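(* Let $n\geq 16$. Among all unicyclic graphs on $n$ vertices, the unicyclic graph with maximal energy is $P_n^6$; that is, $E(G)<E(P_n^6)$ for every unicyclic graph $G$ on $n$ vertices with $G\not\cong P_n^6$.
   Context: All graphs are finite and simple. A unicyclic graph is a connected graph containing exactly one cycle. The energy $E(G)$ of a graph $G$ is $\sum_{i}|\lambda_i|$, where $\lambda_1,\dots,\lambda_n$ are the eigenvalues of the adjacency matrix of $G$. For $\ell\ge 3$ and $n>\ell$, $P_n^{\ell}$ denotes the unicyclic graph obtained by joining, by an edge, a vertex of the cycle $C_\ell$ to a leaf (end vertex) of the path $P_{n-\ell}$ on $n-\ell$ vertices. *)

theory Defs
  imports "Graph_Theory.Graph_Theory" "Jordan_Normal_Form.Char_Poly"
begin

text \<open>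
  A finite simple graph is a \<^locale>\<open>graph\<close>: a finite, loop-free, symmetric digraph
  without parallel arcs, where an undirected edge is a pair of opposite arcs.
  Hence a cycle of the undirected graph is a directed cycle of length at least 3 (the two arcs
  of one edge form a directed cycle of length 2), considered up to starting point and
  orientation, i.e. it is identified with its set of undirected edges.
\<close>

definition cycle_edge_sets :: "('a, 'b) pre_digraph \<Rightarrow> 'a set set set" where
  "cycle_edge_sets G =
     {(\<lambda>e. {tail G e, head G e}) ` set p | p. pre_digraph.cycle G p \<and> 3 \<le> length p}"

definition unicyclic :: "('a, 'b) pre_digraph \<Rightarrow> bool" where
  "unicyclic G \<longleftrightarrow> graph G \<and> connected G \<and> (\<exists>!C. C \<in> cycle_edge_sets G)"

definition adjacency_matrix :: "('a, 'b) pre_digraph \<Rightarrow> 'a list \<Rightarrow> complex mat" where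
  "adjacency_matrix G vs =
     mat (length vs) (length vs) (\<lambda>(i, j). if (vs ! i, vs ! j) \<in> arcs_ends G then 1 else 0)"

text \<open>
  The eigenvalues with multiplicity are the roots of the characteristic polynomial over the
  complex numbers. The choice of the enumeration of the vertices is irrelevant, see
  \<open>energy_eq\<close> below.
\<close>

definition energy :: "('a, 'b) pre_digraph \<Rightarrow> real" where
  "energy G =
     (let vs = (SOME vs. distinct vs \<and> set vs = verts G)
      in \<Sum>x\<in>#proots (char_poly (adjacency_matrix G vs)). cmod x)"

text \<open>
  The graph \<open>P\<^sub>n\<^sup>l\<close>: the cycle has vertices \<open>0, \<dots>, l - 1\<close>, the path has
  vertices \<open>l, \<dots>, n - 1\<close>, and the cycle vertex \<open>0\<close> is joined to the end vertex \<open>l\<close> of the path.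
  It is meaningful for \<open>3 \<le> l < n\<close> only.
\<close>

definition cycle_with_path :: "nat \<Rightarrow> nat \<Rightarrow> (nat, nat \<times> nat) pre_digraph" where
  "cycle_with_path n l = with_proj (mk_symmetric (with_proj
     \<lparr> pverts = {..<n},
       parcs = {(i, Suc i mod l) | i. i < l} \<union> {(0, l)} \<union> {(i, Suc i) | i. l \<le> i \<and> Suc i < n} \<rparr>))"

lemma char_poly_adjacency_matrix_eq:
  assumes "distinct vs" "distinct ws" "set vs = set ws"
  shows "char_poly (adjacency_matrix G vs) = char_poly (adjacency_matrix G ws)"
proof (rule char_poly_similar)
  define n where "n = length vs"
  have n': "length ws = n"
    using assms distinct_card n_def by metis
  define f where "f i = (SOME j. j < n \<and> vs ! j = ws ! i)" for i
  have f: "f i < n" "vs ! (f i) = ws ! i" if "i < n" for i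
  proof -
    have "\<exists>j. j < n \<and> vs ! j = ws ! i"
      using that assms(3) n' n_def by (metis in_set_conv_nth)
    from someI_ex[OF this] show "f i < n" "vs ! (f i) = ws ! i"
      unfolding f_def by auto
  qed
  have inj: "f i = f j \<longleftrightarrow> i = j" if "i < n" "j < n" for i j
    using that f[of i] f[of j] assms(2) n' by (metis nth_eq_iff_index_eq)
  have surj: "\<exists>i<n. f i = j" if "j < n" for j
  proof -
    have "inj_on f {..<n}" using inj by (auto simp: inj_on_def)
    moreover have "f ` {..<n} \<subseteq> {..<n}" using f by auto
    ultimately have "f ` {..<n} = {..<n}"
      by (simp add: endo_inj_surj)
    thus ?thesis using that by (metis imageE lessThan_iff)
  qed
  define P :: "complex mat" where "P = mat n n (\<lambda>(i, j). if j = f i then 1 else 0)"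
  define A where "A = adjacency_matrix G vs"
  define B where "B = adjacency_matrix G ws"
  have A: "A \<in> carrier_mat n n" and B: "B \<in> carrier_mat n n" and P: "P \<in> carrier_mat n n"
    by (auto simp: A_def B_def P_def adjacency_matrix_def n' n_def[symmetric])
  have PP: "P * transpose_mat P = 1\<^sub>m n"
    by (rule eq_matI)
      (auto simp: P_def scalar_prod_def inj f if_distrib[of "\<lambda>x. _ * x"] cong: if_cong)
  have PP': "transpose_mat P * P = 1\<^sub>m n"
    using mat_mult_left_right_inverse[OF P _ PP] P by auto
  have "P * A = B * P"
  proof (rule eq_matI)
    fix i j assume "i < dim_row (B * P)" "j < dim_col (B * P)"
    hence ij: "i < n" "j < n" using B P by auto
    obtain k where k: "k < n" "f k = j" using surj ij by blast
    have "(P * A) $$ (i, j) = (\<Sum>m = 0..<n. P $$ (i, m) * A $$ (m, j))"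
      using ij A P by (simp add: scalar_prod_def)
    also have "\<dots> = (\<Sum>m = 0..<n. if m = f i then A $$ (m, j) else 0)"
      using ij by (intro sum.cong) (auto simp: P_def)
    also have "\<dots> = A $$ (f i, j)" using f ij by simp
    also have "\<dots> = B $$ (i, k)"
      using ij k f n' by (auto simp: A_def B_def adjacency_matrix_def n_def[symmetric])
    also have "\<dots> = (\<Sum>m = 0..<n. if m = k then B $$ (i, m) else 0)" using k by simp
    also have "\<dots> = (\<Sum>m = 0..<n. B $$ (i, m) * P $$ (m, j))"
      using ij k inj by (intro sum.cong) (auto simp: P_def)
    also have "\<dots> = (B * P) $$ (i, j)"
      using ij B P by (simp add: scalar_prod_def)
    finally show "(P * A) $$ (i, j) = (B * P) $$ (i, j)" .
  qed (use A B P in auto)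
  hence "transpose_mat P * (P * A) = transpose_mat P * (B * P)" by simp
  hence "A = transpose_mat P * B * P"
    using A B P PP' assoc_mult_mat[of "transpose_mat P" n n P n A n]
      assoc_mult_mat[of "transpose_mat P" n n B n P n] by simp
  hence "similar_mat_wit A B (transpose_mat P) P"
    using A B P PP PP' by (auto simp: similar_mat_wit_def Let_def)
  thus "similar_mat (adjacency_matrix G vs) (adjacency_matrix G ws)"
    unfolding A_def B_def similar_mat_def by blast
qed

lemma energy_eq:
  assumes "distinct vs" "set vs = verts G"
  shows "energy G = (\<Sum>x\<in>#proots (char_poly (adjacency_matrix G vs)). cmod x)"
proof -
  let ?ws = "SOME vs. distinct vs \<and> set vs = verts G"
  have "distinct ?ws \<and> set ?ws = verts G"
    by (rule someI[of _ vs]) (use assms in simp)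
  thus ?thesis
    using assms char_poly_adjacency_matrix_eq[of ?ws vs G] by (simp add: energy_def Let_def)
qed

lemma cycle_with_path_simps:
  shows "verts (cycle_with_path n l) = {..<n}"
    and "tail (cycle_with_path n l) = fst" and "head (cycle_with_path n l) = snd"
    and "arcs_ends (cycle_with_path n l) = arcs (cycle_with_path n l)"
  by (simp_all add: cycle_with_path_def mk_symmetric_def)

lemma cycle_with_path_arcs:
  "(a, b) \<in> arcs (cycle_with_path n l) \<longleftrightarrow>
     (a < l \<and> b = Suc a mod l) \<or> (b < l \<and> a = Suc b mod l) \<or>
     (a = 0 \<and> b = l) \<or> (a = l \<and> b = 0) \<or>
     (l \<le> a \<and> b = Suc a \<and> b < n) \<or> (l \<le> b \<and> a = Suc b \<and> a < n)"
  by (auto simp: cycle_with_path_def mk_symmetric_def)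

lemma graph_cycle_with_path:
  assumes "3 \<le> l" "l < n"
  shows "graph (cycle_with_path n l)"
proof -
  let ?G = "cycle_with_path n l"
  have lt: "Suc i mod l < n" for i
    using assms by (meson less_trans mod_less_divisor less_le_trans zero_less_numeral)
  have ne: "Suc i mod l \<noteq> i" if "i < l" for i
    using that assms by (simp add: mod_Suc)
  have verts: "a < n \<and> b < n \<and> a \<noteq> b" if "(a, b) \<in> arcs ?G" for a b
    using that assms lt ne ne[symmetric] unfolding cycle_with_path_arcs by auto
  have "arcs ?G \<subseteq> {..<n} \<times> {..<n}" using verts by auto
  hence fin: "finite (arcs ?G)" by (rule finite_subset) simp
  have sym: "(b, a) \<in> arcs ?G" if "(a, b) \<in> arcs ?G" for a b
    using that unfolding cycle_with_path_arcs by blast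
  have "symmetric ?G"
    using sym by (simp add: symmetric_def cycle_with_path_simps sym_def)
  moreover have "tail ?G e \<in> verts ?G \<and> head ?G e \<in> verts ?G \<and> tail ?G e \<noteq> head ?G e"
    if "e \<in> arcs ?G" for e
    using verts[of "fst e" "snd e"] that by (simp add: cycle_with_path_simps)
  moreover have "arc_to_ends ?G e = e" for e
    by (simp add: arc_to_ends_def cycle_with_path_simps)
  ultimately show ?thesis
    using fin by unfold_locales (auto simp: cycle_with_path_simps(1))
qed

lemma connected_cycle_with_path:
  assumes "3 \<le> l" "l < n"
  shows "connected (cycle_with_path n l)"
proof -
  let ?G = "cycle_with_path n l"
  interpret graph ?G by (rule graph_cycle_with_path[OF assms])
  have sym: "y \<rightarrow>\<^sup>*\<^bsub>?G\<^esub> x" if "x \<rightarrow>\<^sup>*\<^bsub>?G\<^esub> y" for x y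
    using that by (rule symmetric_reachable')
  have arc: "a \<rightarrow>\<^sup>*\<^bsub>?G\<^esub> b" if "(a, b) \<in> arcs ?G" for a b
    by (rule reachable_adjI) (use that in \<open>simp add: cycle_with_path_simps\<close>)
  have r: "0 \<rightarrow>\<^sup>*\<^bsub>?G\<^esub> i" if "i < n" for i
    using that
  proof (induction i)
    case 0
    then show ?case by (simp add: cycle_with_path_simps)
  next
    case (Suc i)
    consider "Suc i < l" | "Suc i = l" | "l \<le> i" by linarith
    then show ?case
    proof cases
      case 2
      then show ?thesis by (intro arc) (auto simp: cycle_with_path_arcs)
    next
      case 1
      hence "i \<rightarrow>\<^sup>*\<^bsub>?G\<^esub> Suc i" by (intro arc) (auto simp: cycle_with_path_arcs)
      moreover have "0 \<rightarrow>\<^sup>*\<^bsub>?G\<^esub> i" using Suc by simp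
      ultimately show ?thesis by (metis reachable_trans)
    next
      case 3
      hence "i \<rightarrow>\<^sup>*\<^bsub>?G\<^esub> Suc i" using Suc by (intro arc) (auto simp: cycle_with_path_arcs)
      moreover have "0 \<rightarrow>\<^sup>*\<^bsub>?G\<^esub> i" using Suc by simp
      ultimately show ?thesis by (metis reachable_trans)
    qed
  qed
  have "strongly_connected ?G"
    unfolding strongly_connected_def
  proof (intro conjI ballI)
    show "verts ?G \<noteq> {}" using assms by (auto simp: cycle_with_path_simps)
    fix u v assume "u \<in> verts ?G" "v \<in> verts ?G"
    hence "u \<rightarrow>\<^sup>*\<^bsub>?G\<^esub> 0" "0 \<rightarrow>\<^sup>*\<^bsub>?G\<^esub> v"
      using r sym by (simp_all add: cycle_with_path_simps)
    thus "u \<rightarrow>\<^sup>*\<^bsub>?G\<^esub> v" by (rule reachable_trans)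
  qed
  moreover have "(b, a) \<in> arcs ?G" if "(a, b) \<in> arcs ?G" for a b
    using that unfolding cycle_with_path_arcs by blast
  hence "(\<Union>e\<in>arcs ?G. {(fst e, snd e), (snd e, fst e)}) = arcs ?G"
    by auto
  hence "verts (with_proj (mk_symmetric ?G)) = verts ?G"
    and "arcs_ends (with_proj (mk_symmetric ?G)) = arcs_ends ?G"
    by (simp_all add: mk_symmetric_def cycle_with_path_simps)
  ultimately show ?thesis
    by (simp add: connected_def strongly_connected_def reachable_def)
qed

lemma (in wf_digraph) cycle_steps:
  assumes "cycle p" "3 \<le> length p" "e \<in> set p"
  shows cycle_next: "\<exists>e'\<in>set p. tail G e' = head G e \<and> head G e' \<noteq> tail G e"
    and cycle_prev: "\<exists>e'\<in>set p. head G e' = tail G e \<and> tail G e' \<noteq> head G e"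
proof -
  from assms(1) obtain u where u: "awalk u p u" "distinct (tl (awalk_verts u p))" "p \<noteq> []"
    by (auto simp: cycle_def)
  define k where "k = length p"
  have k: "3 \<le> k" using assms(2) by (simp add: k_def)
  have cas: "cas u p u" using u by (simp add: awalk_def)
  have v1: "awalk_verts u p = tail G (hd p) # map (head G) p"
    using u awalk_verts_conv'[OF cas] by simp
  have dist: "distinct (map (head G) p)" using u v1 by simp
  have hd: "tail G (hd p) = head G (last p)"
    using awhd_if_cas[OF cas] awlast_if_cas[OF cas] v1 u(3) by (simp add: last_map)
  have eq: "map (tail G) p @ [head G (last p)] = tail G (hd p) # map (head G) p"
    using v1 u(3) by (simp add: awalk_verts_conv)
  have step: "tail G (p ! Suc i) = head G (p ! i)" if "Suc i < k" for i
  proof -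
    have "(map (tail G) p @ [head G (last p)]) ! Suc i = (tail G (hd p) # map (head G) p) ! Suc i"
      by (simp only: eq)
    thus ?thesis using that by (simp add: nth_append k_def)
  qed
  have wrap: "tail G (p ! 0) = head G (p ! (k - 1))"
    using hd u(3) by (simp add: hd_conv_nth last_conv_nth k_def)
  have inj: "head G (p ! i) = head G (p ! j) \<longleftrightarrow> i = j" if "i < k" "j < k" for i j
    using dist that nth_eq_iff_index_eq[OF dist, of i j] by (simp add: k_def)
  define nx where "nx i = (if Suc i < k then Suc i else 0)" for i
  define pr where "pr i = (if i = 0 then k - 1 else i - 1)" for i
  have nx: "nx i < k" "tail G (p ! nx i) = head G (p ! i)" if "i < k" for i
  proof -
    show "nx i < k" using k by (simp add: nx_def)
    show "tail G (p ! nx i) = head G (p ! i)"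
    proof (cases "Suc i < k")
      case False
      hence "i = k - 1" using that by simp
      thus ?thesis using wrap False by (simp add: nx_def)
    qed (use step in \<open>simp add: nx_def\<close>)
  qed
  have pr: "pr i < k" "tail G (p ! i) = head G (p ! pr i)" if "i < k" for i
  proof -
    show "pr i < k" using k that by (auto simp: pr_def)
    show "tail G (p ! i) = head G (p ! pr i)"
      using wrap that step[of "i - 1"] by (cases "i = 0") (auto simp: pr_def)
  qed
  from assms(3) obtain i where i: "i < k" "e = p ! i" by (auto simp: in_set_conv_nth k_def)
  have "nx i \<noteq> pr i" using i k by (auto simp: nx_def pr_def split: if_splits)
  hence "head G (p ! nx i) \<noteq> tail G e"
    using inj nx pr i by simp
  moreover have "p ! nx i \<in> set p" using nx i by (simp add: k_def)
  ultimately show "\<exists>e'\<in>set p. tail G e' = head G e \<and> head G e' \<noteq> tail G e"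
    using nx i by auto
  have pp: "pr (pr i) \<noteq> i" "pr (pr i) < k" using i k by (auto simp: pr_def split: if_splits)
  have "tail G (p ! pr i) \<noteq> head G e"
    using inj pp pr[of i] pr(2)[of "pr i"] i by simp
  moreover have "p ! pr i \<in> set p" using pr i by (simp add: k_def)
  ultimately show "\<exists>e'\<in>set p. head G e' = tail G e \<and> tail G e' \<noteq> head G e"
    using pr i by (intro bexI[of _ "p ! pr i"]) auto
qed

lemma Suc_mod_inj:
  assumes "Suc a mod l = Suc b mod l" "a < l" "b < l"
  shows "a = b"
  using assms by (auto simp: mod_Suc split: if_splits)

lemma cycle_edge_sets_cycle_with_path:
  assumes "3 \<le> l" "l < n"
  shows "cycle_edge_sets (cycle_with_path n l) = {{{i, Suc i mod l} | i. i < l}}"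
proof -
  let ?G = "cycle_with_path n l"
  let ?C = "{{i, Suc i mod l} | i. i < l}"
  interpret graph ?G by (rule graph_cycle_with_path[OF assms])
  have "(\<lambda>e. {tail ?G e, head ?G e}) ` set p = ?C" if p: "cycle p" "3 \<le> length p" for p
  proof -
    define S where "S = set p"
    have S: "S \<subseteq> arcs ?G" "S \<noteq> {}" "finite S"
      using p by (auto simp: S_def cycle_def awalk_def)
    have nxt: "\<exists>c. (b, c) \<in> S \<and> c \<noteq> a" if "(a, b) \<in> S" for a b
      using cycle_next[OF p, of "(a, b)"] that by (auto simp: S_def cycle_with_path_simps)
    have prv: "\<exists>c. (c, a) \<in> S \<and> c \<noteq> b" if "(a, b) \<in> S" for a b
      using cycle_prev[OF p, of "(a, b)"] that by (auto simp: S_def cycle_with_path_simps)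
    define m where "m = Max (snd ` S)"
    have le: "a \<le> m" "b \<le> m" if e: "(a, b) \<in> S" for a b
    proof -
      obtain c where "(c, a) \<in> S" using prv e by blast
      thus "a \<le> m" "b \<le> m" using S e unfolding m_def by (force intro: Max_ge)+
    qed
    have "m \<in> snd ` S" unfolding m_def using S by (intro Max_in) auto
    then obtain a where a: "(a, m) \<in> S" by auto
    then obtain c where c: "(m, c) \<in> S" "c \<noteq> a" using nxt by blast
    have modl: "Suc i mod l < l" for i using assms by simp
    have "m < l"
    proof (rule ccontr)
      assume "\<not> m < l"
      hence m: "l \<le> m" by simp
      have "x = (if m = l then 0 else m - 1)"
        if "(x, m) \<in> arcs ?G \<or> (m, x) \<in> arcs ?G" "x \<le> m" for x
        using that m modl[of x] assms unfolding cycle_with_path_arcs by auto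
      thus False using a c le S by (metis subsetD)
    qed
    hence lt: "a < l" "b < l" if "(a, b) \<in> S" for a b
      using le[OF that] by auto
    have arc: "b = Suc a mod l \<or> a = Suc b mod l" if "(a, b) \<in> S" for a b
      using lt[OF that] S that unfolding cycle_with_path_arcs[of _ _ n l]
      by (auto simp: cycle_with_path_arcs)
    have sub: "(\<lambda>e. {fst e, snd e}) ` S \<subseteq> ?C"
      using arc lt by (fastforce simp: insert_commute)
    have all: "?C \<subseteq> (\<lambda>e. {fst e, snd e}) ` S"
      if i: "i < l" and E: "\<And>k. {(i + k) mod l, Suc (i + k) mod l} \<in> (\<lambda>e. {fst e, snd e}) ` S" for i
    proof
      fix X assume "X \<in> ?C"
      then obtain j where j: "j < l" "X = {j, Suc j mod l}" by blast
      have "(i + (l + j - i)) mod l = j" using i j by simp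
      moreover have "Suc (i + (l + j - i)) mod l = Suc j mod l"
        using i j by (metis calculation mod_Suc_eq)
      ultimately show "X \<in> (\<lambda>e. {fst e, snd e}) ` S"
        using E[of "l + j - i"] j by simp
    qed
    obtain a b where ab: "(a, b) \<in> S" using S by auto
    have "?C \<subseteq> (\<lambda>e. {fst e, snd e}) ` S"
    proof (cases "b = Suc a mod l")
      case True
      have "((a + k) mod l, Suc (a + k) mod l) \<in> S" for k
      proof (induction k)
        case 0
        then show ?case using ab True lt[OF ab] by simp
      next
        case (Suc k)
        obtain c where c: "(Suc (a + k) mod l, c) \<in> S" "c \<noteq> (a + k) mod l" using nxt[OF Suc] by blast
        have "Suc c mod l \<noteq> Suc ((a + k) mod l) mod l"
          using c(2) Suc_mod_inj lt[OF c(1)] lt[OF Suc] by blast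
        hence "c = Suc (Suc (a + k) mod l) mod l" using arc[OF c(1)] by (simp add: mod_Suc_eq)
        thus ?case using c by (simp add: mod_Suc_eq)
      qed
      thus ?thesis by (intro all[of a]) (use lt[OF ab] in \<open>auto simp: image_iff\<close>, force)
    next
      case False
      hence a: "a = Suc b mod l" using arc[OF ab] by simp
      have "(Suc (b + k) mod l, (b + k) mod l) \<in> S" for k
      proof (induction k)
        case 0
        then show ?case using ab a lt[OF ab] by simp
      next
        case (Suc k)
        obtain c where c: "(c, Suc (b + k) mod l) \<in> S" "c \<noteq> (b + k) mod l" using prv[OF Suc] by blast
        have "Suc c mod l \<noteq> Suc ((b + k) mod l) mod l"
          using c(2) Suc_mod_inj lt[OF c(1)] lt[OF Suc] by blast
        hence "c = Suc (Suc (b + k) mod l) mod l" using arc[OF c(1)] by (simp add: mod_Suc_eq)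
        thus ?case using c by (simp add: mod_Suc_eq)
      qed
      thus ?thesis by (intro all[of b]) (use lt[OF ab] in \<open>auto simp: image_iff\<close>, force simp: insert_commute)
    qed
    with sub show ?thesis by (simp add: S_def cycle_with_path_simps)
  qed
  moreover have "\<exists>p. cycle p \<and> 3 \<le> length p"
  proof (intro exI conjI)
    let ?p = "map (\<lambda>i. (i, Suc i)) [0..<l - 1] @ [(l - 1, 0)]"
    have cas: "cas 0 (map (\<lambda>i. (i, Suc i)) [0..<k]) k" for k
      by (induction k) (auto simp: cas_append_iff awalk_verts_conv cycle_with_path_simps last_map)
    have "awalk_verts 0 ?p = [0..<l - 1] @ [l - 1, 0]"
      by (simp add: awalk_verts_conv cycle_with_path_simps comp_def)
    moreover have "[0..<l - 1] = 0 # [1..<l - 1]" using assms by (simp add: upt_conv_Cons)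
    ultimately have dist: "distinct (tl (awalk_verts 0 ?p))" using assms by simp
    have "set ?p \<subseteq> arcs ?G" using assms by (auto simp: cycle_with_path_arcs)
    moreover have "cas 0 ?p 0"
      using cas[of "l - 1"] cas_append_iff by (simp add: cycle_with_path_simps awlast_if_cas)
    ultimately show "cycle ?p"
      using dist assms unfolding cycle_def awalk_def
      by (intro exI[of _ 0] conjI) (simp_all only: cycle_with_path_simps, simp_all)
    show "3 \<le> length ?p" using assms by simp
  qed
  ultimately show ?thesis unfolding cycle_edge_sets_def by blast
qed

lemma unicyclic_cycle_with_path:
  assumes "3 \<le> l" "l < n"
  shows "unicyclic (cycle_with_path n l)" and "card (verts (cycle_with_path n l)) = n"
  using assms graph_cycle_with_path connected_cycle_with_path
  by (auto simp: unicyclic_def cycle_edge_sets_cycle_with_path cycle_with_path_simps)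

end

theory Submission
  imports Defs "HOL-Real_Asymp.Real_Asymp"
begin

text \<open>
  Coulson's idea: if two multisets \<open>A\<close>, \<open>B\<close> of nonnegative reals have the same
      size and
  \<open>\<Prod>(x\<^sup>2 + a\<^sup>2) \<le> \<Prod>(x\<^sup>2 + b\<^sup>2)\<close> for all \<open>x >
      0\<close>, then \<open>\<Sum>a \<le> \<Sum>b\<close>. Applied to the spectra of two graphs, this
  reduces the comparison of energies to a pointwise comparison of \<open>|det (x I + \<i> A)|\<close>.

  For a forest this determinant is the matching polynomial (with positive signs), which is at most the
  value \<open>p\<^sub>n\<close> of the path, with equality only for the path. For a unicyclic graph with
      cycle \<open>C\<close> of length
  \<open>l\<close> and a cycle edge \<open>uv\<close> it equals \<open>M + 2 (-
      \<i>)\<^sup>l\<^sup>-\<^sup>2 Q\<close>, where \<open>M\<close> is the sum of the matching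
          polynomials of the
  tree \<open>G - uv\<close> and of the forest \<open>G - u - v\<close>, and \<open>Q\<close> is that of
      the forest \<open>G - C\<close>. If \<open>G\<close> is not the
  cycle, choose \<open>u\<close> with \<open>k \<ge> 1\<close> vertices hanging off it; then \<open>M \<le>
      p\<^sub>n + p\<^sub>k p\<^sub>n\<^sub>-\<^sub>2\<^sub>-\<^sub>k\<close> and
  \<open>Q \<le> p\<^sub>k p\<^sub>n\<^sub>-\<^sub>l\<^sub>-\<^sub>k\<close>, which settles even
      \<open>l\<close>, and odd \<open>l\<close> for even \<open>n\<close>, pointwise.

  For odd \<open>l\<close> and odd \<open>n\<close>, and for the cycle itself, the pointwise inequality
      fails. There the ratio of the
  two determinants is monotone in \<open>n\<close> along each parity class, so it is enough to compare
      energies once, at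
  \<open>n = 14\<close> and \<open>n = 17\<close>; this is done by bounding the polynomials by products of
      explicit linear factors.
\<close>

section \<open>Path polynomials\<close>

text \<open>The failure of the pointwise inequality has two sources. For odd \<open>n\<close>,
  \<open>tadpole_poly x n\<close> is built from path polynomials of odd index and tends to 0 with
  \<open>x\<close>, while an odd cycle adds \<open>4 Q^2\<close> to the squared modulus, and
  \<open>Q\<close> tends to 1 there as soon as \<open>G - C\<close> has a perfect matching. For even
  \<open>n\<close>, the cycle \<open>C_n\<close> has one more matching of size two than
  \<open>P_n^6\<close>, so its polynomial wins for large \<open>x\<close>. Transport from the base
  case needs no further integrals. If the determinant of \<open>P_n^6\<close> divided by the bound
  for \<open>G\<close> grows with \<open>n\<close>, then cross-multiplication gives a pointwise
  inequality between four products: the spectrum of \<open>G\<close> padded with numbers lying below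
  \<open>P_n^6\<close> at the base index, against the spectrum of \<open>P_n^6\<close> padded with
  numbers lying above the bound at the base index. Coulson's comparison of the padded multisets
  leaves two sums of explicit rationals. The base 17 is the first odd \<open>n\<close> in the range;
  the base 14 serves all even \<open>n\<close>, because the bound used for the even cycle ignores
  \<open>n mod 4\<close>.\<close>

fun path_poly :: "real \<Rightarrow> nat \<Rightarrow> real" where
  "path_poly x 0 = 1"
| "path_poly x (Suc 0) = x"
| "path_poly x (Suc (Suc k)) = x * path_poly x (Suc k) + path_poly x k"

lemma path_poly_pos: "0 < x \<Longrightarrow> 0 < path_poly x k"
  by (induction x k rule: path_poly.induct) (auto intro!: add_nonneg_pos mult_nonneg_nonneg)

text \<open>Cuts a path at one edge: the first product counts the matchings that avoid the edge, the
  second those that use it. These are the Fibonacci polynomials with index shifted by one.\<close>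

lemma path_poly_Suc_Suc_add:
  "path_poly x (Suc a + Suc b) = path_poly x (Suc a) * path_poly x (Suc b) + path_poly x a * path_poly x b"
proof (induction x a rule: path_poly.induct)
  case (3 x k)
  have "path_poly x (Suc (Suc (Suc k)) + Suc b) = x * path_poly x (Suc (Suc k) + Suc b) + path_poly x (Suc
      k + Suc b)"
    by simp
  also have "\<dots> = path_poly x (Suc (Suc (Suc k))) * path_poly x (Suc b) + path_poly x (Suc (Suc k)) *
      path_poly x b"
    unfolding 3 by (simp add: algebra_simps)
  finally show ?case .
qed (auto simp: algebra_simps)

lemma path_poly_add:
  assumes "1 \<le> a" "1 \<le> b"
  shows "path_poly x (a + b) = path_poly x a * path_poly x b + path_poly x (a - 1) * path_poly x (b - 1)"
  using path_poly_Suc_Suc_add[of x "a - 1" "b - 1"] assms by simp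

text \<open>One step of the recurrence negates this quadratic form, so only its sign depends on
  \<open>m\<close>.\<close>

lemma path_poly_cassini:
  "(path_poly x (Suc m))\<^sup>2 - x * path_poly x m * path_poly x (Suc m) - (path_poly x m)\<^sup>2 = (-1)
      ^ Suc m"
proof (induction m)
  case (Suc m)
  have "(path_poly x (Suc (Suc m)))\<^sup>2 - x * path_poly x (Suc m) * path_poly x (Suc (Suc m)) -
      (path_poly x (Suc m))\<^sup>2
     = - ((path_poly x (Suc m))\<^sup>2 - x * path_poly x m * path_poly x (Suc m) - (path_poly x m)\<^sup>2)"
    by (simp add: power2_eq_square algebra_simps)
  with Suc show ?case by simp
qed (simp add: power2_eq_square)

lemma path_poly_values:
  "path_poly x 2 = x^2 + 1" "path_poly x 3 = x^3 + 2*x" "path_poly x 4 = x^4 + 3*x^2 + 1"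
  by (simp_all add: numeral_eq_Suc algebra_simps)

text \<open>Only even shifts are monotone: for \<open>x < 1\<close> already
  \<open>path_poly x 0 = 1\<close> exceeds \<open>path_poly x 1 = x\<close>.\<close>

lemma path_poly_mono_even: "0 < x \<Longrightarrow> path_poly x m \<le> path_poly x (m + 2 * k)"
proof (induction k)
  case (Suc k)
  moreover have "0 < x * path_poly x (Suc (m + 2 * k))" using Suc path_poly_pos by simp
  ultimately show ?case by simp
qed simp

lemma path_poly_mult_le:
  assumes "0 < x"
  shows "path_poly x a * path_poly x b \<le> path_poly x (a + b)"
proof (cases "1 \<le> a \<and> 1 \<le> b")
  case True
  have "0 < path_poly x (a - 1) * path_poly x (b - 1)" using assms path_poly_pos by simp
  thus ?thesis using True path_poly_add[of a b x] by simp
qed (use not_less_eq_eq in \<open>auto simp: not_le\<close>)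

text \<open>Among products with a given sum of indices the split \<open>1 + (a + b - 1)\<close> is
  the smallest, since its complementary product is the full
  \<open>path_poly x (a + b - 2)\<close>.\<close>

lemma path_poly_mult_ge:
  assumes "0 < x" "1 \<le> a + b"
  shows "x * path_poly x (a + b - 1) \<le> path_poly x a * path_poly x b"
proof (cases "1 \<le> a \<and> 1 \<le> b")
  case True
  have s: "path_poly x (a + b) = x * path_poly x (a + b - 1) + path_poly x (a + b - 2)"
    using True by (cases a; cases b) auto
  have "path_poly x (a - 1) * path_poly x (b - 1) \<le> path_poly x (a + b - 2)"
    using path_poly_mult_le[OF assms(1), of "a - 1" "b - 1"] True by (simp add: numeral_2_eq_2)
  thus ?thesis using s True path_poly_add[of a b x] by simp
next
  case False
  have "x * path_poly x (c - 1) \<le> path_poly x c" if "1 \<le> c" for c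
    using path_poly_mult_le[OF assms(1), of 1 "c - 1"] that by simp
  thus ?thesis using False assms by (auto simp: not_le)
qed

text \<open>Writing \<open>p\<^sub>a p\<^sub>b = p\<^sub>a\<^sub>+\<^sub>b - p\<^sub>a\<^sub>-\<^sub>1
    p\<^sub>b\<^sub>-\<^sub>1\<close> turns upper bounds for products with a given sum of
  indices into lower bounds for smaller indices, and conversely.\<close>

lemma path_poly_mult_le_2:
  assumes "0 < x" "1 \<le> a" "1 \<le> b" "a + b = s" "3 \<le> s"
  shows "path_poly x a * path_poly x b \<le> path_poly x 2 * path_poly x (s - 2)"
proof -
  have "path_poly x s = path_poly x a * path_poly x b + path_poly x (a - 1) * path_poly x (b - 1)"
    using path_poly_add[of a b x] assms by simp
  moreover have "path_poly x s = path_poly x 2 * path_poly x (s - 2) + x * path_poly x (s - 3)"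
    using path_poly_add[of 2 "s - 2" x] assms by (simp del: add_2_eq_Suc add_2_eq_Suc')
  moreover have "x * path_poly x (s - 3) \<le> path_poly x (a - 1) * path_poly x (b - 1)"
  proof -
    have "a - 1 + (b - 1) - 1 = s - 3" using assms by simp
    thus ?thesis using path_poly_mult_ge[OF assms(1), of "a - 1" "b - 1"] assms by simp
  qed
  ultimately show ?thesis by simp
qed

text \<open>Next in order after the split 2. Lowering both indices twice restores the direction of
  the inequality and leads back to \<open>path_poly_mult_le_2\<close>; an index 2 would drop to 0
  there, whence its exclusion. An index 1 reaches 0 after one step and is treated apart.\<close>

lemma path_poly_mult_le_4:
  assumes "0 < x" "1 \<le> a" "1 \<le> b" "a \<noteq> 2" "b \<noteq> 2" "a + b = s" "7 \<le> s"
  shows "path_poly x a * path_poly x b \<le> path_poly x 4 * path_poly x (s - 4)"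
proof -
  have 1: "path_poly x s = path_poly x a * path_poly x b + path_poly x (a - 1) * path_poly x (b - 1)"
    using path_poly_add[of a b x] assms by simp
  have 2: "path_poly x s = path_poly x 4 * path_poly x (s - 4) + path_poly x 3 * path_poly x (s - 5)"
    using path_poly_add[of 4 "s - 4" x] assms by simp
  have "path_poly x 3 * path_poly x (s - 5) \<le> path_poly x (a - 1) * path_poly x (b - 1)"
  proof (cases "a = 1 \<or> b = 1")
    case True
    have "path_poly x 3 * path_poly x (s - 5) \<le> path_poly x (3 + (s - 5))"
      by (rule path_poly_mult_le[OF assms(1)])
    moreover have "path_poly x (a - 1) * path_poly x (b - 1) = path_poly x (3 + (s - 5))"
      using True assms by auto
    ultimately show ?thesis by simp
  next
    case False
    hence ab: "3 \<le> a" "3 \<le> b" using assms by auto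
    have "path_poly x (s - 2) = path_poly x (a - 1) * path_poly x (b - 1) + path_poly x (a - 2) * path_poly
        x (b - 2)"
      using path_poly_add[of "a - 1" "b - 1" x] ab assms by (simp add: numeral_2_eq_2)
    moreover have "path_poly x (s - 2) = path_poly x 3 * path_poly x (s - 5) + path_poly x 2 * path_poly x
        (s - 6)"
      using path_poly_add[of 3 "s - 5" x] assms by simp
    moreover have "path_poly x (a - 2) * path_poly x (b - 2) \<le> path_poly x 2 * path_poly x (s - 4 - 2)"
      by (rule path_poly_mult_le_2) (use ab assms in auto)
    ultimately show ?thesis by simp
  qed
  thus ?thesis using 1 2 by simp
qed

section \<open>Comparison polynomials\<close>

text \<open>The coefficients are path polynomials again: \<open>path_poly x (m + k)\<close> has the
  coefficients \<open>path_poly x (k - 1)\<close> and \<open>path_poly x (k - 2)\<close>, written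
  out for polynomial arithmetic.\<close>

lemma path_poly_offset:
  shows
    "path_poly x (m + 2) = x * path_poly x (m + 1) + path_poly x m"
    "path_poly x (m + 3) = (x^2 + 1) * path_poly x (m + 1) + (x) * path_poly x m"
    "path_poly x (m + 4) = (x^3 + 2*x) * path_poly x (m + 1) + (x^2 + 1) * path_poly x m"
    "path_poly x (m + 5) = (x^4 + 3*x^2 + 1) * path_poly x (m + 1) + (x^3 + 2*x) * path_poly x m"
    "path_poly x (m + 6) = (x^5 + 4*x^3 + 3*x) * path_poly x (m + 1) + (x^4 + 3*x^2 + 1) * path_poly x m"
    "path_poly x (m + 7) = (x^6 + 5*x^4 + 6*x^2 + 1) * path_poly x (m + 1) + (x^5 + 4*x^3 + 3*x) *
        path_poly x m"
    "path_poly x (m + 8) = (x^7 + 6*x^5 + 10*x^3 + 4*x) * path_poly x (m + 1) + (x^6 + 5*x^4 + 6*x^2 + 1) *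
        path_poly x m"
    "path_poly x (m + 9) = (x^8 + 7*x^6 + 15*x^4 + 10*x^2 + 1) * path_poly x (m + 1) + (x^7 + 6*x^5 +
        10*x^3 + 4*x) * path_poly x m"
    "path_poly x (m + 10) = (x^9 + 8*x^7 + 21*x^5 + 20*x^3 + 5*x) * path_poly x (m + 1) + (x^8 + 7*x^6 +
        15*x^4 + 10*x^2 + 1) * path_poly x m"
    "path_poly x (m + 11) = (x^10 + 9*x^8 + 28*x^6 + 35*x^4 + 15*x^2 + 1) * path_poly x (m + 1) + (x^9 +
        8*x^7 + 21*x^5 + 20*x^3 + 5*x) * path_poly x m"
    "path_poly x (m + 12) = (x^11 + 10*x^9 + 36*x^7 + 56*x^5 + 35*x^3 + 6*x) * path_poly x (m + 1) + (x^10
        + 9*x^8 + 28*x^6 + 35*x^4 + 15*x^2 + 1) * path_poly x m"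
proof -
  show r2: "path_poly x (m + 2) = x * path_poly x (m + 1) + path_poly x m" by simp
  have r: "path_poly x (m + 3) = x * path_poly x (m + 2) + path_poly x (m + 1)"
    "path_poly x (m + 4) = x * path_poly x (m + 3) + path_poly x (m + 2)"
    "path_poly x (m + 5) = x * path_poly x (m + 4) + path_poly x (m + 3)"
    "path_poly x (m + 6) = x * path_poly x (m + 5) + path_poly x (m + 4)"
    "path_poly x (m + 7) = x * path_poly x (m + 6) + path_poly x (m + 5)"
    "path_poly x (m + 8) = x * path_poly x (m + 7) + path_poly x (m + 6)"
    "path_poly x (m + 9) = x * path_poly x (m + 8) + path_poly x (m + 7)"
    "path_poly x (m + 10) = x * path_poly x (m + 9) + path_poly x (m + 8)"
    "path_poly x (m + 11) = x * path_poly x (m + 10) + path_poly x (m + 9)"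
    "path_poly x (m + 12) = x * path_poly x (m + 11) + path_poly x (m + 10)"
    by (simp_all add: numeral_eq_Suc)
  show r3: "path_poly x (m + 3) = (x^2 + 1) * path_poly x (m + 1) + (x) * path_poly x m"
    using r(1) r2 by Groebner_Basis.algebra
  show r4: "path_poly x (m + 4) = (x^3 + 2*x) * path_poly x (m + 1) + (x^2 + 1) * path_poly x m"
    using r(2) r3 r2 by Groebner_Basis.algebra
  show r5: "path_poly x (m + 5) = (x^4 + 3*x^2 + 1) * path_poly x (m + 1) + (x^3 + 2*x) * path_poly x m"
    using r(3) r4 r3 by Groebner_Basis.algebra
  show r6: "path_poly x (m + 6) = (x^5 + 4*x^3 + 3*x) * path_poly x (m + 1) + (x^4 + 3*x^2 + 1) * path_poly
      x m"
    using r(4) r5 r4 by Groebner_Basis.algebra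
  show r7: "path_poly x (m + 7) = (x^6 + 5*x^4 + 6*x^2 + 1) * path_poly x (m + 1) + (x^5 + 4*x^3 + 3*x) *
      path_poly x m"
    using r(5) r6 r5 by Groebner_Basis.algebra
  show r8: "path_poly x (m + 8) = (x^7 + 6*x^5 + 10*x^3 + 4*x) * path_poly x (m + 1) + (x^6 + 5*x^4 + 6*x^2
      + 1) * path_poly x m"
    using r(6) r7 r6 by Groebner_Basis.algebra
  show r9: "path_poly x (m + 9) = (x^8 + 7*x^6 + 15*x^4 + 10*x^2 + 1) * path_poly x (m + 1) + (x^7 + 6*x^5
      + 10*x^3 + 4*x) * path_poly x m"
    using r(7) r8 r7 by Groebner_Basis.algebra
  show r10: "path_poly x (m + 10) = (x^9 + 8*x^7 + 21*x^5 + 20*x^3 + 5*x) * path_poly x (m + 1) + (x^8 +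
      7*x^6 + 15*x^4 + 10*x^2 + 1) * path_poly x m"
    using r(8) r9 r8 by Groebner_Basis.algebra
  show r11: "path_poly x (m + 11) = (x^10 + 9*x^8 + 28*x^6 + 35*x^4 + 15*x^2 + 1) * path_poly x (m + 1) +
      (x^9 + 8*x^7 + 21*x^5 + 20*x^3 + 5*x) * path_poly x m"
    using r(9) r10 r9 by Groebner_Basis.algebra
  show r12: "path_poly x (m + 12) = (x^11 + 10*x^9 + 36*x^7 + 56*x^5 + 35*x^3 + 6*x) * path_poly x (m + 1)
      + (x^10 + 9*x^8 + 28*x^6 + 35*x^4 + 15*x^2 + 1) * path_poly x m"
    using r(10) r11 r10 by Groebner_Basis.algebra
qed

text \<open>
  The value of the determinant for \<open>P\<^sub>n\<^sup>6\<close>: its matching polynomial is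
      \<open>p\<^sub>n + p\<^sub>4 p\<^sub>n\<^sub>-\<^sub>6\<close>, and the hexagon
  contributes \<open>2 p\<^sub>n\<^sub>-\<^sub>6\<close>.
\<close>

definition tadpole_poly :: "real \<Rightarrow> nat \<Rightarrow> real" where
  "tadpole_poly x n = path_poly x n + (path_poly x 4 + 2) * path_poly x (n - 6)"

text \<open>
  A common bound for the squared determinants of all noncycle unicyclic graphs with an odd cycle; it is not
  attained by a graph.
\<close>

definition triangle_poly :: "real \<Rightarrow> nat \<Rightarrow> real" where
  "triangle_poly x n = (path_poly x n + path_poly x 2 * path_poly x (n - 4))\<^sup>2 + 4 * (path_poly x 2 *
      path_poly x (n - 5))\<^sup>2"

lemma tadpole_poly_pos: "0 < x \<Longrightarrow> 0 < tadpole_poly x n"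
  unfolding tadpole_poly_def by (intro add_pos_pos mult_pos_pos path_poly_pos) auto

text \<open>
  Everything is expressed in \<open>p\<^sub>m\<close> and \<open>p\<^sub>m\<^sub>+\<^sub>1\<close> with
      \<open>m = n - 10\<close>, so that the differences become polynomials with
  nonnegative coefficients. The parity of \<open>n\<close> enters only through Cassini's identity.
\<close>

context
  fixes x :: real and n m :: nat
  assumes x: "0 < x" and n: "n = m + 10"
begin

lemma path_poly_index_shift: "path_poly x n = path_poly x (m + 10)" "path_poly x (n - 2) = path_poly x (m +
    8)"
  "path_poly x (n - 3) = path_poly x (m + 7)" "path_poly x (n - 4) = path_poly x (m + 6)"
  "path_poly x (n - 5) = path_poly x (m + 5)" "path_poly x (n - 6) = path_poly x (m + 4)"
  "path_poly x (n - 8) = path_poly x (m + 2)" "path_poly x (n - 10) = path_poly x m"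
  "path_poly x (n + 2) = path_poly x (m + 12)" "path_poly x (n + 2 - 4) = path_poly x (m + 8)"
  "path_poly x (n + 2 - 5) = path_poly x (m + 7)" "path_poly x (n + 2 - 6) = path_poly x (m + 6)"
  "path_poly x (n + 2 - 2) = path_poly x (m + 10)"
  "path_poly x (n - 1) = path_poly x (m + 9)" "path_poly x (n + 2 - 1) = path_poly x (m + 11)"
  using n by (simp_all add: add.commute)

lemma path_poly_pos_pair: "0 < path_poly x m" "0 < path_poly x (m + 1)"
  using x path_poly_pos by auto

text \<open>For a cycle length divisible by 4 the modulus is \<open>\<bar>M - 2 * Q\<bar>\<close>.
  This bound on \<open>M\<close> and the next one on \<open>2 * Q\<close> cover its two
  signs.\<close>

lemma tadpole_gt_matching: "path_poly x n + path_poly x 2 * path_poly x (n - 4) < tadpole_poly x n" (is "?l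
    < ?r")
proof -
  have "?r - ?l = (2*x^2 + 2) * path_poly x m + (2*x^3 + 3*x) * path_poly x (m + 1)"
    unfolding tadpole_poly_def triangle_poly_def path_poly_values path_poly_index_shift
    unfolding path_poly_offset[of x m] by Groebner_Basis.algebra
  also have "0 < \<dots>"
    using path_poly_pos_pair x by (auto intro!: add_pos_pos add_nonneg_pos add_pos_nonneg mult_pos_pos)
  finally show ?thesis by simp
qed

lemma tadpole_gt_twice_path: "2 * path_poly x (n - 4) < tadpole_poly x n" (is "?l < ?r")
proof -
  have "?r - ?l = (x^8 + 8*x^6 + 17*x^4 + 10*x^2 + 2) * path_poly x m + (x^9 + 9*x^7 + 24*x^5 + 21*x^3 +
      5*x) * path_poly x (m + 1)"
    unfolding tadpole_poly_def triangle_poly_def path_poly_values path_poly_index_shift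
    unfolding path_poly_offset[of x m] by Groebner_Basis.algebra
  also have "0 < \<dots>"
    using path_poly_pos_pair x by (auto intro!: add_pos_pos add_nonneg_pos add_pos_nonneg mult_pos_pos)
  finally show ?thesis by simp
qed

text \<open>Serves the cycle lengths \<open>l \<ge> 10\<close> with \<open>l mod 4 = 2\<close>,
  where \<open>2 * Q\<close> is added.\<close>

lemma tadpole_gt_matching_10: "path_poly x n + path_poly x 2 * path_poly x (n - 4) + 2 * path_poly x (n -
    10) < tadpole_poly x n" (is "?l < ?r")
proof -
  have "?r - ?l = (2*x^2) * path_poly x m + (2*x^3 + 3*x) * path_poly x (m + 1)"
    unfolding tadpole_poly_def triangle_poly_def path_poly_values path_poly_index_shift
    unfolding path_poly_offset[of x m] by Groebner_Basis.algebra
  also have "0 < \<dots>"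
    using path_poly_pos_pair x by (auto intro!: add_pos_pos add_nonneg_pos add_pos_nonneg mult_pos_pos)
  finally show ?thesis by simp
qed

text \<open>The tightest case: a hexagon with exactly two vertices hanging off the chosen cycle
  vertex. The margin is a single term.\<close>

lemma tadpole_gt_matching_8: "path_poly x n + path_poly x 2 * path_poly x (n - 4) + 2 * (path_poly x 2 *
    path_poly x (n - 8)) < tadpole_poly x n" (is "?l < ?r")
proof -
  have "?r - ?l = x * path_poly x (m + 1)"
    unfolding tadpole_poly_def triangle_poly_def path_poly_values path_poly_index_shift
    unfolding path_poly_offset[of x m] by Groebner_Basis.algebra
  also have "0 < \<dots>"
    using path_poly_pos_pair x by (auto intro!: add_pos_pos add_nonneg_pos add_pos_nonneg mult_pos_pos)
  finally show ?thesis by simp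
qed

text \<open>Covers a triangle with all other vertices hanging off one of its vertices; there the
  second factor in the bound for \<open>Q\<close> has index 0 and \<open>path_poly_mult_le_2\<close>
  does not apply.\<close>

lemma triangle_tail_le: "(path_poly x n + x * path_poly x (n - 3))\<^sup>2 + 4 * (path_poly x (n -
    3))\<^sup>2 \<le> triangle_poly x n" (is "?l \<le> ?r")
proof -
  have "?r - ?l = ((x^2 + 1) * path_poly x m + (x^3 + 2*x) * path_poly x (m + 1)) * ((2*x^8 + 8*x^6 +
      10*x^4 + 7*x^2 + 3) * path_poly x m + (2*x^9 + 10*x^7 + 16*x^5 + 13*x^3 + 6*x) * path_poly x (m + 1))"
    unfolding tadpole_poly_def triangle_poly_def path_poly_values path_poly_index_shift
    unfolding path_poly_offset[of x m] by Groebner_Basis.algebra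
  also have "0 < \<dots>"
    using path_poly_pos_pair x by (auto intro!: add_pos_pos add_nonneg_pos add_pos_nonneg mult_pos_pos)
  finally show ?thesis by simp
qed

lemma triangle_less_tadpole:
  assumes "even n"
  shows "triangle_poly x n < (tadpole_poly x n)\<^sup>2" (is "?l < ?r")
proof -
  have k: "(path_poly x (m + 1))\<^sup>2 - x * path_poly x m * path_poly x (m + 1) - (path_poly x
      m)\<^sup>2 = - 1"
    using path_poly_cassini[of x m] assms n by simp
  \<comment> \<open>For even \<open>n\<close> the Cassini form is -1, so the last summand
    contributes 4. For odd \<open>n\<close> it would contribute -4 and the difference would be
    negative near \<open>x = 0\<close>.\<close>
  have "?r - ?l = (12*x^8 + 56*x^6 + 88*x^4 + 56*x^2 + 8) * (path_poly x m)\<^sup>2 + (22*x^9 + 120*x^7 +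
      222*x^5 + 164*x^3 + 36*x) * (path_poly x m * path_poly x (m + 1)) + (10*x^10 + 62*x^8 + 132*x^6 +
          110*x^4 + 25*x^2) * (path_poly x (m + 1))\<^sup>2 - 4 * ((path_poly x (m + 1))\<^sup>2 - x *
            path_poly x m * path_poly x (m + 1) - (path_poly x m)\<^sup>2)"
    unfolding tadpole_poly_def triangle_poly_def path_poly_values path_poly_index_shift
    unfolding path_poly_offset[of x m] by Groebner_Basis.algebra
  also have "\<dots> = (12*x^8 + 56*x^6 + 88*x^4 + 56*x^2 + 8) * (path_poly x m)\<^sup>2 + (22*x^9 +
      120*x^7 + 222*x^5 + 164*x^3 + 36*x) * (path_poly x m * path_poly x (m + 1)) + (10*x^10 + 62*x^8 +
          132*x^6 + 110*x^4 + 25*x^2) * (path_poly x (m + 1))\<^sup>2 + 4" unfolding k by simp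
  also have "0 < \<dots>"
    using path_poly_pos_pair x by (auto intro!: add_pos_pos add_nonneg_pos add_pos_nonneg mult_pos_pos)
  finally show ?thesis by simp
qed

section \<open>Monotone ratios along a parity class\<close>

context
  assumes odd: "odd n"
begin

lemma path_poly_cassini_odd: "(path_poly x (m + 1))\<^sup>2 - x * path_poly x m * path_poly x (m + 1) -
    (path_poly x m)\<^sup>2 = 1"
  using path_poly_cassini[of x m] odd n by simp

text \<open>Both sequences solve the same linear recurrence, so the cross difference is a
  Casoratian: a polynomial in \<open>x\<close> times the Cassini form, whose value is 1 here. The
  next two lemmas have the same reason.\<close>

lemma tadpole_ratio_path: "tadpole_poly x n * path_poly x (n + 2 - 1) \<le> tadpole_poly x (n + 2) *
    path_poly x (n - 1)" (is "?l \<le> ?r")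
proof -
  have "?r - ?l = (x^9 + 6*x^7 + 13*x^5 + 12*x^3 + 4*x) * ((path_poly x (m + 1))\<^sup>2 - x * path_poly x
      m * path_poly x (m + 1) - (path_poly x m)\<^sup>2)"
    unfolding tadpole_poly_def triangle_poly_def path_poly_values path_poly_index_shift
    unfolding path_poly_offset[of x m] by Groebner_Basis.algebra
  also have "\<dots> = x^9 + 6*x^7 + 13*x^5 + 12*x^3 + 4*x" unfolding path_poly_cassini_odd by simp
  also have "0 < \<dots>"
    using x by (auto intro!: add_pos_pos add_nonneg_pos add_pos_nonneg mult_pos_pos)
  finally show ?thesis by simp
qed

lemma tadpole_ratio_matching: "(path_poly x (n + 2) + path_poly x 2 * path_poly x (n + 2 - 4)) *
    tadpole_poly x n \<le> (path_poly x n + path_poly x 2 * path_poly x (n - 4)) * tadpole_poly x (n + 2)"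
        (is "?l \<le> ?r")
proof -
  have "?r - ?l = (x^10 + 8*x^8 + 21*x^6 + 24*x^4 + 10*x^2) * ((path_poly x (m + 1))\<^sup>2 - x *
      path_poly x m * path_poly x (m + 1) - (path_poly x m)\<^sup>2)"
    unfolding tadpole_poly_def triangle_poly_def path_poly_values path_poly_index_shift
    unfolding path_poly_offset[of x m] by Groebner_Basis.algebra
  also have "\<dots> = x^10 + 8*x^8 + 21*x^6 + 24*x^4 + 10*x^2" unfolding path_poly_cassini_odd by simp
  also have "0 < \<dots>"
    using x by (auto intro!: add_pos_pos add_nonneg_pos add_pos_nonneg mult_pos_pos)
  finally show ?thesis by simp
qed

lemma tadpole_ratio_path_5: "path_poly x (n + 2 - 5) * tadpole_poly x n \<le> path_poly x (n - 5) *
    tadpole_poly x (n + 2)" (is "?l \<le> ?r")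
proof -
  have "?r - ?l = (2*x^5 + 6*x^3 + 4*x) * ((path_poly x (m + 1))\<^sup>2 - x * path_poly x m * path_poly x
      (m + 1) - (path_poly x m)\<^sup>2)"
    unfolding tadpole_poly_def triangle_poly_def path_poly_values path_poly_index_shift
    unfolding path_poly_offset[of x m] by Groebner_Basis.algebra
  also have "\<dots> = 2*x^5 + 6*x^3 + 4*x" unfolding path_poly_cassini_odd by simp
  also have "0 < \<dots>"
    using x by (auto intro!: add_pos_pos add_nonneg_pos add_pos_nonneg mult_pos_pos)
  finally show ?thesis by simp
qed

text \<open>\<open>triangle_poly\<close> is a sum of two squares, and each of them shrinks relative
  to the squared tadpole value, so no difference of degree four in the path polynomials has to be
  expanded.\<close>

lemma triangle_ratio: "triangle_poly x (n + 2) * (tadpole_poly x n)\<^sup>2 \<le> triangle_poly x n *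
    (tadpole_poly x (n + 2))\<^sup>2"
proof -
  have nn: "0 \<le> path_poly x k" "0 \<le> tadpole_poly x k" for k
    using path_poly_pos[OF x] tadpole_poly_pos[OF x] less_imp_le by blast+
  have "((path_poly x (n + 2) + path_poly x 2 * path_poly x (n + 2 - 4)) * tadpole_poly x n)\<^sup>2
      \<le> ((path_poly x n + path_poly x 2 * path_poly x (n - 4)) * tadpole_poly x (n + 2))\<^sup>2"
    by (rule power_mono[OF tadpole_ratio_matching]) (intro mult_nonneg_nonneg add_nonneg_nonneg nn)
  moreover have "(path_poly x 2 * (path_poly x (n + 2 - 5) * tadpole_poly x n))\<^sup>2
      \<le> (path_poly x 2 * (path_poly x (n - 5) * tadpole_poly x (n + 2)))\<^sup>2"
    by (intro power_mono mult_left_mono tadpole_ratio_path_5 mult_nonneg_nonneg nn)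
  moreover have "(A\<^sup>2 + 4 * (K * C)\<^sup>2) * d\<^sup>2 \<le> (B\<^sup>2 + 4 * (K * F)\<^sup>2) *
      e\<^sup>2"
    if "(A * d)\<^sup>2 \<le> (B * e)\<^sup>2" "(K * (C * d))\<^sup>2 \<le> (K * (F * e))\<^sup>2" for A B
        C d e F K :: real
    using that by (simp add: power_mult_distrib algebra_simps)
  ultimately show ?thesis
    unfolding triangle_poly_def by blast
qed

end

text \<open>For even \<open>n\<close> the Cassini form has the wrong sign. The constant 2 of the
  cycle bound yields terms linear in the path polynomials that outweigh it, given the lower bounds 1
  and \<open>x\<close>, which are the values at \<open>m = 0\<close>.\<close>

lemma tadpole_ratio_cycle:
  assumes "even n"
  shows "tadpole_poly x n * (path_poly x (n + 2) + path_poly x (n + 2 - 2) + 2) \<le> tadpole_poly x (n +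
      2) * (path_poly x n + path_poly x (n - 2) + 2)" (is "?l \<le> ?r")
proof -
  have k: "(path_poly x (m + 1))\<^sup>2 - x * path_poly x m * path_poly x (m + 1) - (path_poly x
      m)\<^sup>2 = - 1"
    using path_poly_cassini[of x m] assms n by simp
  have m: "m = 0 + 2 * (m div 2)" "m + 1 = 1 + 2 * (m div 2)" using assms n by auto
  have ge: "1 \<le> path_poly x m" "x \<le> path_poly x (m + 1)"
    using path_poly_mono_even[OF x, of 0 "m div 2"] path_poly_mono_even[OF x, of 1 "m div 2"] m by auto
  have "?r - ?l = (2*x^10 + 18*x^8 + 52*x^6 + 58*x^4 + 22*x^2) * path_poly x m + (2*x^11 + 20*x^9 + 68*x^7
      + 96*x^5 + 54*x^3 + 8*x) * path_poly x (m + 1) + (x^10 + 8*x^8 + 23*x^6 + 30*x^4 + 14*x^2) *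
          ((path_poly x (m + 1))\<^sup>2 - x * path_poly x m * path_poly x (m + 1) - (path_poly x m)\<^sup>2)"
    unfolding tadpole_poly_def triangle_poly_def path_poly_values path_poly_index_shift
    unfolding path_poly_offset[of x m] by Groebner_Basis.algebra
  also have "\<dots> = (2*x^10 + 18*x^8 + 52*x^6 + 58*x^4 + 22*x^2) * path_poly x m + (2*x^11 + 20*x^9 +
      68*x^7 + 96*x^5 + 54*x^3 + 8*x) * path_poly x (m + 1) - (x^10 + 8*x^8 + 23*x^6 + 30*x^4 + 14*x^2)"
          unfolding k by simp
  also have "\<dots> \<ge> (2*x^10 + 18*x^8 + 52*x^6 + 58*x^4 + 22*x^2) * 1 + (2*x^11 + 20*x^9 + 68*x^7 +
      96*x^5 + 54*x^3 + 8*x) * x - (x^10 + 8*x^8 + 23*x^6 + 30*x^4 + 14*x^2)"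
    using x ge by (intro diff_right_mono add_mono mult_left_mono) auto
  also have "(2*x^10 + 18*x^8 + 52*x^6 + 58*x^4 + 22*x^2) * 1 + (2*x^11 + 20*x^9 + 68*x^7 + 96*x^5 + 54*x^3
      + 8*x) * x - (x^10 + 8*x^8 + 23*x^6 + 30*x^4 + 14*x^2) = 2*x^12 + 21*x^10 + 78*x^8 + 125*x^6 + 82*x^4
          + 16*x^2"
    by Groebner_Basis.algebra
  finally have "2*x^12 + 21*x^10 + 78*x^8 + 125*x^6 + 82*x^4 + 16*x^2 \<le> ?r - ?l" .
  moreover have "0 \<le> 2*x^12 + 21*x^10 + 78*x^8 + 125*x^6 + 82*x^4 + 16*x^2" using x by (auto intro!:
      add_nonneg_nonneg)
  ultimately show ?thesis by linarith
qed

end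

text \<open>For odd \<open>n\<close> the squared eigenvalues of the cycle are 4 together with those
  of the path on \<open>n - 1\<close> vertices. The factorisation lets a certificate for a path
  serve the odd cycle.\<close>

lemma cycle_odd_eq:
  assumes "odd n" "3 \<le> n"
  shows "(path_poly x n + path_poly x (n - 2))\<^sup>2 + 4 = (x\<^sup>2 + 4) * (path_poly x (n - 1))\<^sup>2"
proof -
  define m where "m = n - 2"
  have n: "n = m + 2" "odd m" using assms by (auto simp: m_def)
  have "(path_poly x (m + 1))\<^sup>2 - x * path_poly x m * path_poly x (m + 1) - (path_poly x m)\<^sup>2 = 1"
    using path_poly_cassini[of x m] n by simp
  moreover have "path_poly x (m + 2) = x * path_poly x (m + 1) + path_poly x m" by simp
  ultimately have "(path_poly x (m + 2) + path_poly x m)\<^sup>2 + 4 = (x\<^sup>2 + 4) * (path_poly x (m +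
      1))\<^sup>2"
    by Groebner_Basis.algebra
  thus ?thesis using n by simp
qed

lemma ratio_mono_iterate:
  fixes F G :: "nat \<Rightarrow> real"
  assumes "\<And>k. 0 < F k" "\<And>k. 0 < G k" "\<And>k. F k * G (Suc k) \<le> F (Suc k) * G k"
  shows "F 0 * G k \<le> F k * G 0"
proof -
  have "F 0 / G 0 \<le> F k / G k"
  proof (induction k)
    case (Suc k)
    have "F k / G k \<le> F (Suc k) / G (Suc k)" using assms by (simp add: divide_simps)
    with Suc show ?case by linarith
  qed simp
  thus ?thesis using assms by (simp add: divide_simps)
qed

section \<open>Certificates for the base cases\<close>

lemma path_poly_values_large:

  "path_poly x 8 = x^8 + 7*x^6 + 15*x^4 + 10*x^2 + 1"
  "path_poly x 10 = x^10 + 9*x^8 + 28*x^6 + 35*x^4 + 15*x^2 + 1"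
  "path_poly x 11 = x^11 + 10*x^9 + 36*x^7 + 56*x^5 + 35*x^3 + 6*x"
  "path_poly x 12 = x^12 + 11*x^10 + 45*x^8 + 84*x^6 + 70*x^4 + 21*x^2 + 1"
  "path_poly x 13 = x^13 + 12*x^11 + 55*x^9 + 120*x^7 + 126*x^5 + 56*x^3 + 7*x"
  "path_poly x 14 = x^14 + 13*x^12 + 66*x^10 + 165*x^8 + 210*x^6 + 126*x^4 + 28*x^2 + 1"
  "path_poly x 16 = x^16 + 15*x^14 + 91*x^12 + 286*x^10 + 495*x^8 + 462*x^6 + 210*x^4 + 36*x^2 + 1"
  "path_poly x 17 = x^17 + 16*x^15 + 105*x^13 + 364*x^11 + 715*x^9 + 792*x^7 + 462*x^5 + 120*x^3 + 9*x"
proof -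
  have r: "path_poly x 5 = x * path_poly x 4 + path_poly x 3"
    "path_poly x 6 = x * path_poly x 5 + path_poly x 4"
    "path_poly x 7 = x * path_poly x 6 + path_poly x 5"
    "path_poly x 8 = x * path_poly x 7 + path_poly x 6"
    "path_poly x 9 = x * path_poly x 8 + path_poly x 7"
    "path_poly x 10 = x * path_poly x 9 + path_poly x 8"
    "path_poly x 11 = x * path_poly x 10 + path_poly x 9"
    "path_poly x 12 = x * path_poly x 11 + path_poly x 10"
    "path_poly x 13 = x * path_poly x 12 + path_poly x 11"
    "path_poly x 14 = x * path_poly x 13 + path_poly x 12"
    "path_poly x 15 = x * path_poly x 14 + path_poly x 13"
    "path_poly x 16 = x * path_poly x 15 + path_poly x 14"
    "path_poly x 17 = x * path_poly x 16 + path_poly x 15"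
    by (simp_all add: numeral_eq_Suc)
  have r5: "path_poly x 5 = x^5 + 4*x^3 + 3*x"
    using r(1) path_poly_values(3)[of x] path_poly_values(2)[of x] by Groebner_Basis.algebra
  have r6: "path_poly x 6 = x^6 + 5*x^4 + 6*x^2 + 1"
    using r(2) r5 path_poly_values(3)[of x] by Groebner_Basis.algebra
  have r7: "path_poly x 7 = x^7 + 6*x^5 + 10*x^3 + 4*x"
    using r(3) r6 r5 by Groebner_Basis.algebra
  show r8: "path_poly x 8 = x^8 + 7*x^6 + 15*x^4 + 10*x^2 + 1"
    using r(4) r7 r6 by Groebner_Basis.algebra
  have r9: "path_poly x 9 = x^9 + 8*x^7 + 21*x^5 + 20*x^3 + 5*x"
    using r(5) r8 r7 by Groebner_Basis.algebra
  show r10: "path_poly x 10 = x^10 + 9*x^8 + 28*x^6 + 35*x^4 + 15*x^2 + 1"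
    using r(6) r9 r8 by Groebner_Basis.algebra
  show r11: "path_poly x 11 = x^11 + 10*x^9 + 36*x^7 + 56*x^5 + 35*x^3 + 6*x"
    using r(7) r10 r9 by Groebner_Basis.algebra
  show r12: "path_poly x 12 = x^12 + 11*x^10 + 45*x^8 + 84*x^6 + 70*x^4 + 21*x^2 + 1"
    using r(8) r11 r10 by Groebner_Basis.algebra
  show r13: "path_poly x 13 = x^13 + 12*x^11 + 55*x^9 + 120*x^7 + 126*x^5 + 56*x^3 + 7*x"
    using r(9) r12 r11 by Groebner_Basis.algebra
  show r14: "path_poly x 14 = x^14 + 13*x^12 + 66*x^10 + 165*x^8 + 210*x^6 + 126*x^4 + 28*x^2 + 1"
    using r(10) r13 r12 by Groebner_Basis.algebra
  have r15: "path_poly x 15 = x^15 + 14*x^13 + 78*x^11 + 220*x^9 + 330*x^7 + 252*x^5 + 84*x^3 + 8*x"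
    using r(11) r14 r13 by Groebner_Basis.algebra
  show r16: "path_poly x 16 = x^16 + 15*x^14 + 91*x^12 + 286*x^10 + 495*x^8 + 462*x^6 + 210*x^4 + 36*x^2 + 1"
    using r(12) r15 r14 by Groebner_Basis.algebra
  show r17: "path_poly x 17 = x^17 + 16*x^15 + 105*x^13 + 364*x^11 + 715*x^9 + 792*x^7 + 462*x^5 + 120*x^3
      + 9*x"
    using r(13) r16 r15 by Groebner_Basis.algebra
qed

text \<open>
  The integers in the lists below are \<open>10\<^sup>4\<close> times the square roots of the negated zeros
      (in \<open>x\<^sup>2\<close>) of the
  polynomials, rounded down for lower and up for upper bounds; domination then holds coefficientwise. The
  polynomial \<open>triangle_poly x 17\<close> is not real-rooted; its list comes from numerically
      minimising the sum
  subject to coefficientwise domination.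
\<close>

lemma le_of_scaled_diff: "0 < c \<Longrightarrow> c * a - c * b = d \<Longrightarrow> 0 \<le> d
    \<Longrightarrow> b \<le> a" for a :: real
  by auto

text \<open>Clears denominators, one \<open>10^8\<close> for each factor, so that the certificates
  become identities with integer coefficients.\<close>

lemma prod_list_scale:
  fixes x :: real
  shows "10 ^ (8 * length ks) * (\<Prod>k\<leftarrow>ks. x\<^sup>2 + (k / 10^4)\<^sup>2) =
      (\<Prod>k\<leftarrow>ks. 10^8 * x\<^sup>2 + k\<^sup>2)"
proof (induction ks)
  case (Cons k ks)
  have "10^8 * (x\<^sup>2 + (k / 10^4)\<^sup>2) = 10^8 * x\<^sup>2 + k\<^sup>2"
    by (simp add: power_divide distrib_left)
  hence "(10^8 * (x\<^sup>2 + (k / 10^4)\<^sup>2)) * (10 ^ (8 * length ks) * (\<Prod>k\<leftarrow>ks.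
      x\<^sup>2 + (k / 10^4)\<^sup>2))
      = (10^8 * x\<^sup>2 + k\<^sup>2) * (\<Prod>k\<leftarrow>ks. 10^8 * x\<^sup>2 + k\<^sup>2)"
    by (simp only: Cons)
  moreover have "(10::real) ^ (8 * length (k # ks)) = 10^8 * 10 ^ (8 * length ks)"
    by (simp add: power_add)
  ultimately show ?case by (simp only: list.map prod_list.Cons mult_ac)
qed simp

context
  fixes x :: real
  assumes x: "0 < x"
begin

lemma tadpole_14_ge: "(\<Prod>k\<leftarrow>[2973, 8454, 10000, 12534, 15747, 18675, 21582]. x\<^sup>2 + (k
    / 10^4)\<^sup>2) \<le> tadpole_poly x 14" (is "?l \<le> ?r")
proof -
  let ?P = "\<Prod>k\<leftarrow>[2973, 8454, 10000, 12534, 15747, 18675, 21582]. x\<^sup>2 + (k /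
      10^4)\<^sup>2"
  have e: "10^56 * ?P = (10^8 * x\<^sup>2 + 2973\<^sup>2) * (10^8 * x\<^sup>2 + 8454\<^sup>2) * (10^8 *
      x\<^sup>2 +
      10000\<^sup>2) * (10^8 * x\<^sup>2 + 12534\<^sup>2) * (10^8 * x\<^sup>2 + 15747\<^sup>2) * (10^8 *
      x\<^sup>2 + 18675\<^sup>2) * (10^8 * x\<^sup>2 + 21582\<^sup>2)"
    using prod_list_scale[of "[2973, 8454, 10000, 12534, 15747, 18675, 21582]" x] by (simp add: mult.assoc)
  have v: "tadpole_poly x 14 = (x^14 + 14*x^12 + 76*x^10 + 204*x^8 + 286*x^6 + 202*x^4 + 61*x^2 + 4)"
    by (simp add: tadpole_poly_def path_poly_values_large path_poly_values(3)) Groebner_Basis.algebra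
  have "10^56 * (x^14 + 14*x^12 + 76*x^10 + 204*x^8 + 286*x^6 + 202*x^4 + 61*x^2 + 4) - 10^56 * ?P =
      83641000000000000000000000000000000000000000000000000*x^12 +
      866135327666170000000000000000000000000000000000000000*x^10 +
      3330693759570380093640300000000000000000000000000000000*x^8 +
      5988813439558469737474704838084000000000000000000000000*x^6 +
      5225837497916611297441232794814352902560000000000000000*x^4 +
      2030192177535348427675009708470847039295644000000000000*x^2 +
      244968687272996774068181751740494136735644000000000000"
    unfolding e by Groebner_Basis.algebra
  moreover have "0 \<le> 83641000000000000000000000000000000000000000000000000*x^12 +
      866135327666170000000000000000000000000000000000000000*x^10 +
      3330693759570380093640300000000000000000000000000000000*x^8 +
      5988813439558469737474704838084000000000000000000000000*x^6 +
      5225837497916611297441232794814352902560000000000000000*x^4 +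
      2030192177535348427675009708470847039295644000000000000*x^2 +
      244968687272996774068181751740494136735644000000000000"
    using x by (intro add_nonneg_nonneg mult_nonneg_nonneg zero_le_power) simp_all
  ultimately have "?P \<le> x^14 + 14*x^12 + 76*x^10 + 204*x^8 + 286*x^6 + 202*x^4 + 61*x^2 + 4" by (rule
      le_of_scaled_diff[rotated]) simp
  thus ?thesis unfolding v .
qed

text \<open>The entries are \<open>2 cos (pi j / 7)\<close> for \<open>j = 0, ..., 3\<close>,
  rounded up: the eigenvalues of the cycle on 14 vertices, for which the summand 2 has its true
  sign.\<close>

lemma cycle_14_le: "path_poly x 14 + path_poly x 12 + 2 \<le> (\<Prod>k\<leftarrow>[20000, 18020, 18020,
    12470, 12470, 4451, 4451]. x\<^sup>2 + (k / 10^4)\<^sup>2)" (is "?l \<le> ?r")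
proof -
  let ?P = "\<Prod>k\<leftarrow>[20000, 18020, 18020, 12470, 12470, 4451, 4451]. x\<^sup>2 + (k /
      10^4)\<^sup>2"
  have e: "10^56 * ?P = (10^8 * x\<^sup>2 + 20000\<^sup>2) * (10^8 * x\<^sup>2 + 18020\<^sup>2) * (10^8 *
      x\<^sup>2 +
      18020\<^sup>2) * (10^8 * x\<^sup>2 + 12470\<^sup>2) * (10^8 * x\<^sup>2 + 12470\<^sup>2) * (10^8 *
      x\<^sup>2 + 4451\<^sup>2) * (10^8 * x\<^sup>2 + 4451\<^sup>2)"
    using prod_list_scale[of "[20000, 18020, 18020, 12470, 12470, 4451, 4451]" x] by (simp add: mult.assoc)
  have v: "path_poly x 14 + path_poly x 12 + 2 = (x^14 + 14*x^12 + 77*x^10 + 210*x^8 + 294*x^6 + 196*x^4 +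
      49*x^2 + 4)"
    unfolding path_poly_values_large by Groebner_Basis.algebra
  have "10^56 * ?P - 10^56 * (x^14 + 14*x^12 + 77*x^10 + 210*x^8 + 294*x^6 + 196*x^4 + 49*x^2 + 4) =
      65402000000000000000000000000000000000000000000000000*x^12 +
      752052521580010000000000000000000000000000000000000000*x^10 +
      3243985018986793254260000000000000000000000000000000000*x^8 +
      6537974971980784184609490410000000000000000000000000000*x^6 +
      6235806242258844761482067271641360000000000000000000000*x^4 +
      2469504644340565591968418939565060556960000000000000000*x^2 +
      290542145302100908607985651998482227840000000000000000"
    unfolding e by Groebner_Basis.algebra
  moreover have "0 \<le> 65402000000000000000000000000000000000000000000000000*x^12 +
      752052521580010000000000000000000000000000000000000000*x^10 +
      3243985018986793254260000000000000000000000000000000000*x^8 +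
      6537974971980784184609490410000000000000000000000000000*x^6 +
      6235806242258844761482067271641360000000000000000000000*x^4 +
      2469504644340565591968418939565060556960000000000000000*x^2 +
      290542145302100908607985651998482227840000000000000000"
    using x by (intro add_nonneg_nonneg mult_nonneg_nonneg zero_le_power) simp_all
  ultimately have "x^14 + 14*x^12 + 77*x^10 + 210*x^8 + 294*x^6 + 196*x^4 + 49*x^2 + 4 \<le> ?P" by (rule
      le_of_scaled_diff[rotated]) simp
  thus ?thesis unfolding v .
qed

text \<open>The factor \<open>x\<close> is the eigenvalue 0 of a bipartite graph of odd
  order.\<close>

lemma tadpole_17_ge: "x * (\<Prod>k\<leftarrow>[4590, 8775, 9999, 12119, 14795, 17320, 19241, 21584].
    x\<^sup>2 + (k / 10^4)\<^sup>2) \<le> tadpole_poly x 17" (is "?l \<le> ?r")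
proof -
  let ?P = "\<Prod>k\<leftarrow>[4590, 8775, 9999, 12119, 14795, 17320, 19241, 21584]. x\<^sup>2 + (k /
      10^4)\<^sup>2"
  have e: "10^64 * ?P = (10^8 * x\<^sup>2 + 4590\<^sup>2) * (10^8 * x\<^sup>2 + 8775\<^sup>2) * (10^8 *
      x\<^sup>2 +
      9999\<^sup>2) * (10^8 * x\<^sup>2 + 12119\<^sup>2) * (10^8 * x\<^sup>2 + 14795\<^sup>2) * (10^8 *
      x\<^sup>2 + 17320\<^sup>2) * (10^8 * x\<^sup>2 + 19241\<^sup>2) * (10^8 * x\<^sup>2 + 21584\<^sup>2)"
    using prod_list_scale[of "[4590, 8775, 9999, 12119, 14795, 17320, 19241, 21584]" x] by (simp add:
        mult.assoc)
  have v: "tadpole_poly x 17 = x * (x^16 + 17*x^14 + 118*x^12 + 433*x^10 + 909*x^8 + 1103*x^6 + 741*x^4 +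
      243*x^2 + 27)"
    by (simp add: tadpole_poly_def path_poly_values_large path_poly_values(3)) Groebner_Basis.algebra
  have "10^64 * (x^16 + 17*x^14 + 118*x^12 + 433*x^10 + 909*x^8 + 1103*x^6 + 741*x^4 + 243*x^2 + 27) -
      10^64 * ?P = 12155100000000000000000000000000000000000000000000000000000000*x^14 +
      175073696585634000000000000000000000000000000000000000000000000*x^12 +
      1005106995228175449970860000000000000000000000000000000000000000*x^10 +
      2953255757619196617770320232497900000000000000000000000000000000*x^8 +
      4730911155131729467823071462708604289475000000000000000000000000*x^6 +
      4041895390382928116477532944805239118619944975000000000000000000*x^4 +
      1637159037193014459021647313286420065145452105236400000000000000*x^2 +
      219107394121662686878174293364090467776510838518855040000000000"
    unfolding e by Groebner_Basis.algebra
  moreover have "0 \<le> 12155100000000000000000000000000000000000000000000000000000000*x^14 +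
      175073696585634000000000000000000000000000000000000000000000000*x^12 +
      1005106995228175449970860000000000000000000000000000000000000000*x^10 +
      2953255757619196617770320232497900000000000000000000000000000000*x^8 +
      4730911155131729467823071462708604289475000000000000000000000000*x^6 +
      4041895390382928116477532944805239118619944975000000000000000000*x^4 +
      1637159037193014459021647313286420065145452105236400000000000000*x^2 +
      219107394121662686878174293364090467776510838518855040000000000"
    using x by (intro add_nonneg_nonneg mult_nonneg_nonneg zero_le_power) simp_all
  ultimately have "?P \<le> x^16 + 17*x^14 + 118*x^12 + 433*x^10 + 909*x^8 + 1103*x^6 + 741*x^4 + 243*x^2 +
      27" by (rule le_of_scaled_diff[rotated]) simp
  thus ?thesis unfolding v using x by (intro mult_left_mono) simp_all
qed

text \<open>The entries are \<open>2 cos (pi j / 17)\<close> for \<open>j = 1, ..., 8\<close>,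
  rounded up.\<close>

lemma path_16_le: "path_poly x 16 \<le> (\<Prod>k\<leftarrow>[19660, 18650, 17005, 14781, 12053, 8915,
    5474, 1846]. x\<^sup>2 + (k / 10^4)\<^sup>2)" (is "?l \<le> ?r")
proof -
  let ?P = "\<Prod>k\<leftarrow>[19660, 18650, 17005, 14781, 12053, 8915, 5474, 1846]. x\<^sup>2 + (k /
      10^4)\<^sup>2"
  have e: "10^64 * ?P = (10^8 * x\<^sup>2 + 19660\<^sup>2) * (10^8 * x\<^sup>2 + 18650\<^sup>2) * (10^8 *
      x\<^sup>2 +
      17005\<^sup>2) * (10^8 * x\<^sup>2 + 14781\<^sup>2) * (10^8 * x\<^sup>2 + 12053\<^sup>2) * (10^8 *
      x\<^sup>2 + 8915\<^sup>2) * (10^8 * x\<^sup>2 + 5474\<^sup>2) * (10^8 * x\<^sup>2 + 1846\<^sup>2)"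
    using prod_list_scale[of "[19660, 18650, 17005, 14781, 12053, 8915, 5474, 1846]" x] by (simp add:
        mult.assoc)
  have v: "path_poly x 16 = (x^16 + 15*x^14 + 91*x^12 + 286*x^10 + 495*x^8 + 462*x^6 + 210*x^4 + 36*x^2 + 1)"
    by (rule path_poly_values_large)
  have "10^64 * ?P - 10^64 * (x^16 + 15*x^14 + 91*x^12 + 286*x^10 + 495*x^8 + 462*x^6 + 210*x^4 + 36*x^2 +
      1) = 11051200000000000000000000000000000000000000000000000000000000*x^14 +
      136965551132630000000000000000000000000000000000000000000000000*x^12 +
      662435105666111009568280000000000000000000000000000000000000000*x^10 +
      1580769417920302449434216129660900000000000000000000000000000000*x^8 +
      1938942672831050529246299912139734511900000000000000000000000000*x^6 +
      1156056921231213946779336515163321577123875100000000000000000000*x^4 +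
      278015302352616798982086569072718343472876179794100000000000000*x^2 +
      13631225401820737327621700161161413374949743986318410000000000"
    unfolding e by Groebner_Basis.algebra
  moreover have "0 \<le> 11051200000000000000000000000000000000000000000000000000000000*x^14 +
      136965551132630000000000000000000000000000000000000000000000000*x^12 +
      662435105666111009568280000000000000000000000000000000000000000*x^10 +
      1580769417920302449434216129660900000000000000000000000000000000*x^8 +
      1938942672831050529246299912139734511900000000000000000000000000*x^6 +
      1156056921231213946779336515163321577123875100000000000000000000*x^4 +
      278015302352616798982086569072718343472876179794100000000000000*x^2 +
      13631225401820737327621700161161413374949743986318410000000000"
    using x by (intro add_nonneg_nonneg mult_nonneg_nonneg zero_le_power) simp_all
  ultimately have "x^16 + 15*x^14 + 91*x^12 + 286*x^10 + 495*x^8 + 462*x^6 + 210*x^4 + 36*x^2 + 1 \<le> ?P"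
      by (rule le_of_scaled_diff[rotated]) simp
  thus ?thesis unfolding v .
qed

lemma triangle_17_le: "triangle_poly x 17 \<le> (\<Prod>k\<leftarrow>[1083, 3224, 5265, 7261, 7261, 9882,
    9883, 14687, 14691, 14694, 14695, 14698, 19281, 19305, 19359, 19560, 21923]. x\<^sup>2 + (k /
        10^4)\<^sup>2)" (is "?l \<le> ?r")
proof -
  let ?P = "\<Prod>k\<leftarrow>[1083, 3224, 5265, 7261, 7261, 9882, 9883, 14687, 14691, 14694, 14695,
      14698, 19281, 19305, 19359, 19560, 21923]. x\<^sup>2 + (k / 10^4)\<^sup>2"
  have e: "10^136 * ?P = (10^8 * x\<^sup>2 + 1083\<^sup>2) * (10^8 * x\<^sup>2 + 3224\<^sup>2) * (10^8 *
      x\<^sup>2 +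
      5265\<^sup>2) * (10^8 * x\<^sup>2 + 7261\<^sup>2) * (10^8 * x\<^sup>2 + 7261\<^sup>2) * (10^8 *
      x\<^sup>2 + 9882\<^sup>2) * (10^8 * x\<^sup>2 + 9883\<^sup>2) * (10^8 * x\<^sup>2 + 14687\<^sup>2) *
      (10^8 * x\<^sup>2 + 14691\<^sup>2) * (10^8 * x\<^sup>2 + 14694\<^sup>2) * (10^8 * x\<^sup>2 +
      14695\<^sup>2) * (10^8 * x\<^sup>2 + 14698\<^sup>2) * (10^8 * x\<^sup>2 + 19281\<^sup>2) * (10^8 *
      x\<^sup>2 + 19305\<^sup>2) * (10^8 * x\<^sup>2 + 19359\<^sup>2) * (10^8 * x\<^sup>2 + 19560\<^sup>2)
      * (10^8 * x\<^sup>2 + 21923\<^sup>2)"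
    using prod_list_scale[of "[1083, 3224, 5265, 7261, 7261, 9882, 9883, 14687, 14691, 14694, 14695, 14698,
        19281, 19305, 19359, 19560, 21923]" x] by (simp add: mult.assoc)
  have v: "triangle_poly x 17 = (x^34 + 34*x^32 + 525*x^30 + 4878*x^28 + 30454*x^26 + 135076*x^24 +
      438789*x^22 + 1060570*x^20 + 1918398*x^18 + 2590968*x^16 + 2587102*x^14 + 1875204*x^12 + 958388*x^10
          + 330180*x^8 + 71345*x^6 + 8520*x^4 + 432*x^2 + 4)"
    by (simp add: triangle_poly_def path_poly_values_large path_poly_values(1)) Groebner_Basis.algebra
  have "10^136 * ?P - 10^136 * (x^34 + 34*x^32 + 525*x^30 + 4878*x^28 + 30454*x^26 + 135076*x^24 +
      438789*x^22 + 1060570*x^20 + 1918398*x^18 + 2590968*x^16 + 2587102*x^14 + 1875204*x^12 + 958388*x^10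
          + 330180*x^8 + 71345*x^6 + 8520*x^4 + 432*x^2 + 4) =
            190285600000000000000000000000000000000000000000000000000000000000000000000000000000000000000000000000000000000000000000000000000000000*x^32
      +
      9739426693619314000000000000000000000000000000000000000000000000000000000000000000000000000000000000000000000000000000000000000000000000*x^30
      +
      168758414037033224936372840000000000000000000000000000000000000000000000000000000000000000000000000000000000000000000000000000000000000000*x^28
      +
      1551899680948216529290348261048081500000000000000000000000000000000000000000000000000000000000000000000000000000000000000000000000000000000*x^26
      +
      8926863711117108746314287582745417748888140000000000000000000000000000000000000000000000000000000000000000000000000000000000000000000000000*x^24
      +
      34799926353102198561963574197541939063068223753535800000000000000000000000000000000000000000000000000000000000000000000000000000000000000000*x^22
      +
      95877306423771055252953238127016908206401306038682558544948000000000000000000000000000000000000000000000000000000000000000000000000000000000*x^20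
      +
      190142235930797375179843564722247476444890006564417534817307283183215000000000000000000000000000000000000000000000000000000000000000000000000*x^18
      +
      271373719441204074059483147891192911302029499296853787875908870142751751270400000000000000000000000000000000000000000000000000000000000000000*x^16
      +
      274003066372606407880108252362828050886636856547907453534169854823643955258055003099400000000000000000000000000000000000000000000000000000000*x^14
      +
      189247466955157527417669743363151161712643813378364257730123896722472962827557561052969321364000000000000000000000000000000000000000000000000*x^12
      +
      84939373205359108418033749866428923280759948567763711652891167360030684606107772237724979552884540810000000000000000000000000000000000000000*x^10
      +
      23043354161815136121912784972183762332422642036940570673262854346277683434934156907759118838297251359619383600000000000000000000000000000000*x^8
      +
      3447190568579090854987580351630626930061836566496447666377835382087715189404163348363724454834154557501745038878000000000000000000000000000*x^6
      +
      264429871034322198919172852621863208389717823837122399384512276618594763905971731757041224155008931070210796648771894800000000000000000000*x^4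
      +
      9129820111934418162240085143661409159937341591168705620146667555938907054995642154331196996037654320618490902831440215872000000000000000*x^2
      +
      114708623755332712885875275567716819081030307247507443555981202616742950940907524237544514356207396690869670989861216663307161600000000"
    unfolding e by Groebner_Basis.algebra
  moreover have "0 \<le>
      190285600000000000000000000000000000000000000000000000000000000000000000000000000000000000000000000000000000000000000000000000000000000*x^32
      +
      9739426693619314000000000000000000000000000000000000000000000000000000000000000000000000000000000000000000000000000000000000000000000000*x^30
      +
      168758414037033224936372840000000000000000000000000000000000000000000000000000000000000000000000000000000000000000000000000000000000000000*x^28
      +
      1551899680948216529290348261048081500000000000000000000000000000000000000000000000000000000000000000000000000000000000000000000000000000000*x^26
      +
      8926863711117108746314287582745417748888140000000000000000000000000000000000000000000000000000000000000000000000000000000000000000000000000*x^24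
      +
      34799926353102198561963574197541939063068223753535800000000000000000000000000000000000000000000000000000000000000000000000000000000000000000*x^22
      +
      95877306423771055252953238127016908206401306038682558544948000000000000000000000000000000000000000000000000000000000000000000000000000000000*x^20
      +
      190142235930797375179843564722247476444890006564417534817307283183215000000000000000000000000000000000000000000000000000000000000000000000000*x^18
      +
      271373719441204074059483147891192911302029499296853787875908870142751751270400000000000000000000000000000000000000000000000000000000000000000*x^16
      +
      274003066372606407880108252362828050886636856547907453534169854823643955258055003099400000000000000000000000000000000000000000000000000000000*x^14
      +
      189247466955157527417669743363151161712643813378364257730123896722472962827557561052969321364000000000000000000000000000000000000000000000000*x^12
      +
      84939373205359108418033749866428923280759948567763711652891167360030684606107772237724979552884540810000000000000000000000000000000000000000*x^10
      +
      23043354161815136121912784972183762332422642036940570673262854346277683434934156907759118838297251359619383600000000000000000000000000000000*x^8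
      +
      3447190568579090854987580351630626930061836566496447666377835382087715189404163348363724454834154557501745038878000000000000000000000000000*x^6
      +
      264429871034322198919172852621863208389717823837122399384512276618594763905971731757041224155008931070210796648771894800000000000000000000*x^4
      +
      9129820111934418162240085143661409159937341591168705620146667555938907054995642154331196996037654320618490902831440215872000000000000000*x^2
      +
      114708623755332712885875275567716819081030307247507443555981202616742950940907524237544514356207396690869670989861216663307161600000000"
    using x by (intro add_nonneg_nonneg mult_nonneg_nonneg zero_le_power) simp_all
  ultimately have "x^34 + 34*x^32 + 525*x^30 + 4878*x^28 + 30454*x^26 + 135076*x^24 + 438789*x^22 +
      1060570*x^20 + 1918398*x^18 + 2590968*x^16 + 2587102*x^14 + 1875204*x^12 + 958388*x^10 + 330180*x^8 +
          71345*x^6 + 8520*x^4 + 432*x^2 + 4 \<le> ?P" by (rule le_of_scaled_diff[rotated]) simp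
  thus ?thesis unfolding v .
qed

end

section \<open>Comparing sums of moduli\<close>

text \<open>
  An antiderivative of \<open>ln (x\<^sup>2 + a\<^sup>2) + 2\<close>; its monotonicity replaces Coulson's
      integral. For \<open>a = 0\<close> the
  arctangent term vanishes, as it should.
\<close>

lemma coulson_term_deriv:
  assumes "0 < x"
  shows "((\<lambda>x. x * ln (x\<^sup>2 + a\<^sup>2) + 2 * a * arctan (x / a)) has_real_derivative ln
      (x\<^sup>2 + a\<^sup>2) + 2) (at (x::real))"
proof (cases "a = 0")
  case True
  then show ?thesis using assms
    by (auto intro!: derivative_eq_intros simp: power2_eq_square field_simps)
next
  case False
  have "x\<^sup>2 + a\<^sup>2 > 0" using assms by (simp add: add_pos_nonneg)
  moreover have "2 * a * (inverse (1 + (x / a)\<^sup>2) * (1 / a)) = 2 * a\<^sup>2 / (x\<^sup>2 + a\<^sup>2)"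
    using False calculation by (simp add: field_simps power2_eq_square)
  moreover have "x * (2 * x / (x\<^sup>2 + a\<^sup>2)) + 2 * a\<^sup>2 / (x\<^sup>2 + a\<^sup>2) = 2"
  proof -
    have "x * (2 * x / (x\<^sup>2 + a\<^sup>2)) + 2 * a\<^sup>2 / (x\<^sup>2 + a\<^sup>2) = 2 * (x\<^sup>2
        + a\<^sup>2) / (x\<^sup>2 + a\<^sup>2)"
      by (simp add: add_divide_distrib power2_eq_square)
    thus ?thesis using calculation(1) by (metis nonzero_mult_div_cancel_right less_irrefl)
  qed
  moreover have "((\<lambda>x. x * ln (x\<^sup>2 + a\<^sup>2) + 2 * a * arctan (x / a)) has_real_derivative
      (ln (x\<^sup>2 + a\<^sup>2) + x * (2 * x / (x\<^sup>2 + a\<^sup>2))) + 2 * a * (inverse (1 + (x /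
          a)\<^sup>2) * (1 / a))) (at x)"
    using calculation(1) False by (auto intro!: derivative_eq_intros)
  ultimately show ?thesis by (simp only: add.assoc)
qed

lemma coulson_term_at_0:
  assumes "0 \<le> a"
  shows "((\<lambda>x. x * ln (x\<^sup>2 + a\<^sup>2) + 2 * a * arctan (x / a)) \<longlongrightarrow> 0)
      (at_right (0::real))"
proof (cases "a = 0")
  case True
  then show ?thesis by simp real_asymp
next
  case False
  then have "0 < a" using assms by simp
  then show ?thesis by real_asymp
qed

text \<open>The divergent part does not depend on \<open>a\<close>, so it cancels between multisets
  of equal size; the arctangent leaves \<open>pi * a\<close>.\<close>

lemma coulson_term_at_top:
  assumes "0 \<le> a"
  shows "((\<lambda>x. x * ln (x\<^sup>2 + a\<^sup>2) + 2 * a * arctan (x / a) - x * ln (x\<^sup>2))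
      \<longlongrightarrow> pi * a) at_top"
proof (cases "a = 0")
  case True
  then show ?thesis by simp
next
  case False
  then have a: "0 < a" using assms by simp
  have "((\<lambda>x. x * ln (x\<^sup>2 + a\<^sup>2) - x * ln (x\<^sup>2)) \<longlongrightarrow> 0) at_top"
      using a by real_asymp
  moreover have "((\<lambda>x. 2 * a * arctan (x / a)) \<longlongrightarrow> 2 * a * (pi / 2)) at_top"
      using a by real_asymp
  ultimately have "((\<lambda>x. (x * ln (x\<^sup>2 + a\<^sup>2) - x * ln (x\<^sup>2)) + 2 * a * arctan (x
      / a)) \<longlongrightarrow> 0 + 2 * a * (pi / 2)) at_top"
    by (rule tendsto_add)
  then show ?thesis by (simp add: algebra_simps)
qed

definition coulson :: "real multiset \<Rightarrow> real \<Rightarrow> real" where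
  "coulson A x = (\<Sum>a\<in>#A. x * ln (x\<^sup>2 + a\<^sup>2) + 2 * a * arctan (x / a))"

lemma prod_mset_sq_pos: "0 < x \<Longrightarrow> 0 < (\<Prod>a\<in>#A. x\<^sup>2 + a\<^sup>2)" for x :: real
  by (induction A) (auto intro!: mult_pos_pos add_pos_nonneg)

lemma coulson_deriv:
  assumes "0 < x"
  shows "(coulson A has_real_derivative ln (\<Prod>a\<in>#A. x\<^sup>2 + a\<^sup>2) + 2 * size A) (at x)"
proof (induction A)
  case empty
  show ?case by (simp add: coulson_def[abs_def])
next
  case (add a A)
  have "coulson (add_mset a A) = (\<lambda>x. (x * ln (x\<^sup>2 + a\<^sup>2) + 2 * a * arctan (x / a)) +
      coulson A x)"
    by (simp add: coulson_def[abs_def])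
  moreover have "ln (\<Prod>a\<in>#add_mset a A. x\<^sup>2 + a\<^sup>2) = ln (x\<^sup>2 + a\<^sup>2) + ln
      (\<Prod>a\<in>#A. x\<^sup>2 + a\<^sup>2)"
    using prod_mset_sq_pos[OF assms, of A] assms by (simp add: ln_mult_pos add_pos_nonneg)
  ultimately show ?case
    using DERIV_add[OF coulson_term_deriv[OF assms, of a] add] by (simp add: algebra_simps)
qed

lemma coulson_at_0:
  assumes "\<And>a. a \<in># A \<Longrightarrow> 0 \<le> a"
  shows "(coulson A \<longlongrightarrow> 0) (at_right 0)"
  using assms
proof (induction A)
  case empty
  show ?case by (simp add: coulson_def[abs_def])
next
  case (add a A)
  have "coulson (add_mset a A) = (\<lambda>x. (x * ln (x\<^sup>2 + a\<^sup>2) + 2 * a * arctan (x / a)) +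
      coulson A x)"
    by (simp add: coulson_def[abs_def])
  moreover have "((\<lambda>x. (x * ln (x\<^sup>2 + a\<^sup>2) + 2 * a * arctan (x / a)) + coulson A x)
      \<longlongrightarrow> 0 + 0) (at_right 0)"
    by (intro tendsto_add coulson_term_at_0 add.IH) (use add.prems in auto)
  ultimately show ?case by simp
qed

lemma coulson_at_top:
  assumes "\<And>a. a \<in># A \<Longrightarrow> 0 \<le> a"
  shows "((\<lambda>x. coulson A x - size A * (x * ln (x\<^sup>2))) \<longlongrightarrow> pi *
      (\<Sum>a\<in>#A. a)) at_top"
  using assms
proof (induction A)
  case empty
  show ?case by (simp add: coulson_def[abs_def])
next
  case (add a A)
  have "((\<lambda>x. (x * ln (x\<^sup>2 + a\<^sup>2) + 2 * a * arctan (x / a) - x * ln (x\<^sup>2)) +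
      (coulson A x - size A * (x * ln (x\<^sup>2)))) \<longlongrightarrow> pi * a + pi * (\<Sum>a\<in>#A.
          a)) at_top"
    by (intro tendsto_add coulson_term_at_top add.IH) (use add.prems in auto)
  then show ?case by (simp add: coulson_def[abs_def] algebra_simps)
qed

text \<open>The difference \<open>H\<close> of the two antiderivatives has the logarithm of the
  ratio of the products as derivative, hence decreases. It starts at 0 and ends at \<open>pi\<close>
  times the difference of the sums.\<close>

lemma coulson_compare:
  assumes A: "\<And>a. a \<in># A \<Longrightarrow> 0 \<le> a" and B: "\<And>b. b \<in># B
      \<Longrightarrow> 0 \<le> b"
    and size: "size A = size B"
    and le: "\<And>x::real. 0 < x \<Longrightarrow> (\<Prod>a\<in>#A. x\<^sup>2 + a\<^sup>2) \<le>
        (\<Prod>b\<in>#B. x\<^sup>2 + b\<^sup>2)"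
  shows "(\<Sum>a\<in>#A. a) \<le> (\<Sum>b\<in>#B. b)"
    and "(\<And>x::real. 0 < x \<Longrightarrow> (\<Prod>a\<in>#A. x\<^sup>2 + a\<^sup>2) <
        (\<Prod>b\<in>#B. x\<^sup>2 + b\<^sup>2)) \<Longrightarrow> (\<Sum>a\<in>#A. a) < (\<Sum>b\<in>#B. b)"
proof -
  define H where "H x = coulson A x - coulson B x" for x
  define d where "d x = ln (\<Prod>a\<in>#A. x\<^sup>2 + a\<^sup>2) - ln (\<Prod>b\<in>#B. x\<^sup>2 +
      b\<^sup>2)" for x :: real
  have deriv: "(H has_real_derivative d x) (at x)" if "0 < x" for x
    using DERIV_diff[OF coulson_deriv[OF that, of A] coulson_deriv[OF that, of B]] size
    by (simp add: H_def[abs_def] d_def)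
  have d: "d x \<le> 0" if "0 < x" for x
    using le[OF that] prod_mset_sq_pos[OF that] by (simp add: d_def)
  have anti: "H y \<le> H x" if "0 < x" "x \<le> y" for x y
    by (rule DERIV_nonpos_imp_nonincreasing[OF that(2)]) (use deriv d that in \<open>meson
        less_le_trans\<close>)
  have H0: "(H \<longlongrightarrow> 0) (at_right 0)"
    using tendsto_diff[OF coulson_at_0[of A, OF A] coulson_at_0[of B, OF B]] by (simp add: H_def[abs_def])
  have le0: "H y \<le> 0" if "0 < y" for y
  proof (rule tendsto_lowerbound[OF H0])
    show "\<forall>\<^sub>F x in at_right 0. H y \<le> H x"
      using that anti by (auto simp: eventually_at_right intro!: exI[of _ y])
  qed simp
  have Htop: "(H \<longlongrightarrow> pi * ((\<Sum>a\<in>#A. a) - (\<Sum>b\<in>#B. b))) at_top"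
    using tendsto_diff[OF coulson_at_top[of A, OF A] coulson_at_top[of B, OF B]] size
    by (simp add: H_def[abs_def] right_diff_distrib)
  have ge: "pi * ((\<Sum>a\<in>#A. a) - (\<Sum>b\<in>#B. b)) \<le> H y" if "0 < y" for y
  proof (rule tendsto_upperbound[OF Htop])
    show "\<forall>\<^sub>F x in at_top. H x \<le> H y"
      using that anti by (auto simp: eventually_at_top_linorder intro!: exI[of _ y])
  qed simp
  have "pi * ((\<Sum>a\<in>#A. a) - (\<Sum>b\<in>#B. b)) \<le> 0" using ge[of 1] le0[of 1] by simp
  then show "(\<Sum>a\<in>#A. a) \<le> (\<Sum>b\<in>#B. b)" using pi_gt_zero by (auto simp: mult_le_0_iff)
  show "(\<Sum>a\<in>#A. a) < (\<Sum>b\<in>#B. b)"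
    if strict: "\<And>x::real. 0 < x \<Longrightarrow> (\<Prod>a\<in>#A. x\<^sup>2 + a\<^sup>2) <
        (\<Prod>b\<in>#B. x\<^sup>2 + b\<^sup>2)"
  proof -
    \<comment> \<open>A strict drop on one interval suffices, because \<open>H\<close> decreases on
      the whole half-line; the endpoints are arbitrary.\<close>
    have "H 2 < H 1"
    proof (rule DERIV_neg_imp_decreasing[of 1 2 H])
      fix x :: real assume "1 \<le> x" "x \<le> 2"
      hence x: "0 < x" by simp
      have "d x < 0" using strict[OF x] prod_mset_sq_pos[OF x] by (simp add: d_def)
      thus "\<exists>y. (H has_real_derivative y) (at x) \<and> y < 0" using deriv[OF x] by blast
    qed simp
    hence "pi * ((\<Sum>a\<in>#A. a) - (\<Sum>b\<in>#B. b)) < 0" using ge[of 2] le0[of 1] by simp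
    then show "(\<Sum>a\<in>#A. a) < (\<Sum>b\<in>#B. b)" using pi_gt_zero by (auto simp: mult_less_0_iff)
  qed
qed

section \<open>Determinants and matching polynomials of forests\<close>

text \<open>The Leibniz formula over a set instead of \<open>{0..<n}\<close>: vertices can be
  deleted without renumbering rows and columns.\<close>

definition sdet :: "('a \<Rightarrow> 'a \<Rightarrow> 'b) \<Rightarrow> 'a set \<Rightarrow>
    'b::comm_ring_1" where
  "sdet B V = (\<Sum>p | p permutes V. of_int (sign p) * (\<Prod>v\<in>V. B v (p v)))"

text \<open>The signed minor with row \<open>v\<close> and column \<open>u\<close> removed.\<close>

definition scof :: "('a \<Rightarrow> 'a \<Rightarrow> 'b) \<Rightarrow> 'a set \<Rightarrow> 'a
    \<Rightarrow> 'a \<Rightarrow> 'b::comm_ring_1" where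
  "scof B V u v = (\<Sum>p | p permutes V \<and> p v = u. of_int (sign p) * (\<Prod>w\<in>V - {v}. B w (p
      w)))"

lemma sdet_empty [simp]: "sdet B {} = 1"
  by (simp add: sdet_def sign_id)

lemma sdet_expand:
  assumes "finite V" "u \<in> V"
  shows "sdet B V = (\<Sum>w\<in>V. B u w * scof B V w u)"
proof -
  let ?h = "\<lambda>p. of_int (sign p) * (\<Prod>v\<in>V. B v (p v))"
  have "sdet B V = (\<Sum>w\<in>V. \<Sum>p | p \<in> {p. p permutes V} \<and> p u = w. ?h p)"
    unfolding sdet_def using assms
    by (intro sum.group[symmetric] finite_permutations) (auto simp: permutes_in_image)
  also have "\<dots> = (\<Sum>w\<in>V. B u w * scof B V w u)"
  proof (intro sum.cong refl)
    fix w assume "w \<in> V"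
    show "(\<Sum>p | p \<in> {p. p permutes V} \<and> p u = w. ?h p) = B u w * scof B V w u"
      unfolding scof_def sum_distrib_left mem_Collect_eq
    proof (intro sum.cong refl)
      fix p assume "p \<in> {p. p permutes V \<and> p u = w}"
      hence "(\<Prod>v\<in>V. B v (p v)) = B u w * (\<Prod>v\<in>V - {u}. B v (p v))"
        by (subst prod.remove[OF assms]) simp
      thus "?h p = B u w * (of_int (sign p) * (\<Prod>v\<in>V - {u}. B v (p v)))"
        by (simp add: mult_ac)
    qed
  qed
  finally show ?thesis .
qed

lemma permutes_fixing_iff: "u \<in> V \<Longrightarrow> p permutes V \<and> p u = u \<longleftrightarrow> p
    permutes (V - {u})"
proof
  assume "u \<in> V" "p permutes V \<and> p u = u"
  thus "p permutes (V - {u})" by (elim conjE, rule_tac permutes_superset[of p V]) auto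
next
  assume "p permutes (V - {u})"
  thus "p permutes V \<and> p u = u" by (simp add: permutes_subset[of p "V - {u}"] permutes_not_in)
qed

lemma scof_same:
  assumes "u \<in> V"
  shows "scof B V u u = sdet B (V - {u})"
  using assms by (simp add: scof_def sdet_def permutes_fixing_iff)

text \<open>
  Contracting \<open>u\<close> in the permutation cycle through \<open>v\<close>, \<open>u\<close>,
      \<open>p u\<close>: iterating this walks along the paths of the
  graph from \<open>u\<close> to \<open>v\<close>, so the minor vanishes if there is none.
\<close>

lemma scof_step:
  assumes "finite V" "u \<in> V" "v \<in> V" "u \<noteq> v"
  shows "scof B V u v = - (\<Sum>w\<in>V - {u}. B u w * scof B (V - {u}) w v)"
proof -
  let ?h = "\<lambda>p. of_int (sign p) * (\<Prod>w\<in>V - {v}. B w (p w))"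
  have *: "p u \<noteq> u" if "p permutes V" "p v = u" for p
    using that assms(4) permutes_inj[OF that(1)] by (metis injD)
  have "scof B V u v = (\<Sum>w\<in>V - {u}. \<Sum>p | p \<in> {p. p permutes V \<and> p v = u} \<and> p u
      = w. ?h p)"
    unfolding scof_def using assms *
    by (intro sum.group[symmetric] finite_subset[OF _ finite_permutations[OF assms(1)]])
      (auto simp: permutes_in_image)
  also have "\<dots> = (\<Sum>w\<in>V - {u}. - (B u w * scof B (V - {u}) w v))"
  proof (intro sum.cong refl)
    fix w assume w: "w \<in> V - {u}"
    let ?t = "Transposition.transpose u w"
    have t: "?t permutes V" using w assms by (simp add: permutes_swap_id)
    have "(\<Sum>p | p \<in> {p. p permutes V \<and> p v = u} \<and> p u = w. ?h p)
      = (\<Sum>q | q permutes V - {u} \<and> q v = w. - (B u w * (of_int (sign q) * (\<Prod>z\<in>V - {u} -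
          {v}. B z (q z)))))"
    \<comment> \<open>Composing with the transposition of \<open>u\<close> and
      \<open>w = p u\<close> makes \<open>u\<close> a fixed point and sends \<open>v\<close> to
      \<open>w\<close>. The map is an involution, so it witnesses both directions, and it flips the
      sign.\<close>
    proof (rule sum.reindex_bij_witness[where i = "\<lambda>q. ?t \<circ> q" and j = "\<lambda>p. ?t
        \<circ> p"])
      fix p assume "p \<in> {p \<in> {p. p permutes V \<and> p v = u}. p u = w}"
      hence p: "p permutes V" "p v = u" "p u = w" by auto
      have q: "?t \<circ> p permutes V" by (rule permutes_compose[OF p(1) t])
      show "?t \<circ> p \<in> {q. q permutes V - {u} \<and> q v = w}"
        using p q permutes_fixing_iff[OF assms(2), of "?t \<circ> p"] by simp
      show "?t \<circ> (?t \<circ> p) = p" by (simp add: fun_eq_iff)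
      have sg: "sign (?t \<circ> p) = - sign p"
        using w assms(1) p(1)
        by (subst sign_compose) (auto simp: permutation_swap_id sign_swap_id intro: permutes_imp_permutation)
      have "(?t \<circ> p) z = p z" if "z \<in> V - {u} - {v}" for z
        using that p permutes_inj[OF p(1)] by (auto simp: Transposition.transpose_def dest: injD)
      hence "(\<Prod>z\<in>V - {u} - {v}. B z ((?t \<circ> p) z)) = (\<Prod>z\<in>V - {v} - {u}. B z (p z))"
        by (intro prod.cong) auto
      moreover have "(\<Prod>z\<in>V - {v}. B z (p z)) = B u w * (\<Prod>z\<in>V - {v} - {u}. B z (p z))"
        using assms p(3) by (subst prod.remove[of _ u]) auto
      ultimately show "- (B u w * (of_int (sign (?t \<circ> p)) * (\<Prod>z\<in>V - {u} - {v}. B z ((?t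
          \<circ> p) z)))) = ?h p"
        unfolding sg by (simp add: mult_ac)
    next
      fix q assume "q \<in> {q. q permutes V - {u} \<and> q v = w}"
      hence q: "q permutes V - {u}" "q v = w" by auto
      have "q permutes V" using q(1) by (rule permutes_subset) auto
      moreover have "q u = u" using q(1) by (simp add: permutes_not_in)
      ultimately show "?t \<circ> q \<in> {p \<in> {p. p permutes V \<and> p v = u}. p u = w}"
        using q permutes_compose[OF _ t] by simp
      show "?t \<circ> (?t \<circ> q) = q" by (simp add: fun_eq_iff)
    qed
    also have "\<dots> = - (B u w * scof B (V - {u}) w v)"
      by (simp add: scof_def sum_distrib_left sum_negf)
    finally show "(\<Sum>p | p \<in> {p. p permutes V \<and> p v = u} \<and> p u = w. ?h p) = \<dots>" .
  qed
  finally show ?thesis by (simp add: sum_negf)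
qed

section \<open>Reachability and forests\<close>

definition reach :: "('a \<Rightarrow> 'a \<Rightarrow> bool) \<Rightarrow> 'a set \<Rightarrow> 'a
    \<Rightarrow> 'a \<Rightarrow> bool" where
  "reach E W a b \<longleftrightarrow> (a, b) \<in> {(p, q). E p q \<and> p \<in> W \<and> q \<in> W}\<^sup>*"

text \<open>Acyclicity seen from one vertex: two neighbours of \<open>w\<close> that remain
  connected without \<open>w\<close> would close a cycle through \<open>w\<close>. In this form it
  meets the vanishing of minors between unconnected vertices directly.\<close>

definition forest_on :: "('a \<Rightarrow> 'a \<Rightarrow> bool) \<Rightarrow> 'a set \<Rightarrow> bool"
    where
  "forest_on E W \<longleftrightarrow> (\<forall>w\<in>W. \<forall>u\<in>W. \<forall>z\<in>W. E w u
      \<longrightarrow> E w z \<longrightarrow> u \<noteq> z \<longrightarrow> \<not> reach E (W - {w}) z u)"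

lemma reach_refl [simp]: "reach E W a a"
  by (simp add: reach_def)

lemma reach_trans: "reach E W a b \<Longrightarrow> reach E W b c \<Longrightarrow> reach E W a c"
  unfolding reach_def by (rule rtrancl_trans)

lemma reach_edge: "E a b \<Longrightarrow> a \<in> W \<Longrightarrow> b \<in> W \<Longrightarrow> reach E
    W a b"
  unfolding reach_def by auto

lemma reach_mono:
  assumes "reach E W a b" "W \<subseteq> W'" "\<And>p q. p \<in> W \<Longrightarrow> q \<in> W
      \<Longrightarrow> E p q \<Longrightarrow> E' p q"
  shows "reach E' W' a b"
  using assms(1) unfolding reach_def
  by (rule rtrancl_mono[THEN subsetD, rotated]) (use assms in auto)

lemma forest_mono:
  assumes "forest_on E' W'" "W \<subseteq> W'" "\<And>p q. p \<in> W \<Longrightarrow> q \<in> W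
      \<Longrightarrow> E p q \<Longrightarrow> E' p q"
  shows "forest_on E W"
  unfolding forest_on_def
proof (intro ballI impI notI)
  fix w u z assume *: "w \<in> W" "u \<in> W" "z \<in> W" "E w u" "E w z" "u \<noteq> z" "reach E (W - {w})
      z u"
  have "reach E' (W' - {w}) z u"
    using *(7) by (rule reach_mono) (use assms in auto)
  thus False using * assms unfolding forest_on_def by blast
qed

lemma forest_subset: "forest_on E W' \<Longrightarrow> W \<subseteq> W' \<Longrightarrow> forest_on E W"
  by (rule forest_mono)

lemma reach_hd:
  "successively E ps \<Longrightarrow> set ps \<subseteq> W \<Longrightarrow> b \<in> set ps
      \<Longrightarrow> reach E W (hd ps) b"
proof (induction ps)
  case (Cons a ps)
  show ?case
  proof (cases "b = a")
    case False
    hence b: "b \<in> set ps" using Cons by auto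
    then obtain c qs where ps: "ps = c # qs" by (cases ps) auto
    have "reach E W c b" using Cons b unfolding ps by auto
    moreover have "reach E W a c" using Cons.prems unfolding ps by (auto intro: reach_edge)
    ultimately show ?thesis by (auto intro: reach_trans)
  qed auto
qed auto

lemma reach_imp_path:
  assumes "reach E W a b" "a \<in> W"
  shows "\<exists>ps. ps \<noteq> [] \<and> hd ps = a \<and> last ps = b \<and> distinct ps \<and>
      successively E ps \<and> set ps \<subseteq> W"
  using assms(1) unfolding reach_def
proof (induction rule: rtrancl_induct)
  case base
  show ?case by (rule exI[of _ "[a]"]) (use assms in auto)
next
  case (step b c)
  then obtain ps where ps: "ps \<noteq> []" "hd ps = a" "last ps = b" "distinct ps" "successively E ps"
      "set ps \<subseteq> W"
    by blast
  show ?case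
  proof (cases "c \<in> set ps")
    case False
    show ?thesis
      by (rule exI[of _ "ps @ [c]"]) (use ps step False in \<open>auto simp: successively_append_iff\<close>)
  next
    case True
    then obtain us vs where "ps = us @ c # vs" by (meson split_list)
    hence e: "ps = (us @ [c]) @ vs" by simp
    show ?thesis
      by (rule exI[of _ "us @ [c]"])
        (use ps step in \<open>auto simp: e successively_append_iff hd_append split: if_splits\<close>)
  qed
qed

locale simple_rel =
  fixes E :: "'a \<Rightarrow> 'a \<Rightarrow> bool"
  assumes sym: "E a b \<Longrightarrow> E b a" and irrefl: "\<not> E a a"
begin

lemma reach_sym: "reach E W a b \<Longrightarrow> reach E W b a"
proof -
  have "{(p, q). E p q \<and> p \<in> W \<and> q \<in> W}\<inverse> = {(p, q). E p q \<and> p \<in> W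
      \<and> q \<in> W}"
    using sym by auto
  thus "reach E W a b \<Longrightarrow> reach E W b a"
    unfolding reach_def using rtrancl_converseI[of a b "{(p, q). E p q \<and> p \<in> W \<and> q \<in> W}"]
        by simp
qed

lemma reach_list:
  assumes "successively E ps" "set ps \<subseteq> W" "a \<in> set ps" "b \<in> set ps"
  shows "reach E W a b"
  by (rule reach_trans[OF reach_sym[OF reach_hd[OF assms(1,2,3)]] reach_hd[OF assms(1,2,4)]])

text \<open>The first vertex of a longest path has all its neighbours on that path, and two of them
  would be connected by the rest of the path.\<close>

lemma forest_leaf:
  assumes "forest_on E W" "finite W" "W \<noteq> {}"
  shows "\<exists>v\<in>W. \<forall>a\<in>W. \<forall>b\<in>W. E v a \<longrightarrow> E v b
      \<longrightarrow> a = b"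
proof -
  define S where "S = {ps. distinct ps \<and> set ps \<subseteq> W \<and> successively E ps}"
  obtain w where "w \<in> W" using assms by auto
  have "length ps \<le> card W" if "ps \<in> S" for ps
    using that card_mono[OF assms(2), of "set ps"] by (auto simp: S_def distinct_card)
  moreover have "[w] \<in> S" using \<open>w \<in> W\<close> by (simp add: S_def)
  ultimately have "\<exists>ps. ps \<in> S \<and> (\<forall>qs. qs \<in> S \<longrightarrow> length qs
      \<le> length ps)"
    by (intro ex_has_greatest_nat[of "\<lambda>ps. ps \<in> S" "[w]" length "Suc (card W)"]) (simp_all add:
        less_Suc_eq_le)
  then obtain ps where ps: "ps \<in> S" "\<And>qs. qs \<in> S \<Longrightarrow> length qs \<le> length ps"
      by metis
  have "length ps \<ge> 1" using ps(2)[OF \<open>[w] \<in> S\<close>] by simp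
  then obtain v qs where v: "ps = v # qs" by (cases ps) simp_all
  have pS: "distinct ps" "set ps \<subseteq> W" "successively E ps" using ps(1) unfolding S_def by simp_all
  have in_qs: "a \<in> set qs" if "a \<in> W" "E v a" for a
  proof (rule ccontr)
    assume "a \<notin> set qs"
    moreover have "a \<noteq> v" using that irrefl by auto
    ultimately have "a # ps \<in> S" using pS that(1) sym[OF that(2)] unfolding S_def v by simp
    from ps(2)[OF this] show False by simp
  qed
  have "a = b" if "a \<in> W" "b \<in> W" "E v a" "E v b" for a b
  proof (rule ccontr)
    assume "a \<noteq> b"
    have "reach E (W - {v}) b a"
    proof (rule reach_list[of qs])
      show "successively E qs" using pS(3) v by (auto simp: successively_Cons)
      show "set qs \<subseteq> W - {v}" using pS(1,2) v by auto
      show "b \<in> set qs" "a \<in> set qs" using in_qs that by simp_all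
    qed
    moreover have "v \<in> W" using pS(2) v by simp
    ultimately show False using assms(1) that \<open>a \<noteq> b\<close> unfolding forest_on_def by blast
  qed
  moreover have "v \<in> W" using pS(2) v by simp
  ultimately show ?thesis by blast
qed

text \<open>Paths in a forest are induced: a chord at \<open>ps ! i\<close> would give it two
  neighbours joined by the remainder of the path.\<close>

lemma forest_path_adjacent:
  assumes "forest_on E W" "distinct ps" "set ps \<subseteq> W" "successively E ps"
    and "i < j" "j < length ps" "E (ps ! i) (ps ! j)"
  shows "j = Suc i"
proof (rule ccontr)
  assume ne: "j \<noteq> Suc i"
  let ?w = "ps ! i"
  let ?qs = "drop (Suc i) ps"
  have i: "i < length ps" using assms by simp
  have dist: "?w \<notin> set ?qs"
    using assms(2) by (subst (asm) id_take_nth_drop[OF i]) simp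
  have suc: "successively E (?w # ?qs)"
    using assms(4) by (subst (asm) id_take_nth_drop[OF i]) (simp only: successively_append_iff)
  have "?qs ! (j - Suc i) = ps ! j" using assms by simp
  moreover have "j - Suc i < length ?qs" using assms by simp
  ultimately have 1: "ps ! j \<in> set ?qs" by (metis nth_mem)
  have 2: "ps ! Suc i = hd ?qs" using assms by (simp add: hd_drop_conv_nth)
  have "?qs \<noteq> []" using 1 by auto
  hence 3: "ps ! Suc i \<in> set ?qs" unfolding 2 by (rule hd_in_set)
  have "reach E (W - {?w}) (ps ! j) (ps ! Suc i)"
    by (rule reach_list[of ?qs]) (use 1 3 suc dist assms(3) set_drop_subset[of "Suc i" ps] in \<open>auto
        simp: successively_Cons\<close>)
  moreover have "E ?w (ps ! Suc i)" using suc \<open>?qs \<noteq> []\<close> unfolding 2 by (simp add: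
      successively_Cons)
  moreover have "ps ! Suc i \<noteq> ps ! j" using assms ne by (simp add: nth_eq_iff_index_eq)
  moreover have "?w \<in> W" "ps ! j \<in> W" "ps ! Suc i \<in> W" using assms 3 set_drop_subset[of "Suc i"
      ps] by auto
  ultimately show False using assms(1,7) unfolding forest_on_def by blast
qed

end

text \<open>The entries of \<open>x I + \<i> A\<close>, whose determinant is \<open>(-
    \<i>)\<^sup>n\<close> times the characteristic polynomial at \<open>\<i> x\<close>.\<close>

definition adj_weight :: "real \<Rightarrow> ('a \<Rightarrow> 'a \<Rightarrow> bool) \<Rightarrow> 'a
    \<Rightarrow> 'a \<Rightarrow> complex" where
  "adj_weight x E v w = (if v = w then of_real x else if E v w then \<i> else 0)"

abbreviation mdet :: "real \<Rightarrow> ('a \<Rightarrow> 'a \<Rightarrow> bool) \<Rightarrow> 'a set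
    \<Rightarrow> complex" where
  "mdet x E W \<equiv> sdet (adj_weight x E) W"

abbreviation mcof :: "real \<Rightarrow> ('a \<Rightarrow> 'a \<Rightarrow> bool) \<Rightarrow> 'a set
    \<Rightarrow> 'a \<Rightarrow> 'a \<Rightarrow> complex" where
  "mcof x E W \<equiv> scof (adj_weight x E) W"

section \<open>Expanding determinants and minors at a vertex\<close>

lemma mdet_cong:
  assumes "\<And>a b. a \<in> W \<Longrightarrow> b \<in> W \<Longrightarrow> E a b = E' a b"
  shows "mdet x E W = mdet x E' W"
  unfolding sdet_def
proof (intro sum.cong refl arg_cong2[of _ _ _ _ "(*)"] prod.cong)
  fix p v assume "p \<in> {p. p permutes W}" "v \<in> W"
  hence "p v \<in> W" by (simp add: permutes_in_image)
  thus "adj_weight x E v (p v) = adj_weight x E' v (p v)"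
    using assms[OF \<open>v \<in> W\<close>] by (simp add: adj_weight_def)
qed

lemma mcof_step:
  assumes "finite W" "u \<in> W" "v \<in> W" "u \<noteq> v"
  shows "mcof x E W u v = - (\<Sum>w | w \<in> W - {u} \<and> E u w. \<i> * mcof x E (W - {u}) w v)"
proof -
  have "(\<Sum>w\<in>W - {u}. adj_weight x E u w * mcof x E (W - {u}) w v)
      = (\<Sum>w\<in>W - {u}. if E u w then \<i> * mcof x E (W - {u}) w v else 0)"
    by (intro sum.cong) (auto simp: adj_weight_def)
  also have "\<dots> = (\<Sum>w | w \<in> W - {u} \<and> E u w. \<i> * mcof x E (W - {u}) w v)"
    by (rule sum.inter_filter[symmetric]) (use assms in simp)
  finally show ?thesis using scof_step[OF assms, of "adj_weight x E"] by simp
qed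

lemma mcof_unreachable:
  assumes "finite W" "w \<in> W" "u \<in> W" "\<not> reach E W w u"
  shows "mcof x E W w u = 0"
  using assms
proof (induction "card W" arbitrary: W w rule: less_induct)
  case less
  have "w \<noteq> u" using less.prems by auto
  have "mcof x E (W - {w}) z u = 0" if z: "z \<in> W - {w}" "E w z" for z
  proof (rule less.hyps)
    show "card (W - {w}) < card W" using less.prems by (intro card_Diff1_less)
    show "\<not> reach E (W - {w}) z u"
    proof
      assume "reach E (W - {w}) z u"
      hence zu: "reach E W z u" by (rule reach_mono) auto
      have "reach E W w z" using z less.prems by (intro reach_edge) auto
      from reach_trans[OF this zu] show False using less.prems(4) by simp
    qed
  qed (use less.prems z \<open>w \<noteq> u\<close> in auto)
  thus ?case using mcof_step[OF less.prems(1-3) \<open>w \<noteq> u\<close>] by simp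
qed

context simple_rel
begin

text \<open>Separates the immediate return to \<open>u\<close>, which produces the matching edge
  \<open>uw\<close>, from walks that go on at another neighbour of \<open>w\<close> and can come
  back to \<open>u\<close> only around a cycle.\<close>

lemma mcof_adjacent:
  assumes "finite W" "u \<in> W" "w \<in> W" "E u w"
  shows "mcof x E W w u = - \<i> * mdet x E (W - {u, w})
    - (\<Sum>z | z \<in> W - {w, u} \<and> E w z. \<i> * mcof x E (W - {w}) z u)"
proof -
  have ne: "w \<noteq> u" using assms irrefl by auto
  have wu: "E w u" using assms sym by auto
  have eq: "{z. z \<in> W - {w} \<and> E w z} = insert u {z. z \<in> W - {w, u} \<and> E w z}"
    using assms ne wu by auto
  have "(\<Sum>z | z \<in> W - {w} \<and> E w z. \<i> * mcof x E (W - {w}) z u)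
      = \<i> * mcof x E (W - {w}) u u + (\<Sum>z | z \<in> W - {w, u} \<and> E w z. \<i> * mcof x E (W -
          {w}) z u)"
    unfolding eq using assms by (subst sum.insert) auto
  moreover have "mcof x E (W - {w}) u u = mdet x E (W - {u, w})"
    using assms ne scof_same[of u "W - {w}"] by (simp add: Diff_insert2[symmetric] insert_commute)
  ultimately show ?thesis using mcof_step[OF assms(1,3,2) ne] by simp
qed

lemma mdet_expand:
  assumes "finite W" "u \<in> W"
  shows "mdet x E W = x * mdet x E (W - {u}) + (\<Sum>w | w \<in> W \<and> E u w. \<i> * mcof x E W w u)"
proof -
  have "mdet x E W = (\<Sum>w\<in>W. adj_weight x E u w * mcof x E W w u)" using sdet_expand[OF assms] .
  also have "\<dots> = x * mcof x E W u u + (\<Sum>w\<in>W - {u}. adj_weight x E u w * mcof x E W w u)"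
    using assms by (subst sum.remove[of _ u]) (auto simp: adj_weight_def)
  also have "(\<Sum>w\<in>W - {u}. adj_weight x E u w * mcof x E W w u)
      = (\<Sum>w\<in>W - {u}. if E u w then \<i> * mcof x E W w u else 0)"
    by (intro sum.cong) (auto simp: adj_weight_def)
  also have "\<dots> = (\<Sum>w | w \<in> W - {u} \<and> E u w. \<i> * mcof x E W w u)"
    by (rule sum.inter_filter[symmetric]) (use assms in simp)
  also have "{w. w \<in> W - {u} \<and> E u w} = {w. w \<in> W \<and> E u w}" using irrefl by auto
  finally show ?thesis unfolding scof_same[OF assms(2)] .
qed

text \<open>In a forest the walks around a cycle vanish, and the weight \<open>\<i>\<close> of the
  edge times the factor \<open>- \<i>\<close> of the minor is 1. This is the recurrence of the
  matching polynomial with positive signs.\<close>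

lemma forest_mdet_expand:
  assumes "forest_on E W" "finite W" "u \<in> W"
  shows "mdet x E W = x * mdet x E (W - {u}) + (\<Sum>w | w \<in> W \<and> E u w. mdet x E (W - {u, w}))"
proof -
  have "\<i> * mcof x E W w u = mdet x E (W - {u, w})" if w: "w \<in> W" "E u w" for w
  proof -
    have wu: "E w u" using w sym by auto
    have "mcof x E (W - {w}) z u = 0" if z: "z \<in> W - {w, u}" "E w z" for z
    proof (rule mcof_unreachable)
      show "\<not> reach E (W - {w}) z u" using assms w wu z unfolding forest_on_def by blast
    qed (use assms w z irrefl in auto)
    hence "mcof x E W w u = - \<i> * mdet x E (W - {u, w})"
      using mcof_adjacent[OF assms(2,3) w] by simp
    thus ?thesis by simp
  qed
  hence "(\<Sum>w | w \<in> W \<and> E u w. \<i> * mcof x E W w u) = (\<Sum>w | w \<in> W \<and> E u w.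
      mdet x E (W - {u, w}))"
    by (intro sum.cong) auto
  thus ?thesis using mdet_expand[OF assms(2,3), of x] by simp
qed

text \<open>At each vertex only the next one on the path can still reach the end, so a single walk
  survives and every edge of it contributes \<open>- \<i>\<close>.\<close>

lemma forest_mcof_path:
  assumes "forest_on E W" "finite W" "ps \<noteq> []" "distinct ps" "set ps \<subseteq> W" "successively E ps"
  shows "mcof x E W (hd ps) (last ps) = (- \<i>) ^ (length ps - 1) * mdet x E (W - set ps)"
  using assms
proof (induction ps arbitrary: W)
  case (Cons a ps)
  show ?case
  proof (cases ps)
    case Nil
    thus ?thesis using Cons scof_same by simp
  next
    case c: (Cons b qs)
    define t where "t = last ps"
    have t: "t \<in> set ps" "a \<noteq> t" "t \<in> W" "a \<in> W" using Cons.prems c by (auto simp: t_def)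
    have b: "E a b" "b \<in> W - {a}" using Cons.prems c by auto
    have bt: "reach E (W - {a}) b t"
      by (rule reach_list[of ps]) (use Cons.prems t c in \<open>auto simp: successively_Cons\<close>)
    have "mcof x E (W - {a}) z t = 0" if z: "z \<in> W - {a}" "E a z" "z \<noteq> b" for z
    proof (rule mcof_unreachable)
      show "\<not> reach E (W - {a}) z t"
      proof
        assume "reach E (W - {a}) z t"
        hence "reach E (W - {a}) z b" using bt reach_sym reach_trans by metis
        thus False using Cons.prems(1) t(4) b z unfolding forest_on_def by blast
      qed
    qed (use z Cons.prems t in auto)
    hence "(\<Sum>z | z \<in> W - {a} \<and> E a z. \<i> * mcof x E (W - {a}) z t)
        = (\<Sum>z\<in>{b}. \<i> * mcof x E (W - {a}) z t)"
      using b Cons.prems(2) by (intro sum.mono_neutral_right) auto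
    hence "mcof x E W a t = - (\<i> * mcof x E (W - {a}) b t)"
      using mcof_step[OF Cons.prems(2) t(4,3,2)] by simp
    also have "mcof x E (W - {a}) b t = (- \<i>) ^ (length ps - 1) * mdet x E (W - {a} - set ps)"
    proof -
      have "mcof x E (W - {a}) (hd ps) (last ps) = (- \<i>) ^ (length ps - 1) * mdet x E (W - {a} - set ps)"
        by (rule Cons.IH) (use Cons.prems c forest_subset[OF Cons.prems(1)] in \<open>auto simp:
            successively_Cons\<close>)
      thus ?thesis by (simp add: c t_def)
    qed
    also have "W - {a} - set ps = W - set (a # ps)" by auto
    finally show ?thesis by (simp add: c t_def)
  qed
qed simp

lemma forest_mdet_real:
  assumes "forest_on E W" "finite W"
  shows "mdet x E W \<in> \<real>"
  using assms
proof (induction "card W" arbitrary: W rule: less_induct)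
  case less
  show ?case
  proof (cases "W = {}")
    case False
    then obtain u where u: "u \<in> W" by auto
    have "mdet x E (W - S) \<in> \<real>" if "u \<in> S" for S
    proof (rule less.hyps)
      show "card (W - S) < card W" using that u less.prems(2) by (intro psubset_card_mono) auto
      show "forest_on E (W - S)" by (rule forest_subset[OF less.prems(1)]) auto
    qed (use less.prems in auto)
    thus ?thesis unfolding forest_mdet_expand[OF less.prems u] by (intro Reals_add Reals_mult sum_in_Reals)
        auto
  qed simp
qed

end

text \<open>On a forest the determinant is real by \<open>forest_mdet_real\<close>, so taking the
  real part loses nothing; the value is the sum over all matchings of \<open>x\<close> to the number
  of uncovered vertices.\<close>

definition matching_poly :: "real \<Rightarrow> ('a \<Rightarrow> 'a \<Rightarrow> bool) \<Rightarrow> 'a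
    set \<Rightarrow> real" where
  "matching_poly x E W = Re (mdet x E W)"

lemma matching_poly_empty [simp]: "matching_poly x E {} = 1"
  by (simp add: matching_poly_def)

context simple_rel
begin

lemma forest_mdet_eq: "forest_on E W \<Longrightarrow> finite W \<Longrightarrow> mdet x E W = of_real
    (matching_poly x E W)"
  using forest_mdet_real[of W x] by (simp add: matching_poly_def)

lemma matching_poly_expand:
  assumes "forest_on E W" "finite W" "u \<in> W"
  shows "matching_poly x E W
    = x * matching_poly x E (W - {u}) + (\<Sum>w | w \<in> W \<and> E u w. matching_poly x E (W - {u, w}))"
  unfolding matching_poly_def forest_mdet_expand[OF assms] by simp

lemma matching_poly_pos:
  assumes "forest_on E W" "finite W" "0 < x"
  shows "0 < matching_poly x E W"
  using assms(1,2)
proof (induction "card W" arbitrary: W rule: less_induct)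
  case less
  show ?case
  proof (cases "W = {}")
    case False
    then obtain u where u: "u \<in> W" by auto
    have "0 < matching_poly x E (W - S)" if "u \<in> S" for S
    proof (rule less.hyps)
      show "card (W - S) < card W" using that u less.prems(2) by (intro psubset_card_mono) auto
      show "forest_on E (W - S)" by (rule forest_subset[OF less.prems(1)]) auto
    qed (use less.prems in auto)
    thus ?thesis unfolding matching_poly_expand[OF less.prems u]
      using assms(3) by (intro add_pos_nonneg mult_pos_pos sum_nonneg) (auto intro: less_imp_le)
  qed simp
qed

lemma matching_poly_disjoint:
  assumes "forest_on E (W1 \<union> W2)" "finite W1" "finite W2" "W1 \<inter> W2 = {}"
    and "\<And>a b. a \<in> W1 \<Longrightarrow> b \<in> W2 \<Longrightarrow> \<not> E a b"
  shows "matching_poly x E (W1 \<union> W2) = matching_poly x E W1 * matching_poly x E W2"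
  using assms
proof (induction "card W1" arbitrary: W1 rule: less_induct)
  case less
  show ?case
  proof (cases "W1 = {}")
    case False
    then obtain u where u: "u \<in> W1" by auto
    have IH: "matching_poly x E ((W1 - S) \<union> W2) = matching_poly x E (W1 - S) * matching_poly x E W2"
        if "u \<in> S" for S
    proof (rule less.hyps)
      show "card (W1 - S) < card W1" using that u less.prems(2) by (intro psubset_card_mono) auto
      show "forest_on E (W1 - S \<union> W2)" by (rule forest_subset[OF less.prems(1)]) auto
      show "finite (W1 - S)" "finite W2" using less.prems(2,3) by simp_all
      show "(W1 - S) \<inter> W2 = {}" using less.prems(4) by blast
      show "\<not> E a b" if "a \<in> W1 - S" "b \<in> W2" for a b using less.prems(5) that by blast
    qed
    have 1: "matching_poly x E (W1 \<union> W2 - S) = matching_poly x E (W1 - S) * matching_poly x E W2"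
      if "u \<in> S" "S \<subseteq> W1" for S
    proof -
      have "(W1 \<union> W2) - S = (W1 - S) \<union> W2" using less.prems(4) that by auto
      thus ?thesis using IH[OF that(1)] by simp
    qed
    have 2: "{w. w \<in> W1 \<union> W2 \<and> E u w} = {w. w \<in> W1 \<and> E u w}" using
        less.prems(5)[OF u] by blast
    have "matching_poly x E (W1 \<union> W2) = x * matching_poly x E (W1 \<union> W2 - {u})
        + (\<Sum>w | w \<in> W1 \<and> E u w. matching_poly x E (W1 \<union> W2 - {u, w}))"
      unfolding 2[symmetric] by (rule matching_poly_expand[OF less.prems(1)]) (use less.prems(2,3) u in auto)
    also have "(\<Sum>w | w \<in> W1 \<and> E u w. matching_poly x E (W1 \<union> W2 - {u, w}))
        = (\<Sum>w | w \<in> W1 \<and> E u w. matching_poly x E (W1 - {u, w}) * matching_poly x E W2)"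
      using u by (intro sum.cong refl 1) auto
    also have "matching_poly x E (W1 \<union> W2 - {u}) = matching_poly x E (W1 - {u}) * matching_poly x E W2"
      using u by (intro 1) auto
    also have "x * (matching_poly x E (W1 - {u}) * matching_poly x E W2)
        + (\<Sum>w | w \<in> W1 \<and> E u w. matching_poly x E (W1 - {u, w}) * matching_poly x E W2)
        = matching_poly x E W1 * matching_poly x E W2"
      by (subst matching_poly_expand[OF forest_subset[OF less.prems(1) Un_upper1] less.prems(2) u, of x])
        (simp add: distrib_right sum_distrib_right)
    finally show ?thesis .
  qed simp
qed

lemma matching_poly_path:
  assumes "forest_on E W" "distinct ps" "set ps = W" "successively E ps"
  shows "matching_poly x E W = path_poly x (length ps)"
  using assms
proof (induction ps arbitrary: W rule: induct_list012)
  case (2 a)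
  have "{w. w \<in> W \<and> E a w} = {}" using irrefl "2.prems" by auto
  thus ?case using matching_poly_expand[of W a x] "2.prems" by auto
next
  case (3 a b qs)
  let ?ps = "a # b # qs"
  have W: "finite W" "W = set ?ps" using "3.prems" by auto
  have nb: "{w. w \<in> W \<and> E a w} = {b}"
  proof (intro equalityI subsetI)
    fix w assume "w \<in> {w. w \<in> W \<and> E a w}"
    hence w: "w \<in> W" "E a w" by auto
    then obtain j where j: "j < length ?ps" "?ps ! j = w" using W by (metis in_set_conv_nth)
    moreover have "j \<noteq> 0" using j w irrefl by (metis nth_Cons_0)
    ultimately have "j = Suc 0"
      using forest_path_adjacent[of W ?ps 0 j] "3.prems" w by auto
    thus "w \<in> {b}" using j by simp
  qed (use "3.prems" in auto)
  have s: "W - {a} = set (b # qs)" "W - {a, b} = set qs" using W "3.prems" by auto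
  have "matching_poly x E (set (b # qs)) = path_poly x (length (b # qs))"
    by (rule "3.IH") (use "3.prems" forest_subset[of E W "set (b # qs)"] in auto)
  moreover have "matching_poly x E (set qs) = path_poly x (length qs)"
    by (rule "3.IH") (use "3.prems" forest_subset[of E W "set qs"] in \<open>auto simp:
        successively_Cons\<close>)
  moreover have "matching_poly x E W = x * matching_poly x E (W - {a}) + matching_poly x E (W - {a, b})"
    using matching_poly_expand[OF "3.prems"(1) W(1), of a x] W nb by simp
  ultimately show ?case unfolding s by simp
qed auto

text \<open>Expansion at a leaf turns the recurrence of \<open>path_poly\<close> into a bound; an
  isolated vertex loses a summand. The equality case belongs to the induction because it is applied
  to \<open>W - {v}\<close> and \<open>W - {v, w}\<close> together.\<close>

lemma matching_poly_le:
  assumes "forest_on E W" "finite W" "0 < x"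
  shows "matching_poly x E W \<le> path_poly x (card W) \<and>
    (matching_poly x E W = path_poly x (card W) \<longrightarrow> (\<exists>ps. distinct ps \<and> set ps =
        W \<and> successively E ps))"
  using assms(1,2)
proof (induction "card W" arbitrary: W rule: less_induct)
  case less
  note pp = path_poly_pos[OF assms(3)]
  show ?case
  proof (cases "W = {}")
    case True
    thus ?thesis by (auto intro: exI[of _ "[]"])
  next
    case False
    then obtain v where v: "v \<in> W" "\<And>a b. a \<in> W \<Longrightarrow> b \<in> W \<Longrightarrow>
        E v a \<Longrightarrow> E v b \<Longrightarrow> a = b"
      using forest_leaf[OF less.prems] by blast
    have IH: "matching_poly x E (W - S) \<le> path_poly x (card (W - S)) \<and>
      (matching_poly x E (W - S) = path_poly x (card (W - S)) \<longrightarrow> (\<exists>ps. distinct ps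
          \<and> set ps = W - S \<and> successively E ps))"
      if "v \<in> S" for S
    proof (rule less.hyps)
      show "card (W - S) < card W" using that v less.prems(2) by (intro psubset_card_mono) auto
      show "forest_on E (W - S)" by (rule forest_subset[OF less.prems(1)]) auto
    qed (use less.prems in auto)
    have cv: "card (W - {v}) = card W - 1" using v less.prems by simp
    have c1: "card W \<ge> 1" using v less.prems(2) by (metis card_gt_0_iff empty_iff Suc_leI One_nat_def)
    show ?thesis
    proof (cases "\<exists>w\<in>W. E v w")
      case False
      hence "{w. w \<in> W \<and> E v w} = {}" by auto
      hence e: "matching_poly x E W = x * matching_poly x E (W - {v})"
        using matching_poly_expand[OF less.prems v(1), of x] by (simp only: sum.empty add_0_right)
      have le: "matching_poly x E W \<le> x * path_poly x (card W - 1)"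
        unfolding e using IH[of "{v}"] cv assms(3) by simp
      show ?thesis
      proof (cases "card W = 1")
        case True
        hence "W = {v}" using v by (metis card_1_singletonE singletonD)
        thus ?thesis using le by (auto intro: exI[of _ "[v]"])
      next
        case False
        define k where "k = card W - 2"
        have "card W = Suc (Suc k)" using False c1 by (simp add: k_def)
        hence "x * path_poly x (card W - 1) < path_poly x (card W)" using pp[of k] by simp
        thus ?thesis using le by simp
      qed
    next
      case True
      then obtain w where w: "w \<in> W" "E v w" by auto
      hence vw: "v \<noteq> w" using irrefl by auto
      have "{z. z \<in> W \<and> E v z} = {w}" using v w by auto
      hence e: "matching_poly x E W = x * matching_poly x E (W - {v}) + matching_poly x E (W - {v, w})"
        using matching_poly_expand[OF less.prems v(1)] by simp
      have cvw: "card (W - {v, w}) = card W - 2" using v w vw less.prems(2) by (simp add: card_Diff_subset)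
      have c2: "card W \<ge> 2" using card_mono[OF less.prems(2), of "{v, w}"] v w vw by simp
      define k where "k = card W - 2"
      have k: "card W = Suc (Suc k)" using c2 by (simp add: k_def)
      have 1: "matching_poly x E (W - {v}) \<le> path_poly x (Suc k)" using IH[of "{v}"] cv k by simp
      have 2: "matching_poly x E (W - {v, w}) \<le> path_poly x k" using IH[of "{v, w}"] cvw k by simp
      have 3: "x * matching_poly x E (W - {v}) \<le> x * path_poly x (Suc k)" using 1 assms(3) by simp
      have "\<exists>ps. distinct ps \<and> set ps = W \<and> successively E ps" if eq: "matching_poly x E
          W = path_poly x (card W)"
      proof -
        have "x * matching_poly x E (W - {v}) + matching_poly x E (W - {v, w}) = x * path_poly x (Suc k) +
            path_poly x k"
          using eq e k by simp
        hence "x * matching_poly x E (W - {v}) = x * path_poly x (Suc k)"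
          and 4: "matching_poly x E (W - {v, w}) = path_poly x k"
          using 2 3 by linarith+
        hence "matching_poly x E (W - {v}) = path_poly x (Suc k)" using assms(3) by simp
        then obtain ps where ps: "distinct ps" "set ps = W - {v}" "successively E ps"
          using IH[of "{v}"] cv k by auto
        from 4 obtain qs where qs: "distinct qs" "set qs = W - {v, w}" "successively E qs"
          using IH[of "{v, w}"] cvw k by auto
        have "w \<in> set ps" using w vw ps by auto
        then obtain as bs where ab: "ps = as @ w # bs" by (meson split_list)
        consider "as = []" | "bs = []" | "as \<noteq> []" "bs \<noteq> []" by blast
        thus ?thesis
        proof cases
          case 1
          hence "distinct (v # ps) \<and> set (v # ps) = W \<and> successively E (v # ps)"
            using ps v w ab by (auto simp: successively_Cons)
          thus ?thesis by blast
        next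
          case 2
          hence "distinct (ps @ [v]) \<and> set (ps @ [v]) = W \<and> successively E (ps @ [v])"
            using ps v w ab sym by (auto simp: successively_append_iff)
          thus ?thesis by blast
        next
          \<comment> \<open>If \<open>w\<close> were an inner vertex of the path on
            \<open>W - {v}\<close>, its two neighbours there would stay connected without
            \<open>w\<close> along \<open>qs\<close>, against acyclicity. So \<open>w\<close> is an
            end, to which \<open>v\<close> can be attached.\<close>
          case 3
          have "E w (last as)" "E w (hd bs)"
            using ps(3) ab 3 sym by (auto simp: successively_append_iff successively_Cons)
          moreover have m: "last as \<in> set as" "hd bs \<in> set bs" using 3 by auto
          moreover have "last as \<noteq> hd bs" using m ps(1) ab by auto
          moreover have W: "last as \<in> set qs" "hd bs \<in> set qs" using m ps(1,2) ab qs(2) by auto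
          moreover have "reach E (W - {w}) (hd bs) (last as)"
            by (rule reach_list[OF qs(3)]) (use qs(2) W in auto)
          ultimately show ?thesis using less.prems(1) w qs(2) unfolding forest_on_def by blast
        qed
      qed
      moreover have "matching_poly x E W \<le> path_poly x (card W)" using e k 2 3 by simp
      ultimately show ?thesis by blast
    qed
  qed
qed

end

section \<open>Graphs with a unique cycle\<close>

text \<open>\<open>zip c (rotate1 c)\<close> lists the cyclically consecutive pairs, the closing
  edge included, so rotating \<open>c\<close> only rotates the list of pairs.\<close>

definition cyc :: "('a \<Rightarrow> 'a \<Rightarrow> bool) \<Rightarrow> 'a set \<Rightarrow> 'a list
    \<Rightarrow> bool" where
  "cyc E V c \<longleftrightarrow> distinct c \<and> 3 \<le> length c \<and> set c \<subseteq> V \<and>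
      (\<forall>(p, q)\<in>set (zip c (rotate1 c)). E p q)"

definition cyc_edges :: "'a list \<Rightarrow> 'a set set" where
  "cyc_edges c = (\<lambda>(p, q). {p, q}) ` set (zip c (rotate1 c))"

lemma successively_zip:
  "successively E (w # ps @ [z]) \<longleftrightarrow> (\<forall>(p, q)\<in>set (zip (w # ps) (ps @ [z])).
      E p q)"
  by (induction ps arbitrary: w) auto

lemma zip_rotate1: "length xs = length ys \<Longrightarrow> zip (rotate1 xs) (rotate1 ys) = rotate1 (zip xs
    ys)"
  by (cases xs; cases ys) auto

lemma cyc_rotate1: "cyc E V c \<Longrightarrow> cyc E V (rotate1 c)"
  by (simp add: cyc_def zip_rotate1)

lemma cyc_rotate: "cyc E V c \<Longrightarrow> cyc E V (rotate k c)"
  by (induction k) (auto simp: rotate_Suc cyc_rotate1)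

lemma cyc_Cons_iff:
  "cyc E V (w # ps) \<longleftrightarrow> distinct (w # ps) \<and> 2 \<le> length ps \<and> set (w # ps)
      \<subseteq> V \<and> successively E (w # ps @ [w])"
  unfolding cyc_def successively_zip by auto

lemma cyc_edges_neighbour:
  assumes "distinct (u # xs)" "xs \<noteq> []" "{u, w} \<in> cyc_edges (u # xs)"
  shows "w = hd xs \<or> w = last xs"
proof -
  obtain p q where pq: "(p, q) \<in> set (zip (u # xs) (xs @ [u]))" "{u, w} = {p, q}"
    using assms(3) by (auto simp: cyc_edges_def)
  obtain i where i: "i < length xs + 1" "p = (u # xs) ! i" "q = (xs @ [u]) ! i"
    using pq(1) by (auto simp: set_zip)
  have un: "u \<notin> set xs" using assms(1) by simp
  show ?thesis
  proof (cases "p = u")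
    case True
    have "i = 0" using i True un by (cases i) auto
    hence "q = hd xs" using i assms(2) by (simp add: nth_append hd_conv_nth)
    thus ?thesis using pq(2) True by (auto simp: doubleton_eq_iff)
  next
    case False
    hence "q = u" using pq(2) by (auto simp: doubleton_eq_iff)
    hence "i = length xs" using i un by (auto simp: nth_append split: if_splits)
    hence "p = last xs" using i assms(2) by (cases xs) (auto simp: last_conv_nth)
    thus ?thesis using pq(2) \<open>q = u\<close> False by (auto simp: doubleton_eq_iff)
  qed
qed

lemma cyc_edges_hd: "{u, v} \<in> cyc_edges (u # v # r)"
  by (auto simp: cyc_edges_def image_iff)

text \<open>A list fixes a starting point and an orientation, so uniqueness is demanded of the edge
  sets only.\<close>

locale unicyclic_rel = simple_rel E for E :: "'a \<Rightarrow> 'a \<Rightarrow> bool" +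
  fixes V :: "'a set"
  assumes fin: "finite V"
    and uniq: "cyc E V c \<Longrightarrow> cyc E V d \<Longrightarrow> cyc_edges c = cyc_edges d"
    and conn: "a \<in> V \<Longrightarrow> b \<in> V \<Longrightarrow> reach E V a b"
begin

lemma cyc_reverse:
  assumes "cyc E V (u # xs)"
  shows "cyc E V (u # rev xs)"
proof -
  have "successively (\<lambda>p q. E q p) (u # xs @ [u])"
    using assms by (auto simp: cyc_Cons_iff elim: successively_mono intro: sym)
  hence "successively E (rev (u # xs @ [u]))" by (simp only: successively_rev)
  thus ?thesis using assms by (auto simp: cyc_Cons_iff)
qed

text \<open>A path from \<open>a\<close> to \<open>b\<close> avoiding \<open>w\<close> closes up at
  \<open>w\<close> to a cycle, which by uniqueness has the edges of \<open>c\<close>. The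
  subrelation \<open>E'\<close> records that the whole cycle runs inside a smaller graph.\<close>

lemma closed_walk_edges:
  assumes "cyc E V c" "w \<in> V" "a \<in> V" "E w a" "E w b" "a \<noteq> b"
    and E': "\<And>p q. E' p q \<Longrightarrow> E p q" "E' w a" "E' b w" and reach: "reach E' (V - {w}) a b"
  shows "{w, a} \<in> cyc_edges c" "\<And>e. e \<in> cyc_edges c \<Longrightarrow> \<exists>p q. e = {p, q}
      \<and> E' p q"
proof -
  have "a \<noteq> w" using assms irrefl by auto
  then obtain ps where ps: "ps \<noteq> []" "hd ps = a" "last ps = b" "distinct ps" "successively E' ps"
      "set ps \<subseteq> V - {w}"
    using reach_imp_path[OF reach] assms by auto
  have suc: "successively E' (w # ps @ [w])"
    using ps E' by (auto simp: successively_Cons successively_append_iff)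
  have "2 \<le> length ps" using ps assms(6) by (cases ps; cases "tl ps") auto
  moreover have "successively E (w # ps @ [w])" using suc by (rule successively_mono) (use E' in auto)
  ultimately have "cyc E V (w # ps)" using ps assms by (auto simp: cyc_Cons_iff)
  hence ce: "cyc_edges c = cyc_edges (w # ps)" using uniq assms by blast
  obtain qs where "ps = a # qs" using ps by (cases ps) auto
  thus "{w, a} \<in> cyc_edges c" unfolding ce by (simp add: cyc_edges_hd)
  fix e assume "e \<in> cyc_edges c"
  hence "e \<in> cyc_edges (w # ps)" using ce by simp
  then obtain p q where pq: "(p, q) \<in> set (zip (w # ps) (ps @ [w]))" "e = {p, q}"
    unfolding cyc_edges_def by auto
  have "E' p q" using suc pq(1) unfolding successively_zip by blast
  thus "\<exists>p q. e = {p, q} \<and> E' p q" using pq(2) by blast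
qed

lemma reach_in_cycle:
  assumes "cyc E V c" "w \<in> V" "a \<in> V" "E w a" "E w b" "a \<noteq> b" "reach E (V - {w}) a b"
  shows "{w, a} \<in> cyc_edges c"
  by (rule closed_walk_edges[OF assms(1-6), of E]) (use assms sym in auto)

text \<open>A cycle avoiding the edge \<open>st\<close> would have the same edges as
  \<open>c\<close>, among them \<open>st\<close>.\<close>

lemma forest_delete_edge:
  assumes "cyc E V c" "{s, t} \<in> cyc_edges c"
  shows "forest_on (\<lambda>p q. E p q \<and> {p, q} \<noteq> {s, t}) V"
  unfolding forest_on_def
proof (intro ballI impI notI)
  fix w u z
  let ?E = "\<lambda>p q. E p q \<and> {p, q} \<noteq> {s, t}"
  assume *: "w \<in> V" "u \<in> V" "z \<in> V" "?E w u" "?E w z" "u \<noteq> z" "reach ?E (V - {w}) z u"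
  have "\<exists>p q. {s, t} = {p, q} \<and> ?E p q"
    by (rule closed_walk_edges(2)[OF assms(1) *(1,3) _ _ _ _ _ _ *(7) assms(2)])
      (use * sym in \<open>auto simp: insert_commute\<close>)
  thus False by auto
qed

lemma forest_delete_vertex:
  assumes "cyc E V c" "s \<in> set c"
  shows "forest_on E (V - {s})"
proof -
  obtain as bs where c: "c = as @ s # bs" using assms by (meson split_list)
  have "cyc E V (rotate (length as) c)" by (rule cyc_rotate[OF assms(1)])
  hence cr: "cyc E V (s # bs @ as)" unfolding c rotate_append by simp
  then obtain t r where "bs @ as = t # r" by (cases "bs @ as") (auto simp: cyc_def)
  hence "{s, t} \<in> cyc_edges (s # bs @ as)" by (simp add: cyc_edges_hd)
  from forest_delete_edge[OF cr this] show ?thesis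
    by (rule forest_mono) (auto simp: doubleton_eq_iff)
qed

text \<open>Without \<open>v\<close> the graph is a forest. A neighbour of \<open>v\<close> other
  than \<open>u\<close> that still reaches \<open>u\<close> lies on a cycle edge at
  \<open>v\<close>, so it is \<open>hd r\<close>, and the only walk runs along \<open>r\<close> back
  to \<open>u\<close> in \<open>length r\<close> steps.\<close>

lemma cycle_cofactor:
  assumes "cyc E V (u # v # r)"
  shows "(\<Sum>z | z \<in> V - {v, u} \<and> E v z. mcof x E (V - {v}) z u) = (- \<i>) ^ length r * mdet x
      E (V - set (u # v # r))"
proof -
  have c: "distinct (u # v # r)" "r \<noteq> []" "set (u # v # r) \<subseteq> V" "successively E (u # v # r
      @ [u])"
    using assms by (auto simp: cyc_Cons_iff)
  have c': "cyc E V (v # r @ [u])" using cyc_rotate1[OF assms] by simp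
  have vr: "E v (hd r)" "hd r \<in> set r" using c by (auto simp: successively_Cons)
  have "mcof x E (V - {v}) z u = 0" if z: "z \<in> V - {v, u}" "E v z" "z \<noteq> hd r" for z
  proof (rule mcof_unreachable)
    show "\<not> reach E (V - {v}) z u"
    proof
      assume "reach E (V - {v}) z u"
      moreover have "E v u" using c sym by auto
      ultimately have "{v, z} \<in> cyc_edges (v # r @ [u])"
        using reach_in_cycle[OF c', of v z u] c z by auto
      hence "z = hd (r @ [u]) \<or> z = last (r @ [u])"
        by (intro cyc_edges_neighbour) (use c in auto)
      thus False using z c by auto
    qed
  qed (use fin z c in auto)
  hence "(\<Sum>z | z \<in> V - {v, u} \<and> E v z. mcof x E (V - {v}) z u) = (\<Sum>z\<in>{hd r}. mcof x
      E (V - {v}) z u)"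
    using fin vr c by (intro sum.mono_neutral_right) auto
  also have "\<dots> = mcof x E (V - {v}) (hd (r @ [u])) (last (r @ [u]))" using c by simp
  also have "\<dots> = (- \<i>) ^ (length (r @ [u]) - 1) * mdet x E (V - {v} - set (r @ [u]))"
    by (rule forest_mcof_path[OF forest_delete_vertex[OF assms]])
      (use fin c in \<open>auto simp: successively_Cons\<close>)
  also have "V - {v} - set (r @ [u]) = V - set (u # v # r)" by auto
  finally show ?thesis by simp
qed

text \<open>Expansion at \<open>u\<close>. The cycle is traversed once starting towards
  \<open>v\<close> and once starting towards \<open>last r\<close>, whence the factor 2. Of the
  matching terms, the one for the edge \<open>uv\<close> stands apart and the others reassemble to
  the expansion of the tree \<open>E'\<close>.\<close>

lemma unicyclic_mdet:
  assumes "cyc E V (u # v # r)"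
  defines "E' \<equiv> \<lambda>p q. E p q \<and> {p, q} \<noteq> {u, v}"
  shows "mdet x E V = of_real (matching_poly x E' V + matching_poly x E (V - {u, v}))
    + 2 * (- \<i>) ^ length r * of_real (matching_poly x E (V - set (u # v # r)))"
proof -
  define t where "t = last r"
  have c: "distinct (u # v # r)" "r \<noteq> []" "set (u # v # r) \<subseteq> V" "successively E (u # v # r
      @ [u])"
    using assms by (auto simp: cyc_Cons_iff)
  have t: "t \<in> set r" "E u t" using c sym by (auto simp: t_def successively_append_iff successively_Cons)
  hence vt: "v \<noteq> t" "t \<noteq> u" using c by auto
  have uv: "E u v" using c by auto
  have V: "u \<in> V" "v \<in> V" "t \<in> V" using c t by auto
  let ?S = "\<lambda>w. \<Sum>z | z \<in> V - {w, u} \<and> E w z. mcof x E (V - {w}) z u"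
  let ?K = "(- \<i>) ^ length r * mdet x E (V - set (u # v # r))"
  have Sv: "?S v = ?K" by (rule cycle_cofactor[OF assms(1)])
  \<comment> \<open>The reversed cycle leaves \<open>u\<close> towards \<open>t\<close>, so the same
    lemma applies to it.\<close>
  have St: "?S t = ?K"
  proof -
    have "r = butlast r @ [t]" using c by (simp add: t_def)
    hence rv: "rev (v # r) = t # rev (v # butlast r)" by (metis rev.simps(2) rev_append rev_singleton_conv
        append_Cons append_Nil rev_rev_ident)
    have "cyc E V (u # t # rev (v # butlast r))" using cyc_reverse[OF assms(1)] unfolding rv .
    from cycle_cofactor[OF this, of x] have "?S t = (- \<i>) ^ length (rev (v # butlast r)) * mdet x E (V -
        set (u # t # rev (v # butlast r)))" .
    moreover have "length (rev (v # butlast r)) = length r" using c(2) by (cases r rule: rev_cases) auto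
    moreover have "set (u # t # rev (v # butlast r)) = set (u # v # r)" unfolding rv[symmetric] by simp
    ultimately show ?thesis by metis
  qed
  have S0: "?S w = 0" if w: "w \<in> V" "E u w" "w \<noteq> v" "w \<noteq> t" for w
  proof (rule sum.neutral, rule ballI)
    fix z assume z: "z \<in> {z. z \<in> V - {w, u} \<and> E w z}"
    show "mcof x E (V - {w}) z u = 0"
    proof (rule mcof_unreachable)
      show "\<not> reach E (V - {w}) z u"
      proof
        assume "reach E (V - {w}) z u"
        hence "reach E (V - {w}) u z" by (rule reach_sym)
        hence "{w, u} \<in> cyc_edges (u # v # r)"
          using reach_in_cycle[OF assms(1), of w u z] w z V sym by auto
        hence "{u, w} \<in> cyc_edges (u # v # r)" by (simp add: insert_commute)
        hence "w = hd (v # r) \<or> w = last (v # r)" by (intro cyc_edges_neighbour) (use c in auto)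
        thus False using w c by (auto simp: t_def)
      qed
    qed (use fin w z V irrefl in auto)
  qed
  let ?N = "{w. w \<in> V \<and> E u w}"
  have finN: "finite ?N" using fin by simp
  have adj: "\<i> * mcof x E V w u = mdet x E (V - {u, w}) + ?S w" if "w \<in> ?N" for w
    using mcof_adjacent[OF fin V(1), of w x] that
    by (simp add: right_diff_distrib sum_distrib_left[symmetric] mult.assoc[symmetric])
  have "(\<Sum>w\<in>?N. ?S w) = (\<Sum>w\<in>{v, t}. ?S w)"
    by (rule sum.mono_neutral_right) (use finN V uv t S0 in auto)
  also have "\<dots> = 2 * ?K" using vt Sv St by simp
  finally have sS: "(\<Sum>w\<in>?N. ?S w) = 2 * ?K" .
  have "mdet x E V = x * mdet x E (V - {u}) + (\<Sum>w\<in>?N. \<i> * mcof x E V w u)"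
    by (rule mdet_expand[OF fin V(1)])
  also have "(\<Sum>w\<in>?N. \<i> * mcof x E V w u) = (\<Sum>w\<in>?N. mdet x E (V - {u, w})) + 2 * ?K"
    unfolding sS[symmetric] sum.distrib[symmetric] by (intro sum.cong refl adj)
  finally have 1: "mdet x E V = x * mdet x E (V - {u}) + (\<Sum>w\<in>?N. mdet x E (V - {u, w})) + 2 * ?K"
      by simp
  interpret E': simple_rel E'
    by unfold_locales (auto simp: E'_def insert_commute irrefl intro: sym)
  have f': "forest_on E' V" unfolding E'_def by (rule forest_delete_edge[OF assms(1) cyc_edges_hd])
  have fu: "forest_on E (V - {u})" by (rule forest_delete_vertex[OF assms(1)]) simp
  have same: "mdet x E' (V - S) = mdet x E (V - S)" if "u \<in> S" for S
    by (rule mdet_cong) (use that in \<open>auto simp: E'_def doubleton_eq_iff\<close>)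
  have N: "?N = insert v {w. w \<in> V \<and> E' u w}" using V uv by (auto simp: E'_def doubleton_eq_iff)
  have "mdet x E' V = x * mdet x E' (V - {u}) + (\<Sum>w | w \<in> V \<and> E' u w. mdet x E' (V - {u, w}))"
    by (rule E'.forest_mdet_expand[OF f' fin V(1)])
  also have "\<dots> = x * mdet x E (V - {u}) + (\<Sum>w | w \<in> V \<and> E' u w. mdet x E (V - {u, w}))"
    by (simp add: same)
  finally have 2: "mdet x E' V = x * mdet x E (V - {u}) + (\<Sum>w | w \<in> V \<and> E' u w. mdet x E (V -
      {u, w}))" .
  have "(\<Sum>w\<in>?N. mdet x E (V - {u, w})) = mdet x E (V - {u, v}) + (\<Sum>w | w \<in> V \<and> E' u
      w. mdet x E (V - {u, w}))"
    unfolding N by (subst sum.insert) (use fin in \<open>auto simp: E'_def\<close>)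
  hence "mdet x E V = mdet x E' V + mdet x E (V - {u, v}) + 2 * ?K" using 1 2 by simp
  moreover have "mdet x E' V = of_real (matching_poly x E' V)" by (rule E'.forest_mdet_eq[OF f' fin])
  moreover have "mdet x E (V - S) = of_real (matching_poly x E (V - S))" if "u \<in> S" for S
    using fin that by (intro forest_mdet_eq forest_subset[OF fu]) auto
  ultimately show ?thesis by simp
qed

text \<open>Deleting \<open>u\<close> cuts off the \<open>k\<close> vertices hanging there, so both
  forests factor with the same \<open>k\<close>. This coupling matters: a choice of \<open>k\<close>
  favourable to one bound may be unfavourable to the other.\<close>

lemma pendant_split:
  assumes "cyc E V (u # v # r)" "w \<in> V" "w \<notin> set (u # v # r)" "E u w" "0 < x"
  shows "\<exists>k\<ge>1. k + length (u # v # r) \<le> card V \<and>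
    matching_poly x E (V - {u, v}) \<le> path_poly x k * path_poly x (card V - 2 - k) \<and>
    matching_poly x E (V - set (u # v # r)) \<le> path_poly x k * path_poly x (card V - length (u # v # r)
        - k)"
proof -
  let ?C = "set (u # v # r)"
  have c: "distinct (u # v # r)" "r \<noteq> []" "?C \<subseteq> V" "successively E (u # v # r @ [u])"
    using assms by (auto simp: cyc_Cons_iff)
  have V: "u \<in> V" "v \<in> V" "E u v" using c by auto
  have fu: "forest_on E (V - {u})" by (rule forest_delete_vertex[OF assms(1)]) simp
  \<comment> \<open>The union of the components of \<open>V - {u}\<close> that contain a neighbour
    of \<open>u\<close> other than its two cycle neighbours \<open>v\<close> and
    \<open>last r\<close>.\<close>
  define W1 where "W1 = {z \<in> V - {u}. \<exists>a\<in>V. E u a \<and> a \<noteq> v \<and> a \<noteq>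
      last r \<and> reach E (V - {u}) a z}"
  have "w \<noteq> u" using assms by auto
  moreover have "w \<noteq> last r" using assms c by (metis last_in_set list.set_intros(2))
  ultimately have w1: "w \<in> W1" using assms(2-4) unfolding W1_def by auto
  have disj: "z \<notin> W1" if z: "z \<in> set (v # r)" for z
  proof
    assume "z \<in> W1"
    then obtain a where a: "a \<in> V" "E u a" "a \<noteq> v" "a \<noteq> last r" "reach E (V - {u}) a z"
        by (auto simp: W1_def)
    have "reach E (V - {u}) z v"
      by (rule reach_list[of "v # r"]) (use c z in \<open>auto simp: successively_Cons
          successively_append_iff\<close>)
    hence "reach E (V - {u}) a v" using a reach_trans by metis
    hence "{u, a} \<in> cyc_edges (u # v # r)" using reach_in_cycle[OF assms(1), of u a v] V a by auto
    hence "a = hd (v # r) \<or> a = last (v # r)" by (intro cyc_edges_neighbour) (use c in auto)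
    thus False using a c by auto
  qed
  have noedge: "\<not> E a b" if "a \<in> W1" "b \<in> V - {u} - W1" for a b
  proof
    assume "E a b"
    hence ab: "reach E (V - {u}) a b" using that by (intro reach_edge) (auto simp: W1_def)
    have "b \<in> W1" using that reach_trans[OF _ ab] unfolding W1_def by blast
    thus False using that by simp
  qed
  have W1V: "W1 \<subseteq> V - {u}" by (auto simp: W1_def)
  have fW1: "finite W1" using W1V fin by (meson finite_subset finite_Diff)
  have split: "matching_poly x E (V - S) \<le> path_poly x (card W1) * path_poly x (card V - card S - card
      W1)"
    if S: "u \<in> S" "S \<subseteq> ?C" for S
  proof -
    have d: "W1 \<inter> S = {}" using S disj W1V by auto
    have eq: "V - S = W1 \<union> (V - S - W1)" using W1V d by auto
    have "forest_on E (W1 \<union> (V - S - W1))" using eq forest_subset[OF fu, of "V - S"] S by auto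
    hence "matching_poly x E (W1 \<union> (V - S - W1)) = matching_poly x E W1 * matching_poly x E (V - S -
        W1)"
      by (rule matching_poly_disjoint) (use fW1 fin noedge S in auto)
    hence "matching_poly x E (V - S) = matching_poly x E W1 * matching_poly x E (V - S - W1)" using eq by simp
    also have "\<dots> \<le> path_poly x (card W1) * path_poly x (card (V - S - W1))"
    proof (rule mult_mono)
      show "matching_poly x E W1 \<le> path_poly x (card W1)"
        using matching_poly_le[OF forest_subset[OF fu W1V] fW1 assms(5)] by blast
      have f: "forest_on E (V - S - W1)" by (rule forest_subset[OF fu]) (use S in auto)
      show "matching_poly x E (V - S - W1) \<le> path_poly x (card (V - S - W1))"
        using matching_poly_le[OF f _ assms(5)] fin by blast
      show "0 \<le> matching_poly x E (V - S - W1)"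
        using matching_poly_pos[OF f _ assms(5)] fin by fastforce
      show "0 \<le> path_poly x (card W1)" using path_poly_pos[OF assms(5)] less_imp_le by blast
    qed
    also have "card (V - S - W1) = card V - card S - card W1"
    proof -
      have "finite S" using S(2) by (rule finite_subset) simp
      hence "card (V - S) = card V - card S" using S c by (intro card_Diff_subset) auto
      moreover have "card (V - S - W1) = card (V - S) - card W1" using fW1 W1V d by (intro
          card_Diff_subset) auto
      ultimately show ?thesis by simp
    qed
    finally show ?thesis .
  qed
  have cC: "card ?C = length (u # v # r)" using c(1) by (rule distinct_card)
  have "card W1 + card ?C = card (W1 \<union> ?C)" using fW1 disj W1V by (intro
      card_Un_disjoint[symmetric]) auto
  also have "\<dots> \<le> card V" using W1V c fin by (intro card_mono) auto
  finally have le: "card W1 + length (u # v # r) \<le> card V" using cC by simp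
  have "1 \<le> card W1" using w1 fW1 by (metis card_0_eq empty_iff not_less_eq_eq One_nat_def le0 Suc_leI
      neq0_conv)
  moreover have "card {u, v} = 2" using c by simp
  ultimately show ?thesis using le split[of "{u, v}"] split[of ?C] cC by (intro exI[of _ "card W1"]) auto
qed

lemma cycle_exit:
  assumes "cyc E V c" "set c \<noteq> V"
  obtains u v r w where "cyc E V (u # v # r)" "set (u # v # r) = set c" "w \<in> V" "w \<notin> set c" "E u w"
proof -
  have c: "c \<noteq> []" "set c \<subseteq> V" using assms by (auto simp: cyc_def)
  obtain b where b: "b \<in> V" "b \<notin> set c" using assms c by blast
  have "hd c \<in> V" using c hd_in_set by blast
  hence "(hd c, b) \<in> {(p, q). E p q \<and> p \<in> V \<and> q \<in> V}\<^sup>*"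
    using conn[of "hd c" b] b by (auto simp: reach_def)
  hence "\<exists>p q. p \<in> set c \<and> q \<in> V \<and> q \<notin> set c \<and> E p q"
    using b(2)
  proof (induction rule: rtrancl_induct)
    case base
    thus ?case using c by simp
  next
    case (step y z)
    thus ?case by (cases "y \<in> set c") auto
  qed
  then obtain u w where uw: "u \<in> set c" "w \<in> V" "w \<notin> set c" "E u w" by blast
  obtain as bs where cc: "c = as @ u # bs" using uw by (meson split_list)
  have cr: "cyc E V (u # bs @ as)" using cyc_rotate[OF assms(1), of "length as"] unfolding cc rotate_append
      by simp
  then obtain v r where vr: "bs @ as = v # r" by (cases "bs @ as") (auto simp: cyc_def)
  have "set (u # v # r) = set c" unfolding vr[symmetric] cc by auto
  thus ?thesis using that cr uw unfolding vr by blast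
qed

end

section \<open>Bounds for graphs with a unique cycle\<close>

lemma power_minus_i:
  "k mod 4 = 0 \<Longrightarrow> (- \<i>) ^ k = 1" "k mod 4 = 2 \<Longrightarrow> (- \<i>) ^ k = - 1"
  "odd k \<Longrightarrow> (- \<i>) ^ k = \<i> \<or> (- \<i>) ^ k = - \<i>"
proof -
  have e: "(- \<i>) ^ k = (- \<i>) ^ (k mod 4)"
  proof -
    have "(- \<i>) ^ k = ((- \<i>) ^ 4) ^ (k div 4) * (- \<i>) ^ (k mod 4)"
      unfolding power_mult[symmetric] power_add[symmetric] by simp
    thus ?thesis by simp
  qed
  show "k mod 4 = 0 \<Longrightarrow> (- \<i>) ^ k = 1" "k mod 4 = 2 \<Longrightarrow> (- \<i>) ^ k = - 1"
      using e by simp_all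
  assume "odd k"
  hence "k mod 4 = 1 \<or> k mod 4 = 3" by presburger
  thus "(- \<i>) ^ k = \<i> \<or> (- \<i>) ^ k = - \<i>" using e by (auto simp: numeral_3_eq_3)
qed

text \<open>The exponent is the cycle length minus 2: lengths with remainder 2 modulo 4 add
  \<open>2 * Q\<close>, multiples of 4 subtract it, and odd lengths make it orthogonal to
  \<open>M\<close>.\<close>

lemma cmod_add_power_i:
  fixes M Q :: real
  defines "z k \<equiv> complex_of_real M + 2 * (- \<i>) ^ k * complex_of_real Q"
  shows "k mod 4 = 0 \<Longrightarrow> cmod (z k) = \<bar>M + 2 * Q\<bar>" "k mod 4 = 2 \<Longrightarrow>
      cmod (z k) = \<bar>M - 2 * Q\<bar>"
    "odd k \<Longrightarrow> (cmod (z k))\<^sup>2 = M\<^sup>2 + 4 * Q\<^sup>2"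
proof -
  assume "k mod 4 = 0"
  hence "z k = complex_of_real (M + 2 * Q)" by (simp add: z_def power_minus_i)
  thus "cmod (z k) = \<bar>M + 2 * Q\<bar>" by (simp only: norm_of_real real_norm_def)
next
  assume "k mod 4 = 2"
  hence "z k = complex_of_real (M - 2 * Q)" by (simp add: z_def power_minus_i)
  thus "cmod (z k) = \<bar>M - 2 * Q\<bar>" by (simp only: norm_of_real real_norm_def)
next
  assume "odd k"
  moreover have "(cmod (complex_of_real M + 2 * s * complex_of_real Q))\<^sup>2 = M\<^sup>2 + 4 *
      Q\<^sup>2" if "s = \<i> \<or> s = - \<i>" for s
    using that by (auto simp: cmod_power2 power_mult_distrib)
  ultimately show "(cmod (z k))\<^sup>2 = M\<^sup>2 + 4 * Q\<^sup>2"
    unfolding z_def using power_minus_i(3)[of k] by blast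
qed

lemma (in simple_rel) path_degree:
  assumes "forest_on E W" "distinct ps" "set ps = W" "successively E ps"
    and "w \<in> W" "a \<in> W" "b \<in> W" "d \<in> W" "E w a" "E w b" "E w d"
  shows "a = b \<or> a = d \<or> b = d"
proof -
  have adj: "j = Suc i \<or> i = Suc j" if "i < length ps" "j < length ps" "E (ps ! i) (ps ! j)" for i j
    using that forest_path_adjacent[OF assms(1,2) _ assms(4), of i j]
      forest_path_adjacent[OF assms(1,2) _ assms(4), of j i] assms(3) sym irrefl
    by (metis linorder_neqE_nat order_refl)
  obtain i where i: "i < length ps" "ps ! i = w" using assms by (metis in_set_conv_nth)
  have "\<exists>j. j < length ps \<and> ps ! j = y \<and> (j = Suc i \<or> i = Suc j)" if "y \<in> W" "E w
      y" for y
    using that assms(3) i adj by (metis in_set_conv_nth)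
  then obtain ja jb jd where "ps ! ja = a" "ps ! jb = b" "ps ! jd = d"
    "ja = Suc i \<or> i = Suc ja" "jb = Suc i \<or> i = Suc jb" "jd = Suc i \<or> i = Suc jd"
    using assms(6-11) by metis
  thus ?thesis by auto
qed

text \<open>\<open>s i\<close> is the position of vertex \<open>i\<close> on the path 1, 2, 3, 4, 5,
  0, 6, 7, ... that remains after deleting the edge between 0 and 1.\<close>

lemma tadpole_arcs:
  assumes "i < n" "j < n" "6 < n"
  defines "s \<equiv> \<lambda>i::nat. if i = 0 then 5 else if i < 6 then i - 1 else i"
  shows "(i, j) \<in> arcs (cycle_with_path n 6) \<longleftrightarrow>
    s j = Suc (s i) \<or> s i = Suc (s j) \<or> i = 0 \<and> j = 1 \<or> i = 1 \<and> j = 0"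
proof -
  have *: "a = 0 \<or> a = 1 \<or> a = 2 \<or> a = 3 \<or> a = 4 \<or> a = 5 \<or> 6 \<le> a" for a :: nat
      by linarith
  show ?thesis using *[of i] *[of j] assms(1-3)
    by (elim disjE) (auto simp: cycle_with_path_arcs s_def)
qed

context unicyclic_rel
begin

text \<open>Isomorphism with \<open>P_n^6\<close> as far as the relation \<open>E\<close> can
  express it, through an enumeration of the vertices; the arcs are matched later.\<close>

definition is_tadpole :: bool where
  "is_tadpole \<longleftrightarrow> (\<exists>ps. distinct ps \<and> set ps = V \<and>
    (\<forall>i<card V. \<forall>j<card V. E (ps ! i) (ps ! j) \<longleftrightarrow> (i, j) \<in> arcs
        (cycle_with_path (card V) 6)))"

text \<open>Equality makes both \<open>G - uv\<close> and \<open>G - C\<close> paths. If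
  \<open>w\<close> were not an end of the second path, it would have two neighbours on it and
  \<open>u\<close> as a third, too many for a vertex of the first path.\<close>

lemma hexagon_equality:
  assumes c: "cyc E V (u # v # r)" "length r = 4" and w: "w \<in> V" "w \<notin> set (u # v # r)" "E u w"
    and x: "0 < x"
    and eq1: "matching_poly x (\<lambda>p q. E p q \<and> {p, q} \<noteq> {u, v}) V = path_poly x (card V)"
    and eq2: "matching_poly x E (V - set (u # v # r)) = path_poly x (card V - 6)"
  shows is_tadpole
proof -
  define E' where "E' = (\<lambda>p q. E p q \<and> {p, q} \<noteq> {u, v})"
  define C where "C = set (u # v # r)"
  interpret E': simple_rel E'
    by unfold_locales (auto simp: E'_def insert_commute irrefl intro: sym)
  have cy: "distinct (u # v # r)" "C \<subseteq> V" "successively E (u # v # r @ [u])"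
    using c by (auto simp: cyc_Cons_iff C_def)
  have f': "forest_on E' V" unfolding E'_def by (rule forest_delete_edge[OF c(1) cyc_edges_hd])
  have fC: "forest_on E (V - C)"
    by (rule forest_subset[OF forest_delete_vertex[OF c(1), of u]]) (auto simp: C_def)
  have cC: "card C = 6" using distinct_card[OF cy(1)] c(2) by (simp add: C_def)
  have cVC: "card (V - C) = card V - 6" using cy(2) cC by (subst card_Diff_subset) (auto simp: C_def)
  obtain ps where ps: "distinct ps" "set ps = V" "successively E' ps"
    using E'.matching_poly_le[OF f' fin x] eq1 unfolding E'_def by blast
  obtain qs where qs: "distinct qs" "set qs = V - C" "successively E qs"
    using matching_poly_le[OF fC _ x] fin eq2 cVC unfolding C_def[symmetric] by auto
  have wq: "w \<in> set qs" using w qs by (auto simp: C_def)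
  have EE': "E' a b" if "E a b" "a \<notin> C \<or> b \<notin> C" for a b
    using that by (auto simp: E'_def C_def doubleton_eq_iff)
  have "\<exists>qs'. distinct qs' \<and> set qs' = V - C \<and> successively E qs' \<and> qs' \<noteq> []
      \<and> hd qs' = w"
  proof -
    obtain as bs where ab: "qs = as @ w # bs" using wq by (meson split_list)
    consider "as = []" | "bs = []" | "as \<noteq> []" "bs \<noteq> []" by blast
    thus ?thesis
    proof cases
      case 1
      thus ?thesis using qs ab by (intro exI[of _ qs]) auto
    next
      case 2
      have "successively (\<lambda>p q. E q p) qs" using qs(3) by (rule successively_mono) (auto intro: sym)
      hence "successively E (rev qs)" by (simp only: successively_rev)
      thus ?thesis using qs ab 2 by (intro exI[of _ "rev qs"]) auto
    next
      case 3
      have e: "E w (last as)" "E w (hd bs)" "E w u"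
        using qs(3) ab 3 sym w by (auto simp: successively_append_iff successively_Cons)
      have m: "last as \<in> set as" "hd bs \<in> set bs" using 3 by auto
      have ne: "last as \<noteq> hd bs" using m qs(1) ab by auto
      have inV: "last as \<in> V - C" "hd bs \<in> V - C" using m qs(2) ab by auto
      have uC: "u \<in> C" "w \<notin> C" using w by (auto simp: C_def)
      have "last as = hd bs \<or> last as = u \<or> hd bs = u"
        by (rule E'.path_degree[OF f' ps]) (use e EE' inV w uC cy in auto)
      thus ?thesis using ne inV uC by auto
    qed
  qed
  then obtain rs where rs: "distinct rs" "set rs = V - C" "successively E rs" "rs \<noteq> []" "hd rs = w"
      by blast
  obtain r1 r2 r3 r4 where r: "r = [r1, r2, r3, r4]" using c(2)
    by (auto simp: numeral_eq_Suc length_Suc_conv)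
  \<comment> \<open>\<open>ds\<close> runs along the path \<open>G - uv\<close>, while
    \<open>ts\<close> lists the vertices in the numbering of \<open>cycle_with_path\<close>; the
    function \<open>s\<close> below translates between the two.\<close>
  define ds where "ds = (v # r @ [u]) @ rs"
  define ts where "ts = (u # v # r) @ rs"
  have ds: "distinct ds" "set ds = V" "distinct ts" "set ts = V"
    using cy rs by (auto simp: ds_def ts_def C_def)
  have n: "length ds = card V" "length ts = card V" using ds distinct_card by metis+
  have n6: "6 < card V" using n(1) rs(4) r by (cases rs) (auto simp: ds_def)
  have "successively E' (v # r @ [u])"
    using cy(1,3) unfolding r by (auto simp: E'_def doubleton_eq_iff)
  moreover have "successively E' rs"
    using rs(3) by (rule successively_mono) (use EE' rs(2) in auto)
  moreover have "E' u w" using w EE' by (auto simp: C_def)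
  ultimately have sds: "successively E' ds" using rs
    unfolding ds_def by (subst successively_append_iff) simp
  have adj': "E' (ds ! i) (ds ! j) \<longleftrightarrow> j = Suc i \<or> i = Suc j" if "i < card V" "j <
      card V" for i j
  proof
    assume "E' (ds ! i) (ds ! j)"
    thus "j = Suc i \<or> i = Suc j"
      using that n(1) E'.forest_path_adjacent[OF f' ds(1) _ sds, of i j]
        E'.forest_path_adjacent[OF f' ds(1) _ sds, of j i] ds(2) E'.sym E'.irrefl
      by (metis linorder_neqE_nat order_refl)
  next
    assume "j = Suc i \<or> i = Suc j"
    thus "E' (ds ! i) (ds ! j)"
      using that n(1) successively_nth[OF sds] E'.sym by (metis)
  qed
  define s where "s = (\<lambda>i::nat. if i = 0 then 5 else if i < 6 then i - 1 else i)"
  have s: "ts ! i = ds ! s i" "s i < card V" if "i < card V" for i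
  proof -
    show "s i < card V" using that n6 by (auto simp: s_def)
    consider "i = 0" | "i = 1" | "i = 2" | "i = 3" | "i = 4" | "i = 5" | "6 \<le> i" by linarith
    thus "ts ! i = ds ! s i"
      by cases (auto simp: ts_def ds_def r s_def nth_append nth_Cons split: nat.splits)
  qed
  have uv: "ts ! 0 = u" "ts ! 1 = v" by (auto simp: ts_def)
  have "E (ts ! i) (ts ! j) \<longleftrightarrow> (i, j) \<in> arcs (cycle_with_path (card V) 6)"
    if ij: "i < card V" "j < card V" for i j
  proof -
    have "E u v" using cy by auto
    hence "E (ts ! i) (ts ! j) \<longleftrightarrow> E' (ts ! i) (ts ! j) \<or> {ts ! i, ts ! j} = {u, v}"
      using sym by (auto simp: E'_def doubleton_eq_iff)
    also have "{ts ! i, ts ! j} = {u, v} \<longleftrightarrow> i = 0 \<and> j = 1 \<or> i = 1 \<and> j = 0"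
      unfolding uv[symmetric] doubleton_eq_iff using ij n n6 ds(3)
      by (auto simp: nth_eq_iff_index_eq)
    also have "E' (ts ! i) (ts ! j) \<longleftrightarrow> s j = Suc (s i) \<or> s i = Suc (s j)"
      using s ij adj' by simp
    finally show ?thesis using tadpole_arcs[OF ij n6] unfolding s_def by blast
  qed
  thus ?thesis unfolding is_tadpole_def using ds by blast
qed

section \<open>Determinant bounds by type of cycle\<close>

lemma unicyclic_components:
  assumes "cyc E V (u # v # r)" "0 < x"
  obtains M Q where "mdet x E V = of_real M + 2 * (- \<i>) ^ length r * of_real Q" "0 < M" "0 < Q"
    "M = matching_poly x (\<lambda>p q. E p q \<and> {p, q} \<noteq> {u, v}) V + matching_poly x E (V - {u,
        v})"
    "Q = matching_poly x E (V - set (u # v # r))"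
    "matching_poly x (\<lambda>p q. E p q \<and> {p, q} \<noteq> {u, v}) V \<le> path_poly x (card V)"
    "matching_poly x E (V - {u, v}) \<le> path_poly x (card V - 2)"
proof -
  define E' where "E' = (\<lambda>p q. E p q \<and> {p, q} \<noteq> {u, v})"
  interpret E': simple_rel E'
    by unfold_locales (auto simp: E'_def insert_commute irrefl intro: sym)
  have f': "forest_on E' V" unfolding E'_def by (rule forest_delete_edge[OF assms(1) cyc_edges_hd])
  have fu: "forest_on E (V - S)" if "u \<in> S" for S
    by (rule forest_subset[OF forest_delete_vertex[OF assms(1), of u]]) (use that in auto)
  have "distinct (u # v # r)" "{u, v} \<subseteq> V" using assms(1) by (auto simp: cyc_Cons_iff)
  hence c2: "card (V - {u, v}) = card V - 2" by (subst card_Diff_subset) auto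
  have p1: "0 < matching_poly x E' V" by (rule E'.matching_poly_pos[OF f' fin assms(2)])
  have p2: "0 < matching_poly x E (V - S)" if "u \<in> S" for S
    by (rule matching_poly_pos[OF fu[OF that] _ assms(2)]) (use fin in auto)
  have l1: "matching_poly x E' V \<le> path_poly x (card V)" using E'.matching_poly_le[OF f' fin assms(2)]
      by blast
  have l2: "matching_poly x E (V - {u, v}) \<le> path_poly x (card V - 2)"
    using matching_poly_le[OF fu _ assms(2), of "{u, v}"] fin c2 by auto
  show ?thesis
    by (rule that[OF unicyclic_mdet[OF assms(1)] _ _ refl refl]) (use p1 p2 l1 l2 in \<open>auto simp:
        E'_def intro: add_pos_pos\<close>)
qed

lemma length_eq_if_cyc: "cyc E V c \<Longrightarrow> cyc E V d \<Longrightarrow> set c = set d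
    \<Longrightarrow> length c = length d"
  unfolding cyc_def by (metis distinct_card)

lemma even_cycle_bound:
  assumes "cyc E V c" "set c \<noteq> V" "even (length c)" "16 \<le> card V" "\<not> is_tadpole" "0 < x"
  shows "cmod (mdet x E V) < tadpole_poly x (card V)"
proof -
  define n where "n = card V"
  define m where "m = n - 10"
  have n: "n = m + 10" "16 \<le> n" using assms(4) by (simp_all add: n_def m_def)
  obtain u v r w where e: "cyc E V (u # v # r)" "set (u # v # r) = set c" "w \<in> V" "w \<notin> set c" "E
      u w"
    using cycle_exit[OF assms(1,2)] by blast
  define l where "l = length (u # v # r)"
  have l: "l = length c" using length_eq_if_cyc[OF e(1) assms(1) e(2)] by (simp add: l_def)
  have l3: "3 \<le> l" using assms(1) l by (simp add: cyc_def)
  have lr: "length r = l - 2" by (simp add: l_def)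
  obtain M Q where MQ: "mdet x E V = of_real M + 2 * (- \<i>) ^ length r * of_real Q" "0 < M" "0 < Q"
    "M = matching_poly x (\<lambda>p q. E p q \<and> {p, q} \<noteq> {u, v}) V + matching_poly x E (V - {u,
        v})"
    "Q = matching_poly x E (V - set (u # v # r))"
    "matching_poly x (\<lambda>p q. E p q \<and> {p, q} \<noteq> {u, v}) V \<le> path_poly x (card V)"
    "matching_poly x E (V - {u, v}) \<le> path_poly x (card V - 2)"
    by (rule unicyclic_components[OF e(1) assms(6)])
  note MQ = MQ[folded n_def]
  have we: "w \<notin> set (u # v # r)" unfolding e(2) by (rule e(4))
  obtain k where k: "1 \<le> k" "k + l \<le> n"
    "matching_poly x E (V - {u, v}) \<le> path_poly x k * path_poly x (n - 2 - k)"
    "Q \<le> path_poly x k * path_poly x (n - l - k)"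
    using pendant_split[OF e(1,3) we e(5) assms(6)] unfolding MQ(5) n_def l_def by blast
  have "path_poly x k * path_poly x (n - 2 - k) \<le> path_poly x 2 * path_poly x (n - 2 - 2)"
    by (rule path_poly_mult_le_2) (use k l3 n assms(6) in auto)
  hence M: "M \<le> path_poly x n + path_poly x 2 * path_poly x (n - 4)"
    using MQ(4,6) k(3) by simp
  have Q: "Q \<le> path_poly x (n - l)"
    using k(4) path_poly_mult_le[OF assms(6), of k "n - l - k"] k(2) by simp
  have mono: "path_poly x (n - l) \<le> path_poly x (n - j)" if "j \<le> l" "even (l - j)" for j
  proof -
    have "n - j = (n - l) + 2 * ((l - j) div 2)" using that k(2) by simp
    thus ?thesis using path_poly_mono_even[OF assms(6), of "n - l" "(l - j) div 2"] by simp
  qed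
  have "even l" using assms(3) l by simp
  hence lm: "l mod 4 = 0 \<or> l mod 4 = 2" by presburger
  have lr2: "l = length r + 2" by (simp add: l_def)
  have md: "(j + 2) mod 4 = 0 \<Longrightarrow> j mod 4 = 2" "(j + 2) mod 4 = 2 \<Longrightarrow> j mod 4 = 0"
    "3 \<le> j \<Longrightarrow> j mod 4 = 0 \<Longrightarrow> 4 \<le> j" "3 \<le> j \<Longrightarrow> j
        mod 4 = 2 \<Longrightarrow> j = 6 \<or> 10 \<le> j" for j :: nat
    by presburger+
  from lm consider "l mod 4 = 0" | "l mod 4 = 2" by (rule disjE)
  hence "cmod (mdet x E V) < tadpole_poly x n"
  proof cases
    assume l4: "l mod 4 = 0"
    have "4 \<le> l" by (rule md(3)[OF l3 l4])
    have "length r mod 4 = 2" by (rule md(1)[OF l4[unfolded lr2]])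
    hence "cmod (mdet x E V) = \<bar>M - 2 * Q\<bar>" unfolding MQ(1) by (rule cmod_add_power_i)
    moreover have "2 * Q \<le> 2 * path_poly x (n - 4)"
      using Q mono[of 4] \<open>4 \<le> l\<close> \<open>even l\<close> by simp
    ultimately show ?thesis
      using MQ(2,3) M tadpole_gt_matching[OF assms(6) n(1)] tadpole_gt_twice_path[OF assms(6) n(1)] by
          linarith
  next
    assume l4: "l mod 4 = 2"
    have "length r mod 4 = 0" by (rule md(2)[OF l4[unfolded lr2]])
    hence cm: "cmod (mdet x E V) = M + 2 * Q"
      using cmod_add_power_i(1)[of "length r" M Q] MQ(2,3) unfolding MQ(1) by simp
    have "l = 6 \<or> 10 \<le> l" by (rule md(4)[OF l3 l4])
    thus ?thesis
    proof
      assume "10 \<le> l"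
      hence "Q \<le> path_poly x (n - 10)" using Q mono[of 10] \<open>even l\<close> by simp
      thus ?thesis using cm M tadpole_gt_matching_10[OF assms(6) n(1)] by linarith
    next
      assume l6: "l = 6"
      \<comment> \<open>For \<open>k = 2\<close> the bound on \<open>M\<close> is the largest
        possible, but \<open>Q\<close> then splits into a product and loses more. For any other
        \<open>k\<close> both bounds drop to the values of \<open>P_n^6\<close>, and equality
        throughout is excluded because \<open>G\<close> is not that graph.\<close>
      show ?thesis
      proof (cases "k = 2")
        case True
        have "Q \<le> path_poly x 2 * path_poly x (n - 8)" using k(4) True l6 by simp
        thus ?thesis using cm M tadpole_gt_matching_8[OF assms(6) n(1)] by linarith
      next
        case False
        have "path_poly x k * path_poly x (n - 2 - k) \<le> path_poly x 4 * path_poly x (n - 2 - 4)"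
          by (rule path_poly_mult_le_4) (use k l6 n False assms(6) in auto)
        hence a: "matching_poly x E (V - {u, v}) \<le> path_poly x 4 * path_poly x (n - 6)" using k(3) by simp
        have q: "Q \<le> path_poly x (n - 6)" using Q l6 by simp
        have tp: "tadpole_poly x n = path_poly x n + path_poly x 4 * path_poly x (n - 6) + 2 * path_poly x
            (n - 6)"
          by (simp add: tadpole_poly_def distrib_right)
        have "cmod (mdet x E V) \<noteq> tadpole_poly x n"
        proof
          assume "cmod (mdet x E V) = tadpole_poly x n"
          hence "matching_poly x (\<lambda>p q. E p q \<and> {p, q} \<noteq> {u, v}) V = path_poly x n" "Q
            = path_poly x (n - 6)"
            using a q tp cm MQ(4,6) by linarith+
          hence "matching_poly x (\<lambda>p q. E p q \<and> {p, q} \<noteq> {u, v}) V = path_poly x (card V)"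
            "matching_poly x E (V - set (u # v # r)) = path_poly x (card V - 6)"
            unfolding MQ(5) n_def by simp_all
          moreover have "length r = 4" using l6 lr by simp
          ultimately show False using hexagon_equality[OF e(1) _ e(3) we e(5) assms(6)] assms(5) by blast
        qed
        thus ?thesis using a q tp cm MQ(4,6) by linarith
      qed
    qed
  qed
  thus ?thesis by (simp add: n_def)
qed

lemma odd_cycle_bound:
  assumes "cyc E V c" "set c \<noteq> V" "odd (length c)" "16 \<le> card V" "0 < x"
  shows "(cmod (mdet x E V))\<^sup>2 \<le> triangle_poly x (card V)"
proof -
  define n where "n = card V"
  define m where "m = n - 10"
  have n: "n = m + 10" "16 \<le> n" using assms(4) by (simp_all add: n_def m_def)
  obtain u v r w where e: "cyc E V (u # v # r)" "set (u # v # r) = set c" "w \<in> V" "w \<notin> set c" "E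
      u w"
    using cycle_exit[OF assms(1,2)] by blast
  define l where "l = length (u # v # r)"
  have l: "l = length c" using length_eq_if_cyc[OF e(1) assms(1) e(2)] by (simp add: l_def)
  have l3: "3 \<le> l" using assms(1) l by (simp add: cyc_def)
  have lr: "length r = l - 2" by (simp add: l_def)
  obtain M Q where MQ: "mdet x E V = of_real M + 2 * (- \<i>) ^ length r * of_real Q" "0 < M" "0 < Q"
    "M = matching_poly x (\<lambda>p q. E p q \<and> {p, q} \<noteq> {u, v}) V + matching_poly x E (V - {u,
        v})"
    "Q = matching_poly x E (V - set (u # v # r))"
    "matching_poly x (\<lambda>p q. E p q \<and> {p, q} \<noteq> {u, v}) V \<le> path_poly x (card V)"
    "matching_poly x E (V - {u, v}) \<le> path_poly x (card V - 2)"
    by (rule unicyclic_components[OF e(1) assms(5)])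
  note MQ = MQ[folded n_def]
  have we: "w \<notin> set (u # v # r)" unfolding e(2) by (rule e(4))
  obtain k where k: "1 \<le> k" "k + l \<le> n"
    "matching_poly x E (V - {u, v}) \<le> path_poly x k * path_poly x (n - 2 - k)"
    "Q \<le> path_poly x k * path_poly x (n - l - k)"
    using pendant_split[OF e(1,3) we e(5) assms(5)] unfolding MQ(5) n_def l_def by blast
  note pp = path_poly_pos[OF assms(5)]
  have "odd (length r)" using assms(3) l l3 lr by simp
  hence cm: "(cmod (mdet x E V))\<^sup>2 = M\<^sup>2 + 4 * Q\<^sup>2" unfolding MQ(1) by (rule
      cmod_add_power_i)
  have "path_poly x k * path_poly x (n - 2 - k) \<le> path_poly x 2 * path_poly x (n - 2 - 2)"
    by (rule path_poly_mult_le_2) (use k l3 n assms(5) in auto)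
  hence M: "M \<le> path_poly x n + path_poly x 2 * path_poly x (n - 4)"
    using MQ(4,6) k(3) by simp
  have *: "M\<^sup>2 + 4 * Q\<^sup>2 \<le> triangle_poly x n" if "Q \<le> path_poly x 2 * path_poly x (n - 5)"
    unfolding triangle_poly_def using M that MQ(2,3) by (intro add_mono mult_left_mono power_mono) auto
  have "M\<^sup>2 + 4 * Q\<^sup>2 \<le> triangle_poly x n"
  proof (cases "l = 3")
    case l3': True
    show ?thesis
    proof (cases "k = n - 3")
      case False
      have "path_poly x k * path_poly x (n - 3 - k) \<le> path_poly x 2 * path_poly x (n - 3 - 2)"
        by (rule path_poly_mult_le_2) (use k l3' n False assms(5) in auto)
      thus ?thesis using k(4) l3' by (intro *) simp
    next
      case True
      have "n - 2 - k = 1" "n - l - k = 0" using True l3' n by auto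
      hence "M \<le> path_poly x n + x * path_poly x (n - 3)" "Q \<le> path_poly x (n - 3)"
        using MQ(4,6) k(3,4) True by (simp_all add: mult.commute)
      hence "M\<^sup>2 + 4 * Q\<^sup>2 \<le> (path_poly x n + x * path_poly x (n - 3))\<^sup>2 + 4 *
          (path_poly x (n - 3))\<^sup>2"
        using MQ(2,3) by (intro add_mono mult_left_mono power_mono) auto
      also have "\<dots> \<le> triangle_poly x n" by (rule triangle_tail_le[OF assms(5) n(1)])
      finally show ?thesis .
    qed
  next
    case False
    have "odd l" using assms(3) l by simp
    hence l5: "5 \<le> l" using False l3 by (cases "l = 4") auto
    have "n - 5 = (n - l) + 2 * ((l - 5) div 2)" using l5 \<open>odd l\<close> k(2) by simp
    hence "path_poly x (n - l) \<le> path_poly x (n - 5)"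
      using path_poly_mono_even[OF assms(5), of "n - l" "(l - 5) div 2"] by simp
    moreover have "Q \<le> path_poly x (n - l)"
      using k(4) path_poly_mult_le[OF assms(5), of k "n - l - k"] k(2) by simp
    moreover have "1 * path_poly x (n - 5) \<le> path_poly x 2 * path_poly x (n - 5)"
      using pp[of "n - 5"] assms(5) by (intro mult_right_mono) (auto simp: path_poly_values)
    ultimately show ?thesis by (intro *) simp
  qed
  thus ?thesis using cm by (simp add: n_def)
qed

text \<open>Nothing remains outside the cycle, so \<open>Q = 1\<close>. The triangle inequality
  takes the unfavourable sign, giving one bound for both even residues modulo 4; for odd order the
  cycle term is imaginary and adds 4 to the square.\<close>

lemma full_cycle_bound:
  assumes "cyc E V c" "set c = V" "0 < x"
  shows "cmod (mdet x E V) \<le> path_poly x (card V) + path_poly x (card V - 2) + 2"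
    and "odd (card V) \<Longrightarrow> (cmod (mdet x E V))\<^sup>2 \<le> (path_poly x (card V) + path_poly
        x (card V - 2))\<^sup>2 + 4"
proof -
  obtain u v r where c: "c = u # v # r" using assms(1) by (cases c; cases "tl c") (auto simp: cyc_def)
  have n: "card V = length r + 2" using assms(1,2) distinct_card[of c] by (simp add: cyc_def c)
  obtain M Q where MQ: "mdet x E V = of_real M + 2 * (- \<i>) ^ length r * of_real Q" "0 < M" "0 < Q"
    "M = matching_poly x (\<lambda>p q. E p q \<and> {p, q} \<noteq> {u, v}) V + matching_poly x E (V - {u,
        v})"
    "Q = matching_poly x E (V - set (u # v # r))"
    "matching_poly x (\<lambda>p q. E p q \<and> {p, q} \<noteq> {u, v}) V \<le> path_poly x (card V)"
    "matching_poly x E (V - {u, v}) \<le> path_poly x (card V - 2)"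
    by (rule unicyclic_components[OF assms(1)[unfolded c] assms(3)])
  have Q: "Q = 1" using MQ(5) assms(2) c by simp
  have M: "M \<le> path_poly x (card V) + path_poly x (card V - 2)" using MQ(4,6,7) by simp
  have "cmod (mdet x E V) \<le> M + 2"
    unfolding MQ(1) Q using norm_triangle_ineq[of "of_real M" "2 * (- \<i>) ^ length r"] MQ(2)
    by (simp add: norm_mult norm_power)
  thus "cmod (mdet x E V) \<le> path_poly x (card V) + path_poly x (card V - 2) + 2" using M by simp
  assume "odd (card V)"
  hence "(cmod (mdet x E V))\<^sup>2 = M\<^sup>2 + 4 * Q\<^sup>2" unfolding MQ(1) by (intro
      cmod_add_power_i) (simp add: n)
  thus "(cmod (mdet x E V))\<^sup>2 \<le> (path_poly x (card V) + path_poly x (card V - 2))\<^sup>2 + 4"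
    unfolding Q using M MQ(2) by (simp add: power_mono)
qed

end

section \<open>Energy\<close>

lemma symmetric_real_eigenvalue:
  fixes A :: "complex mat"
  assumes A: "A \<in> carrier_mat n n" and sym: "\<And>i j. i < n \<Longrightarrow> j < n \<Longrightarrow>
      A $$ (i, j) = A $$ (j, i)"
    and real: "\<And>i j. i < n \<Longrightarrow> j < n \<Longrightarrow> A $$ (i, j) \<in> \<real>" and k:
        "eigenvalue A k"
  shows "k \<in> \<real>"
proof -
  obtain v where v: "v \<in> carrier_vec n" "v \<noteq> 0\<^sub>v n" "A *\<^sub>v v = k \<cdot>\<^sub>v v"
    using k A unfolding eigenvalue_def eigenvector_def by auto
  define S where "S = (\<Sum>i<n. \<Sum>j<n. cnj (v $ i) * A $$ (i, j) * v $ j)"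
  define R where "R = (\<Sum>i<n. (cmod (v $ i))\<^sup>2)"
  have row: "(\<Sum>j<n. A $$ (i, j) * v $ j) = k * v $ i" if "i < n" for i
  proof -
    have "(A *\<^sub>v v) $ i = (\<Sum>j<n. A $$ (i, j) * v $ j)"
      using A v(1) that by (simp add: scalar_prod_def atLeast0LessThan)
    thus ?thesis using v that by simp
  qed
  have "S = (\<Sum>i<n. cnj (v $ i) * (k * v $ i))"
    unfolding S_def by (intro sum.cong refl) (simp add: row[symmetric] sum_distrib_left mult.assoc)
  also have "\<dots> = k * of_real R"
    unfolding R_def of_real_sum sum_distrib_left
    by (intro sum.cong refl) (simp add: complex_norm_square mult_ac del: of_real_power)
  finally have S: "S = k * of_real R" .
  have "cnj S = (\<Sum>i<n. \<Sum>j<n. v $ i * A $$ (i, j) * cnj (v $ j))"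
    unfolding S_def using real by (simp add: Reals_cnj_iff)
  also have "\<dots> = (\<Sum>j<n. \<Sum>i<n. v $ i * A $$ (i, j) * cnj (v $ j))" by (rule sum.swap)
  also have "\<dots> = S"
    unfolding S_def by (intro sum.cong refl) (use sym in \<open>simp add: mult_ac\<close>)
  finally have "cnj k * of_real R = k * of_real R" unfolding S by simp
  moreover have "R \<noteq> 0"
  proof
    assume "R = 0"
    hence "\<forall>i<n. v $ i = 0" unfolding R_def by (simp add: sum_nonneg_eq_0_iff)
    hence "v = 0\<^sub>v n" using v(1) by (intro eq_vecI) auto
    thus False using v(2) by simp
  qed
  ultimately show ?thesis by (simp add: Reals_cnj_iff)
qed

text \<open>Since \<open>\<i> x I - A = \<i> (x I + \<i> A)\<close>, the two determinants differ by
  a power of \<open>\<i>\<close>. The remaining work carries permutations of indices over to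
  permutations of vertices.\<close>

lemma cmod_char_poly_adjacency:
  assumes "distinct vs" and loopfree: "\<And>u. (u, u) \<notin> arcs_ends G"
  shows "cmod (poly (char_poly (adjacency_matrix G vs)) (\<i> * of_real x))
    = cmod (mdet x (\<lambda>u v. (u, v) \<in> arcs_ends G) (set vs))"
proof -
  define n where "n = length vs"
  define A where "A = adjacency_matrix G vs"
  let ?E = "\<lambda>u v. (u, v) \<in> arcs_ends G"
  let ?w = "adj_weight x ?E"
  have A: "A \<in> carrier_mat n n" by (simp add: A_def adjacency_matrix_def n_def)
  have bij: "bij_betw ((!) vs) {0..<n} (set vs)"
    using bij_betw_nth[OF assms(1), of "{0..<n}" "set vs"] by (simp add: n_def atLeast0LessThan)
  hence inj: "inj_on ((!) vs) {0..<n}" by (rule bij_betw_imp_inj_on)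
  let ?m = "map_permutation {0..<n} ((!) vs)"
  have bijm: "bij_betw ?m {p. p permutes {0..<n}} {q. q permutes set vs}"
  proof -
    have "?m = (\<lambda>p y. if y \<in> set vs then vs ! (p (inv_into {0..<n} ((!) vs) y)) else y)"
      using bij by (intro ext) (auto simp: map_permutation_def restrict_id_def bij_betw_def)
    thus ?thesis using bij_betw_permutations[OF bij] by simp
  qed
  have ent: "(- char_matrix A (\<i> * of_real x)) $$ (i, j) = \<i> * ?w (vs ! i) (vs ! j)" if "i < n" "j <
      n" for i j
  proof -
    have "vs ! i = vs ! j \<longleftrightarrow> i = j" using assms that by (simp add: nth_eq_iff_index_eq
        n_def)
    thus ?thesis
      using that loopfree A
      by (auto simp: char_matrix_def A_def adjacency_matrix_def n_def adj_weight_def mult.assoc[symmetric])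
  qed
  have cA: "- char_matrix A (\<i> * of_real x) \<in> carrier_mat n n" using A by auto
  have "poly (char_poly A) (\<i> * of_real x) = det (- char_matrix A (\<i> * of_real x))"
    by (rule char_poly_matrix[OF A])
  also have "\<dots> = (\<Sum>p | p permutes {0..<n}. of_int (sign p) * (\<Prod>i = 0..<n. \<i> * ?w (vs !
      i) (vs ! p i)))"
    unfolding det_def'[OF cA]
  proof (intro sum.cong refl arg_cong2[of _ _ _ _ "(*)"] prod.cong)
    fix p i assume "p \<in> {p. p permutes {0..<n}}" "i \<in> {0..<n}"
    hence "p i \<in> {0..<n}" by (simp add: permutes_in_image)
    thus "(- char_matrix A (\<i> * of_real x)) $$ (i, p i) = \<i> * ?w (vs ! i) (vs ! p i)"
      using \<open>i \<in> {0..<n}\<close> ent by simp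
  qed
  also have "\<dots> = \<i> ^ n * (\<Sum>p | p permutes {0..<n}. of_int (sign p) * (\<Prod>i = 0..<n. ?w
      (vs ! i) (vs ! p i)))"
    unfolding sum_distrib_left by (intro sum.cong refl) (simp add: prod.distrib mult_ac)
  also have "(\<Sum>p | p permutes {0..<n}. of_int (sign p) * (\<Prod>i = 0..<n. ?w (vs ! i) (vs ! p i)))
      = (\<Sum>p | p permutes {0..<n}. of_int (sign (?m p)) * (\<Prod>v\<in>set vs. ?w v (?m p v)))"
  proof (intro sum.cong refl arg_cong2[of _ _ _ _ "(*)"])
    fix p assume "p \<in> {p. p permutes {0..<n}}"
    hence p: "p permutes {0..<n}" by simp
    show "of_int (sign p) = (of_int (sign (?m p)) :: complex)"
      using sign_map_permutation[OF inj p] by simp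
    have "(\<Prod>v\<in>set vs. ?w v (?m p v)) = (\<Prod>i\<in>{0..<n}. ?w (vs ! i) (?m p (vs ! i)))"
      by (rule prod.reindex_bij_betw[OF bij, symmetric])
    also have "\<dots> = (\<Prod>i = 0..<n. ?w (vs ! i) (vs ! p i))"
      by (intro prod.cong refl) (simp add: map_permutation_apply[OF inj])
    finally show "(\<Prod>i = 0..<n. ?w (vs ! i) (vs ! p i)) = (\<Prod>v\<in>set vs. ?w v (?m p v))" ..
  qed
  also have "\<dots> = mdet x ?E (set vs)"
    unfolding sdet_def by (rule sum.reindex_bij_betw[OF bijm])
  finally show ?thesis unfolding A_def by (simp add: norm_mult norm_power)
qed

text \<open>\<open>A\<close> consists of the moduli of the eigenvalues. These are real by symmetry,
  so each linear factor at \<open>\<i> x\<close> has squared modulus \<open>x^2 + a^2\<close>, the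
  form required by \<open>coulson_compare\<close>.\<close>

lemma energy_spectrum:
  assumes "graph G"
  obtains A where "energy G = (\<Sum>a\<in>#A. a)" "size A = card (verts G)" "\<And>a. a \<in># A
      \<Longrightarrow> 0 \<le> a"
    "\<And>x. (\<Prod>a\<in>#A. x\<^sup>2 + a\<^sup>2) = (cmod (mdet x (\<lambda>u v. (u, v) \<in>
        arcs_ends G) (verts G)))\<^sup>2"
proof -
  interpret graph G by fact
  obtain vs where vs: "distinct vs" "set vs = verts G" using finite_distinct_list[OF finite_verts] by blast
  define n where "n = length vs"
  define A where "A = adjacency_matrix G vs"
  have A: "A \<in> carrier_mat n n" by (simp add: A_def adjacency_matrix_def n_def)
  obtain as where as: "char_poly A = (\<Prod>a\<leftarrow>as. [:- a, 1:])" "length as = n" using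
      char_poly_factorized[OF A] by blast
  have pr: "proots (\<Prod>a\<leftarrow>bs. [:- a, 1:]) = mset bs" for bs :: "complex list"
  proof (induction bs)
    case (Cons b bs)
    have "(\<Prod>a\<leftarrow>bs. [:- a, 1:]) \<noteq> 0" by (auto simp: prod_list_zero_iff)
    thus ?case using Cons by (simp add: proots_mult del: mult_pCons_left)
  qed simp
  have ss: "(b, a) \<in> arcs_ends G" if "(a, b) \<in> arcs_ends G" for a b
    using sym_arcs that by (auto simp: symmetric_def dest: symD)
  have nl: "(a, a) \<notin> arcs_ends G" for a using no_loops by (auto simp: arcs_ends_conv)
  have real: "a \<in> \<real>" if "a \<in> set as" for a
  proof (rule symmetric_real_eigenvalue[OF A])
    show "eigenvalue A a"
      unfolding eigenvalue_root_char_poly[OF A] as(1) using that by (simp add: poly_prod_list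
          prod_list_zero_iff image_iff)
  qed (use ss in \<open>auto simp: A_def adjacency_matrix_def n_def\<close>)
  let ?E = "\<lambda>u v. (u, v) \<in> arcs_ends G"
  have prod: "(\<Prod>a\<in>#image_mset cmod (mset as). x\<^sup>2 + a\<^sup>2) = (cmod (mdet x ?E (verts
      G)))\<^sup>2" for x
  proof -
    have "cmod (mdet x ?E (verts G)) = cmod (poly (char_poly A) (\<i> * of_real x))"
      using cmod_char_poly_adjacency[OF vs(1) nl, of x] by (simp add: A_def vs(2))
    also have "\<dots> = (\<Prod>a\<leftarrow>as. cmod (\<i> * of_real x - a))"
      unfolding as(1) by (induction as) (simp_all add: norm_mult del: mult_pCons_left)
    finally have "(cmod (mdet x ?E (verts G)))\<^sup>2 = (\<Prod>a\<leftarrow>as. cmod (\<i> * of_real x -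
        a))\<^sup>2" by simp
    also have "\<dots> = (\<Prod>a\<leftarrow>as. (cmod (\<i> * of_real x - a))\<^sup>2)"
      by (induction as) (simp_all add: power_mult_distrib)
    also have "\<dots> = (\<Prod>a\<leftarrow>as. x\<^sup>2 + (cmod a)\<^sup>2)"
    proof (intro arg_cong[of _ _ prod_list] map_cong refl)
      fix a assume "a \<in> set as"
      then obtain r where "a = of_real r" using real Reals_cases by blast
      thus "(cmod (\<i> * of_real x - a))\<^sup>2 = x\<^sup>2 + (cmod a)\<^sup>2" by (simp add: cmod_power2)
    qed
    also have "\<dots> = (\<Prod>a\<in>#image_mset cmod (mset as). x\<^sup>2 + a\<^sup>2)"
      by (simp add: image_mset.compositionality comp_def flip: prod_mset_prod_list)
    finally show ?thesis ..
  qed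
  show ?thesis
  proof (rule that[of "image_mset cmod (mset as)"])
    show "energy G = (\<Sum>a\<in>#image_mset cmod (mset as). a)"
      unfolding energy_eq[OF vs] A_def[symmetric] as(1) pr by simp
    show "size (image_mset cmod (mset as)) = card (verts G)"
      using as(2) vs distinct_card[OF vs(1)] by (simp add: n_def)
  qed (use prod in auto)
qed

section \<open>From digraphs to adjacency relations\<close>

lemma (in graph) cyc_imp_cycle:
  assumes c: "cyc (\<lambda>u v. (u, v) \<in> arcs_ends G) (verts G) c"
  shows "cyc_edges c \<in> cycle_edge_sets G"
proof -
  define arc where "arc = (\<lambda>(u, v). SOME e. e \<in> arcs G \<and> tail G e = u \<and> head G e = v)"
  have arc: "arc (u, v) \<in> arcs G" "tail G (arc (u, v)) = u" "head G (arc (u, v)) = v" if "(u, v) \<in>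
      arcs_ends G" for u v
  proof -
    have "\<exists>e. e \<in> arcs G \<and> tail G e = u \<and> head G e = v" using that by (auto simp:
        arcs_ends_conv)
    from someI_ex[OF this] show "arc (u, v) \<in> arcs G" "tail G (arc (u, v)) = u" "head G (arc (u, v)) = v"
      by (auto simp: arc_def)
  qed
  obtain u xs where cx: "c = u # xs" using c by (cases c) (auto simp: cyc_def)
  define p where "p = map arc (zip c (rotate1 c))"
  have E: "(a, b) \<in> arcs_ends G" if "(a, b) \<in> set (zip c (rotate1 c))" for a b
    using c that by (auto simp: cyc_def)
  have len: "length p = length c" "3 \<le> length p" using c by (auto simp: p_def cyc_def)
  have pne: "p \<noteq> []" using len by auto
  have casl: "cas w (map arc (zip (w # ps) (ps @ [z]))) z"
    if "\<forall>(a, b)\<in>set (zip (w # ps) (ps @ [z])). (a, b) \<in> arcs_ends G" for w ps z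
    using that by (induction ps arbitrary: w) (auto simp: arc)
  have cas: "cas u p u"
    unfolding p_def cx rotate1.simps by (rule casl) (use E[unfolded cx rotate1.simps] in blast)
  have heads: "map (head G) p = rotate1 c"
  proof -
    have "map (head G) p = map snd (zip c (rotate1 c))"
      unfolding p_def map_map by (intro map_cong refl) (auto simp: arc E)
    thus ?thesis by simp
  qed
  have "awalk_verts u p = tail G (hd p) # map (head G) p"
    using awalk_verts_conv'[OF cas] pne by simp
  hence dist: "distinct (tl (awalk_verts u p))" using c by (simp add: heads cyc_def)
  have "set p \<subseteq> arcs G" using arc E by (auto simp: p_def)
  moreover have "u \<in> verts G" using c cx by (auto simp: cyc_def)
  ultimately have "cycle p" unfolding cycle_def awalk_def using cas dist pne by blast
  moreover have "(\<lambda>e. {tail G e, head G e}) ` set p = cyc_edges c"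
    unfolding p_def cyc_edges_def set_map image_image
    by (intro image_cong refl) (auto simp: arc E)
  ultimately show ?thesis using len unfolding cycle_edge_sets_def by blast
qed

lemma (in graph) cycle_imp_cyc:
  assumes p: "cycle p" "3 \<le> length p"
  shows "cyc (\<lambda>u v. (u, v) \<in> arcs_ends G) (verts G) (map (tail G) p)"
proof -
  from p(1) obtain u where u: "awalk u p u" "distinct (tl (awalk_verts u p))" "p \<noteq> []"
    by (auto simp: cycle_def)
  have cas: "cas u p u" using u by (simp add: awalk_def)
  have v1: "awalk_verts u p = tail G (hd p) # map (head G) p"
    using u awalk_verts_conv'[OF cas] by simp
  have dist: "distinct (map (head G) p)" using u v1 by simp
  have hd: "tail G (hd p) = head G (last p)"
    using awhd_if_cas[OF cas] awlast_if_cas[OF cas] v1 u(3) by (simp add: last_map)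
  have eq: "map (tail G) p @ [head G (last p)] = tail G (hd p) # map (head G) p"
    using v1 u(3) by (simp add: awalk_verts_conv)
  obtain e q where pe: "p = e # q" using u(3) by (cases p) auto
  have rot: "rotate1 (map (tail G) p) = map (head G) p"
    using eq hd unfolding pe by simp
  have arcs: "set p \<subseteq> arcs G" using u by (auto simp: awalk_def)
  have "zip (map (tail G) p) (map (head G) p) = map (\<lambda>e. (tail G e, head G e)) p"
    by (simp add: zip_map_map zip_same_conv_map)
  moreover have "distinct (map (tail G) p)" using dist rot by (metis distinct1_rotate)
  ultimately show ?thesis
    using p(2) arcs wellformed unfolding cyc_def rot by (auto simp: arcs_ends_conv)
qed

lemma unicyclic_imp_rel:
  assumes "unicyclic G"
  shows "unicyclic_rel (\<lambda>u v. (u, v) \<in> arcs_ends G) (verts G)"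
    and "\<exists>c. cyc (\<lambda>u v. (u, v) \<in> arcs_ends G) (verts G) c"
proof -
  interpret graph G using assms by (simp add: unicyclic_def)
  let ?E = "\<lambda>u v. (u, v) \<in> arcs_ends G"
  have u1: "\<exists>!C. C \<in> cycle_edge_sets G" and co: "connected G" using assms by (simp_all add:
      unicyclic_def)
  have sc: "strongly_connected G" using co by (rule symmetric_connected_imp_strongly_connected[OF sym_arcs])
  show "unicyclic_rel ?E (verts G)"
  proof unfold_locales
    show "(b, a) \<in> arcs_ends G" if "(a, b) \<in> arcs_ends G" for a b
      using sym_arcs that by (auto simp: symmetric_def dest: symD)
    show "(a, a) \<notin> arcs_ends G" for a using no_loops by (auto simp: arcs_ends_conv)
    show "finite (verts G)" by simp
    show "cyc_edges c = cyc_edges d" if "cyc ?E (verts G) c" "cyc ?E (verts G) d" for c d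
      using cyc_imp_cycle that u1 by blast
    show "reach ?E (verts G) a b" if "a \<in> verts G" "b \<in> verts G" for a b
    proof -
      have "a \<rightarrow>\<^sup>*\<^bsub>G\<^esub> b" using sc that by auto
      hence "(a, b) \<in> rtrancl_on (verts G) (arcs_ends G)" by (simp add: reachable_def)
      thus ?thesis
      proof (induction rule: rtrancl_on_induct)
        case (step y z)
        have yz: "reach ?E (verts G) y z" using step by (intro reach_edge) (auto intro: adj_in_verts)
        show ?case using step.IH yz by (rule reach_trans)
      qed auto
    qed
  qed
  obtain p where "cycle p" "3 \<le> length p" using u1 by (auto simp: cycle_edge_sets_def)
  thus "\<exists>c. cyc ?E (verts G) c" using cycle_imp_cyc by blast
qed

text \<open>In the absence of parallel arcs an arc is determined by its two ends, so the map on
  vertices alone induces the map on arcs.\<close>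

lemma digraph_iso_cycle_with_path:
  assumes "graph G" and ps: "distinct ps" "set ps = verts G" "length ps = n"
    and adj: "\<And>i j. i < n \<Longrightarrow> j < n \<Longrightarrow> (ps ! i, ps ! j) \<in> arcs_ends G
        \<longleftrightarrow> (i, j) \<in> arcs (cycle_with_path n l)"
    and l: "3 \<le> l" "l < n"
  shows "digraph_iso G (cycle_with_path n l)"
proof -
  interpret graph G by fact
  interpret H: graph "cycle_with_path n l" by (rule graph_cycle_with_path[OF l])
  define f where "f v = (THE i. i < n \<and> ps ! i = v)" for v
  have f: "f (ps ! i) = i" if "i < n" for i
    unfolding f_def using that ps by (intro the_equality) (auto simp: nth_eq_iff_index_eq)
  have ex: "\<exists>i<n. v = ps ! i" if "v \<in> verts G" for v using that ps by (metis in_set_conv_nth)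
  define h where "h = \<lparr>iso_verts = f, iso_arcs = (\<lambda>e. (f (tail G e), f (head G e))),
      iso_head = snd, iso_tail = fst\<rparr>"
  have inj: "inj_on f (verts G)" using ex f by (metis inj_onI)
  have "inj_on (\<lambda>e. (f (tail G e), f (head G e))) (arcs G)"
  proof (rule inj_onI)
    fix e1 e2 assume e: "e1 \<in> arcs G" "e2 \<in> arcs G" "(f (tail G e1), f (head G e1)) = (f (tail G
        e2), f (head G e2))"
    hence "tail G e1 = tail G e2" "head G e1 = head G e2" using inj by (auto dest: inj_onD)
    thus "e1 = e2" using e no_multi_arcs by (auto simp: arc_to_ends_def)
  qed
  hence "digraph_isomorphism h"
    unfolding digraph_isomorphism_def h_def using inj wf_digraph_axioms by simp
  moreover have "cycle_with_path n l = app_iso h G"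
  proof -
    have "f ` verts G = {..<n}" using ps f ex by (force simp: image_iff in_set_conv_nth)
    moreover have "(\<lambda>e. (f (tail G e), f (head G e))) ` arcs G = arcs (cycle_with_path n l)" (is
        "?L = ?R")
    proof (intro equalityI subsetI)
      fix y assume "y \<in> ?L"
      then obtain e where e: "e \<in> arcs G" "y = (f (tail G e), f (head G e))" by auto
      obtain i j where ij: "i < n" "j < n" "tail G e = ps ! i" "head G e = ps ! j"
        using ex e(1) by (meson wellformed)
      have "(tail G e, head G e) \<in> arcs_ends G" using e(1) by (auto simp: arcs_ends_conv)
      hence "(ps ! i, ps ! j) \<in> arcs_ends G" using ij by simp
      thus "y \<in> ?R" using adj ij e f by simp
    next
      fix y assume y: "y \<in> ?R"
      obtain i j where y': "y = (i, j)" by (cases y)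
      have ij: "i < n" "j < n" using H.wellformed[OF y] by (auto simp: y' cycle_with_path_simps)
      hence "(ps ! i, ps ! j) \<in> arcs_ends G" using adj y y' by simp
      then obtain e where "e \<in> arcs G" "tail G e = ps ! i" "head G e = ps ! j" by (auto simp:
          arcs_ends_conv)
      thus "y \<in> ?L" using f ij y' by (force simp: image_iff)
    qed
    ultimately show ?thesis
      by (intro pre_digraph.equality) (simp_all add: app_iso_def h_def cycle_with_path_simps)
  qed
  ultimately show ?thesis unfolding digraph_iso_def by blast
qed

lemma cmod_mdet_cycle_with_path:
  assumes "7 \<le> n" "0 < x"
  shows "cmod (mdet x (\<lambda>u v. (u, v) \<in> arcs_ends (cycle_with_path n 6)) (verts (cycle_with_path
      n 6))) = tadpole_poly x n"
proof -
  let ?G = "cycle_with_path n 6"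
  define E where "E = (\<lambda>u v. (u, v) \<in> arcs_ends ?G)"
  define V where "V = verts ?G"
  have V: "V = {..<n}" by (simp add: V_def cycle_with_path_simps)
  interpret unicyclic_rel E V
    unfolding E_def V_def by (rule unicyclic_imp_rel[OF unicyclic_cycle_with_path(1)]) (use assms in auto)
  have E: "E a b \<longleftrightarrow> (a, b) \<in> arcs ?G" for a b by (simp add: E_def
      cycle_with_path_simps)
  have cyc: "cyc E V (0 # 1 # [2, 3, 4, 5])"
    using assms unfolding cyc_Cons_iff V E by (auto simp: cycle_with_path_arcs)
  define E' where "E' = (\<lambda>p q. E p q \<and> {p, q} \<noteq> {0, 1})"
  interpret E': simple_rel E'
    by unfold_locales (auto simp: E'_def insert_commute irrefl intro: sym)
  have f': "forest_on E' V" unfolding E'_def by (rule forest_delete_edge[OF cyc cyc_edges_hd])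
  have fS: "forest_on E (V - S)" if "0 \<in> S" for S
    by (rule forest_subset[OF forest_delete_vertex[OF cyc, of 0]]) (use that in auto)
  have suc: "successively E [6..<n]"
    by (auto simp: successively_conv_nth E cycle_with_path_arcs)
  \<comment> \<open>Without the edge from 0 to 1, the graph is a single path around the hexagon to 0
    and then out along the tail.\<close>
  have sE': "successively E' ([1, 2, 3, 4, 5, 0] @ [6..<n])"
  proof -
    have "successively E' [6..<n]" using suc by (rule successively_mono) (auto simp: E'_def doubleton_eq_iff)
    moreover have "successively E' [1, 2, 3, 4, 5, 0]"
      by (auto simp: E'_def E cycle_with_path_arcs doubleton_eq_iff)
    moreover have "E' 0 6" by (auto simp: E'_def E cycle_with_path_arcs doubleton_eq_iff)
    ultimately show ?thesis using assms by (subst successively_append_iff) auto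
  qed
  have "matching_poly x E' V = path_poly x (length ([1, 2, 3, 4, 5, 0] @ [6..<n]))"
    by (rule E'.matching_poly_path[OF f' _ _ sE']) (use assms in \<open>auto simp: V\<close>)
  moreover have "length ([1, 2, 3, 4, 5, 0] @ [6..<n]) = n" using assms by simp
  ultimately have 1: "matching_poly x E' V = path_poly x n" by metis
  have V01: "V - {0, 1} = {2, 3, 4, 5} \<union> {6..<n}" and VC: "V - set (0 # 1 # [2, 3, 4, 5]) = {6..<n}"
    using assms by (auto simp: V)
  have f1: "forest_on E ({2, 3, 4, 5} \<union> {6..<n})" using fS[of "{0, 1}"] V01 by simp
  have p6: "matching_poly x E {6..<n} = path_poly x (n - 6)"
    using matching_poly_path[of "{6..<n}" "[6..<n]" x] forest_subset[OF f1 Un_upper2] suc by simp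
  have "matching_poly x E {2, 3, 4, 5} = path_poly x (length [2::nat, 3, 4, 5])"
    by (rule matching_poly_path[OF forest_subset[OF f1 Un_upper1]]) (auto simp: E cycle_with_path_arcs)
  moreover have "length [2::nat, 3, 4, 5] = 4" by simp
  ultimately have p4: "matching_poly x E {2, 3, 4, 5} = path_poly x 4" by metis
  have 2: "matching_poly x E (V - {0, 1}) = path_poly x 4 * path_poly x (n - 6)"
    unfolding V01 p4[symmetric] p6[symmetric]
    by (rule matching_poly_disjoint[OF f1]) (auto simp: E cycle_with_path_arcs)
  have "mdet x E V = of_real (matching_poly x E' V + matching_poly x E (V - {0, 1}))
    + 2 * (- \<i>) ^ length [2::nat, 3, 4, 5] * of_real (matching_poly x E (V - set (0 # 1 # [2, 3, 4, 5])))"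
    using unicyclic_mdet[OF cyc, of x] unfolding E'_def by simp
  also have "\<dots> = of_real (tadpole_poly x n)"
    unfolding 1 2 VC p6 by (simp add: tadpole_poly_def algebra_simps)
  finally have "cmod (mdet x E V) = \<bar>tadpole_poly x n\<bar>" by (simp only: norm_of_real real_norm_def)
  thus ?thesis using tadpole_poly_pos[OF assms(2), of n] unfolding E_def V_def by simp
qed

section \<open>The maximal energy\<close>

text \<open>The weak comparison is applied to the padded multisets \<open>A + R\<close> and
  \<open>S + B\<close>; strictness comes entirely from the gap between \<open>S\<close> and
  \<open>R\<close>.\<close>

lemma sum_less_by_certificate:
  fixes A B R S :: "real multiset"
  assumes nn: "\<And>a. a \<in># A + B + R + S \<Longrightarrow> 0 \<le> a"
    and size: "size A = size B" "size R = size S" and less: "(\<Sum>s\<in>#S. s) < (\<Sum>r\<in>#R. r)"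
    and le: "\<And>x::real. 0 < x \<Longrightarrow> (\<Prod>a\<in>#A. x\<^sup>2 + a\<^sup>2) *
        (\<Prod>r\<in>#R. x\<^sup>2 + r\<^sup>2) \<le> (\<Prod>s\<in>#S. x\<^sup>2 + s\<^sup>2) *
            (\<Prod>b\<in>#B. x\<^sup>2 + b\<^sup>2)"
  shows "(\<Sum>a\<in>#A. a) < (\<Sum>b\<in>#B. b)"
proof -
  have "(\<Sum>a\<in>#A + R. a) \<le> (\<Sum>b\<in>#S + B. b)"
    by (rule coulson_compare(1)) (use nn size le in auto)
  thus ?thesis using less by simp
qed

lemma prod_mset_list: "(\<Prod>a\<in>#mset (map f ks). x\<^sup>2 + a\<^sup>2) = (\<Prod>k\<leftarrow>ks.
    x\<^sup>2 + (f k)\<^sup>2)" for x :: real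
  by (simp add: image_mset.compositionality comp_def flip: prod_mset_prod_list)

text \<open>Here \<open>t\<close> and \<open>t'\<close> stand for the squared tadpole value at
  \<open>n\<close> and at the base index, \<open>k\<close> and \<open>k'\<close> for the bounds of
  the competing graph at the same two indices.\<close>

lemma mult_le_chain:
  fixes a r k t k' t' s b :: real
  assumes "0 \<le> a" "0 \<le> r" "0 \<le> t'" "0 \<le> k'" "0 \<le> b" "0 \<le> t"
    and "a \<le> k" "r \<le> t'" "t' * k \<le> t * k'" "k' \<le> s" "t \<le> b"
  shows "a * r \<le> s * b"
proof -
  have "a * r \<le> k * t'" using assms by (intro mult_mono) auto
  also have "\<dots> \<le> k' * t" using assms by (simp add: mult.commute)
  also have "\<dots> \<le> s * b" using assms by (intro mult_mono) auto
  finally show ?thesis .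
qed

section \<open>From the base indices to all larger \<open>n\<close>\<close>

lemma tadpole_triangle_iterate:
  assumes "0 < x" "odd n" "17 \<le> n"
  shows "(tadpole_poly x 17)\<^sup>2 * triangle_poly x n \<le> (tadpole_poly x n)\<^sup>2 * triangle_poly x
      17"
proof -
  define k where "k = (n - 17) div 2"
  have n: "n = 17 + 2 * k" using assms by (simp add: k_def)
  have tp: "0 < triangle_poly x j" for j
    unfolding triangle_poly_def by (intro add_pos_pos zero_less_power mult_pos_pos path_poly_pos[OF
        assms(1)]) simp
  have "(\<lambda>k. (tadpole_poly x (17 + 2 * k))\<^sup>2) 0 * (\<lambda>k. triangle_poly x (17 + 2 * k)) k
      \<le> (\<lambda>k. (tadpole_poly x (17 + 2 * k))\<^sup>2) k * (\<lambda>k. triangle_poly x (17 + 2 *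
          k)) 0"
  proof (rule ratio_mono_iterate)
    fix k
    show "0 < (tadpole_poly x (17 + 2 * k))\<^sup>2" by (rule zero_less_power[OF tadpole_poly_pos[OF
        assms(1)]])
    show "0 < triangle_poly x (17 + 2 * k)" by (rule tp)
    have e: "17 + 2 * Suc k = 17 + 2 * k + 2" "17 + 2 * k = 7 + 2 * k + 10" "odd (17 + 2 * k)" by simp_all
    show "(tadpole_poly x (17 + 2 * k))\<^sup>2 * triangle_poly x (17 + 2 * Suc k)
      \<le> (tadpole_poly x (17 + 2 * Suc k))\<^sup>2 * triangle_poly x (17 + 2 * k)"
      unfolding e(1) using triangle_ratio[OF assms(1) e(2,3)]
      by (simp only: mult.commute[of "triangle_poly _ _"])
  qed
  thus ?thesis by (simp add: n)
qed

lemma tadpole_path_iterate: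
  assumes "0 < x" "odd n" "17 \<le> n"
  shows "tadpole_poly x 17 * path_poly x (n - 1) \<le> tadpole_poly x n * path_poly x 16"
proof -
  define k where "k = (n - 17) div 2"
  have n: "n = 17 + 2 * k" using assms by (simp add: k_def)
  have "(\<lambda>k. tadpole_poly x (17 + 2 * k)) 0 * (\<lambda>k. path_poly x (17 + 2 * k - 1)) k
      \<le> (\<lambda>k. tadpole_poly x (17 + 2 * k)) k * (\<lambda>k. path_poly x (17 + 2 * k - 1)) 0"
  proof (rule ratio_mono_iterate)
    fix k
    show "0 < tadpole_poly x (17 + 2 * k)" by (rule tadpole_poly_pos[OF assms(1)])
    show "0 < path_poly x (17 + 2 * k - 1)" by (rule path_poly_pos[OF assms(1)])
    have e: "17 + 2 * Suc k = 17 + 2 * k + 2" "17 + 2 * k = 7 + 2 * k + 10" "odd (17 + 2 * k)" by simp_all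
    show "tadpole_poly x (17 + 2 * k) * path_poly x (17 + 2 * Suc k - 1)
      \<le> tadpole_poly x (17 + 2 * Suc k) * path_poly x (17 + 2 * k - 1)"
      unfolding e(1) by (rule tadpole_ratio_path[OF assms(1) e(2,3)])
  qed
  thus ?thesis by (simp add: n)
qed

lemma tadpole_cycle_iterate:
  assumes "0 < x" "even n" "14 \<le> n"
  shows "tadpole_poly x 14 * (path_poly x n + path_poly x (n - 2) + 2)
    \<le> tadpole_poly x n * (path_poly x 14 + path_poly x 12 + 2)"
proof -
  define k where "k = (n - 14) div 2"
  have n: "n = 14 + 2 * k" using assms by (simp add: k_def)
  let ?G = "\<lambda>n. path_poly x n + path_poly x (n - 2) + 2"
  have "(\<lambda>k. tadpole_poly x (14 + 2 * k)) 0 * (\<lambda>k. ?G (14 + 2 * k)) k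
      \<le> (\<lambda>k. tadpole_poly x (14 + 2 * k)) k * (\<lambda>k. ?G (14 + 2 * k)) 0"
  proof (rule ratio_mono_iterate)
    fix k
    show "0 < tadpole_poly x (14 + 2 * k)" by (rule tadpole_poly_pos[OF assms(1)])
    show "0 < ?G (14 + 2 * k)" by (intro add_pos_pos path_poly_pos[OF assms(1)]) simp
    have e: "14 + 2 * Suc k = 14 + 2 * k + 2" "14 + 2 * k = 4 + 2 * k + 10" "even (14 + 2 * k)" by simp_all
    show "tadpole_poly x (14 + 2 * k) * ?G (14 + 2 * Suc k) \<le> tadpole_poly x (14 + 2 * Suc k) * ?G (14
        + 2 * k)"
      unfolding e(1) by (rule tadpole_ratio_cycle[OF assms(1) e(2,3)])
  qed
  thus ?thesis by (simp add: n)
qed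


lemma even_cycle_certificate:
  obtains R S :: "real multiset" where "size R = size S" "\<And>a. a \<in># R + S \<Longrightarrow> 0 \<le> a"
    "(\<Sum>s\<in>#S. s) < (\<Sum>r\<in>#R. r)"
    "\<And>x::real. 0 < x \<Longrightarrow> (\<Prod>r\<in>#R. x\<^sup>2 + r\<^sup>2) \<le> (tadpole_poly x
        14)\<^sup>2"
    "\<And>x::real. 0 < x \<Longrightarrow> (path_poly x 14 + path_poly x 12 + 2)\<^sup>2 \<le>
        (\<Prod>s\<in>#S. x\<^sup>2 + s\<^sup>2)"
proof -
  let ?f = "\<lambda>k::real. k / 10^4"
  let ?r = "[2973, 8454, 10000, 12534, 15747, 18675, 21582]"
  let ?s = "[20000, 18020, 18020, 12470, 12470, 4451, 4451]"
  \<comment> \<open>Each list enters twice because squared moduli are compared.\<close>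
  let ?R = "mset (map ?f ?r) + mset (map ?f ?r)"
  let ?S = "mset (map ?f ?s) + mset (map ?f ?s)"
  have sq: "(\<Prod>a\<in>#mset (map ?f ks) + mset (map ?f ks). x\<^sup>2 + a\<^sup>2) =
      (\<Prod>k\<leftarrow>ks. x\<^sup>2 + (?f k)\<^sup>2)\<^sup>2" for ks and x :: real
    unfolding image_mset_union prod_mset_Un prod_mset_list by (simp only: power2_eq_square)
  show ?thesis
  proof (rule that[of ?R ?S])
    show "size ?R = size ?S" "(\<Sum>s\<in>#?S. s) < (\<Sum>r\<in>#?R. r)" by simp_all
    show "0 \<le> a" if "a \<in># ?R + ?S" for a using that by auto
    fix x :: real assume x: "0 < x"
    have pos: "0 \<le> (\<Prod>k\<leftarrow>ks. x\<^sup>2 + (?f k)\<^sup>2)" for ks by (induction ks) auto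
    show "(\<Prod>r\<in>#?R. x\<^sup>2 + r\<^sup>2) \<le> (tadpole_poly x 14)\<^sup>2"
      unfolding sq by (rule power_mono[OF tadpole_14_ge[OF x] pos])
    have "0 \<le> path_poly x 14 + path_poly x 12 + 2"
      using path_poly_pos[OF x, of 14] path_poly_pos[OF x, of 12] by linarith
    thus "(path_poly x 14 + path_poly x 12 + 2)\<^sup>2 \<le> (\<Prod>s\<in>#?S. x\<^sup>2 + s\<^sup>2)"
      unfolding sq by (rule power_mono[OF cycle_14_le[OF x]])
  qed
qed

lemma odd_certificate:
  obtains R S T :: "real multiset" where "size R = size S" "size R = size T" "\<And>a. a \<in># R + S + T
      \<Longrightarrow> 0 \<le> a"
    "(\<Sum>s\<in>#S. s) < (\<Sum>r\<in>#R. r)" "(\<Sum>s\<in>#T. s) < (\<Sum>r\<in>#R. r)"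
    "\<And>x::real. 0 < x \<Longrightarrow> (\<Prod>r\<in>#R. x\<^sup>2 + r\<^sup>2) \<le> (tadpole_poly x
        17)\<^sup>2"
    "\<And>x::real. 0 < x \<Longrightarrow> (x\<^sup>2 + 4) * (path_poly x 16)\<^sup>2 \<le>
        (\<Prod>s\<in>#S. x\<^sup>2 + s\<^sup>2)"
    "\<And>x::real. 0 < x \<Longrightarrow> triangle_poly x 17 \<le> (\<Prod>s\<in>#T. x\<^sup>2 + s\<^sup>2)"
proof -
  let ?f = "\<lambda>k::real. k / 10^4"
  let ?r = "[4590, 8775, 9999, 12119, 14795, 17320, 19241, 21584]"
  let ?s = "[19660, 18650, 17005, 14781, 12053, 8915, 5474, 1846]"
  let ?t = "[1083, 3224, 5265, 7261, 7261, 9882, 9883, 14687, 14691, 14694, 14695, 14698, 19281, 19305,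
      19359, 19560, 21923]"
  \<comment> \<open>The entry 0 comes from the factor \<open>x\<close> of the odd tadpole, the entry
    2 of \<open>?S\<close> from the factor \<open>x^2 + 4\<close> of the odd cycle.
    \<open>?T\<close> is not doubled, as \<open>triangle_poly\<close> already bounds a
    square.\<close>
  let ?R = "add_mset 0 (mset (map ?f ?r) + mset (map ?f ?r))"
  let ?S = "add_mset 2 (mset (map ?f ?s) + mset (map ?f ?s))"
  let ?T = "mset (map ?f ?t)"
  have sq: "(\<Prod>a\<in>#add_mset b (mset (map ?f ks) + mset (map ?f ks)). x\<^sup>2 + a\<^sup>2)
      = (x\<^sup>2 + b\<^sup>2) * (\<Prod>k\<leftarrow>ks. x\<^sup>2 + (?f k)\<^sup>2)\<^sup>2" for ks b
          and x :: real
    unfolding image_mset_add_mset prod_mset.add_mset image_mset_union prod_mset_Un prod_mset_list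
    by (simp only: power2_eq_square)
  show ?thesis
  proof (rule that[of ?R ?S ?T])
    show "size ?R = size ?S" "size ?R = size ?T" by simp_all
    show "(\<Sum>s\<in>#?S. s) < (\<Sum>r\<in>#?R. r)" "(\<Sum>s\<in>#?T. s) < (\<Sum>r\<in>#?R. r)" by
        simp_all
    show "0 \<le> a" if "a \<in># ?R + ?S + ?T" for a using that by auto
    fix x :: real assume x: "0 < x"
    have pos: "0 \<le> (\<Prod>k\<leftarrow>ks. x\<^sup>2 + (?f k)\<^sup>2)" for ks by (induction ks) auto
    have "(x * (\<Prod>k\<leftarrow>?r. x\<^sup>2 + (?f k)\<^sup>2))\<^sup>2 \<le> (tadpole_poly x
        17)\<^sup>2"
      by (rule power_mono[OF tadpole_17_ge[OF x] mult_nonneg_nonneg[OF less_imp_le[OF x] pos]])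
    thus "(\<Prod>r\<in>#?R. x\<^sup>2 + r\<^sup>2) \<le> (tadpole_poly x 17)\<^sup>2"
      unfolding sq power_mult_distrib by (simp only: zero_power2 add_0_right)
    have "(path_poly x 16)\<^sup>2 \<le> (\<Prod>k\<leftarrow>?s. x\<^sup>2 + (?f k)\<^sup>2)\<^sup>2"
      by (rule power_mono[OF path_16_le[OF x] less_imp_le[OF path_poly_pos[OF x]]])
    hence "(x\<^sup>2 + 2\<^sup>2) * (path_poly x 16)\<^sup>2 \<le> (x\<^sup>2 + 2\<^sup>2) *
        (\<Prod>k\<leftarrow>?s. x\<^sup>2 + (?f k)\<^sup>2)\<^sup>2"
      by (rule mult_left_mono) simp
    moreover have "(2::real)\<^sup>2 = 4" by simp
    ultimately show "(x\<^sup>2 + 4) * (path_poly x 16)\<^sup>2 \<le> (\<Prod>s\<in>#?S. x\<^sup>2 +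
        s\<^sup>2)"
      unfolding sq by (simp only:)
    show "triangle_poly x 17 \<le> (\<Prod>s\<in>#?T. x\<^sup>2 + s\<^sup>2)"
      unfolding prod_mset_list by (rule triangle_17_le[OF x])
  qed
qed

theorem theorem1p4:
  fixes n :: nat and G :: "('a, 'b) pre_digraph"
  assumes "16 \<le> n"
    and "unicyclic G" and "card (verts G) = n"
    and "\<not> digraph_iso G (cycle_with_path n 6)"
  shows "energy G < energy (cycle_with_path n 6)"
proof -
  let ?H = "cycle_with_path n 6"
  let ?E = "\<lambda>u v. (u, v) \<in> arcs_ends G"
  let ?m = "\<lambda>x. cmod (mdet x ?E (verts G))"
  interpret graph G using assms(2) by (simp add: unicyclic_def)
  interpret unicyclic_rel ?E "verts G" by (rule unicyclic_imp_rel[OF assms(2)])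
  obtain c where c: "cyc ?E (verts G) c" using unicyclic_imp_rel(2)[OF assms(2)] by blast
  obtain A where A: "energy G = (\<Sum>a\<in>#A. a)" "size A = card (verts G)" "\<And>a. a \<in># A
      \<Longrightarrow> 0 \<le> a"
    "\<And>x. (\<Prod>a\<in>#A. x\<^sup>2 + a\<^sup>2) = (?m x)\<^sup>2"
    using energy_spectrum[OF graph_axioms] by metis
  have gH: "graph ?H" by (rule graph_cycle_with_path) (use assms(1) in auto)
  obtain B where B: "energy ?H = (\<Sum>a\<in>#B. a)" "size B = card (verts ?H)" "\<And>a. a \<in># B
      \<Longrightarrow> 0 \<le> a"
    "\<And>x. (\<Prod>a\<in>#B. x\<^sup>2 + a\<^sup>2) = (cmod (mdet x (\<lambda>u v. (u, v) \<in>
        arcs_ends ?H) (verts ?H)))\<^sup>2"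
    using energy_spectrum[OF gH] by metis
  have pB: "(\<Prod>a\<in>#B. x\<^sup>2 + a\<^sup>2) = (tadpole_poly x n)\<^sup>2" if "0 < x" for x
    using B(4)[of x] cmod_mdet_cycle_with_path[of n x] that assms(1) by simp
  have size: "size A = size B" using A(2) B(2) assms(3) by (simp add: cycle_with_path_simps)
  have notad: "\<not> is_tadpole"
  proof
    assume is_tadpole
    then obtain ps where ps: "distinct ps" "set ps = verts G"
      "\<forall>i<n. \<forall>j<n. ?E (ps ! i) (ps ! j) \<longleftrightarrow> (i, j) \<in> arcs ?H"
      unfolding is_tadpole_def assms(3) by blast
    have "length ps = n" using ps distinct_card[OF ps(1)] assms(3) by simp
    hence "digraph_iso G ?H"
      using ps assms(1) by (intro digraph_iso_cycle_with_path[OF graph_axioms]) auto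
    thus False using assms(4) by simp
  qed
  have strict: ?thesis if "\<And>x. 0 < x \<Longrightarrow> (?m x)\<^sup>2 < (tadpole_poly x n)\<^sup>2"
    unfolding A(1) B(1)
    by (rule coulson_compare(2)[OF A(3) B(3) size]) (use that A(4) pB in \<open>auto intro:
        less_imp_le\<close>)
  \<comment> \<open>\<open>t\<close> and \<open>k\<close> are the values at the base index of the
    squared tadpole polynomial and of the bound for the competing graph; \<open>h\<close> is that
    bound at \<open>n\<close>.\<close>
  have cert: ?thesis
    if "size R = size S" "\<And>a. a \<in># R + S \<Longrightarrow> 0 \<le> a" "(\<Sum>s\<in>#S. s) <
        (\<Sum>r\<in>#R. r)"
      and t: "\<And>x. 0 < x \<Longrightarrow> (\<Prod>r\<in>#R. x\<^sup>2 + r\<^sup>2) \<le> t x"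
      and k: "\<And>x. 0 < x \<Longrightarrow> k x \<le> (\<Prod>s\<in>#S. x\<^sup>2 + s\<^sup>2)"
          "\<And>x. 0 < x \<Longrightarrow> 0 \<le> k x"
      and ratio: "\<And>x. 0 < x \<Longrightarrow> (?m x)\<^sup>2 \<le> h x" "\<And>x. 0 < x
          \<Longrightarrow> t x * h x \<le> (tadpole_poly x n)\<^sup>2 * k x"
    for R S :: "real multiset" and t k h :: "real \<Rightarrow> real"
    unfolding A(1) B(1)
  proof (rule sum_less_by_certificate)
    show "0 \<le> a" if "a \<in># A + B + R + S" for a using that \<open>\<And>a. a \<in># R + S
        \<Longrightarrow> 0 \<le> a\<close> A(3) B(3) by auto
    show "size A = size B" "size R = size S" "(\<Sum>s\<in>#S. s) < (\<Sum>r\<in>#R. r)" by fact+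
    fix x :: real assume x: "0 < x"
    have r: "0 < (\<Prod>r\<in>#R. x\<^sup>2 + r\<^sup>2)" by (rule prod_mset_sq_pos[OF x])
    show "(\<Prod>a\<in>#A. x\<^sup>2 + a\<^sup>2) * (\<Prod>r\<in>#R. x\<^sup>2 + r\<^sup>2) \<le>
        (\<Prod>s\<in>#S. x\<^sup>2 + s\<^sup>2) * (\<Prod>b\<in>#B. x\<^sup>2 + b\<^sup>2)"
      unfolding A(4) pB[OF x]
      by (rule mult_le_chain[where t' = "t x" and k = "h x" and t = "(tadpole_poly x n)\<^sup>2" and k' =
          "k x"])
        (use r t[OF x] k[OF x] ratio[OF x] in auto)
  qed
  show ?thesis
  proof (cases "set c = verts G")
    case False
    show ?thesis
    proof (cases "even (length c)")
      case True
      show ?thesis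
      proof (rule strict)
        fix x :: real assume "0 < x"
        hence "?m x < tadpole_poly x n"
          using even_cycle_bound[OF c False True _ notad] assms(1,3) by simp
        thus "(?m x)\<^sup>2 < (tadpole_poly x n)\<^sup>2" by (intro power_strict_mono) auto
      qed
    next
      case odd: False
      have le: "(?m x)\<^sup>2 \<le> triangle_poly x n" if "0 < x" for x
        using odd_cycle_bound[OF c False odd _ that] assms(1,3) by simp
      show ?thesis
      proof (cases "even n")
        case True
        show ?thesis
        proof (rule strict)
          fix x :: real assume x: "0 < x"
          have "n = (n - 10) + 10" using assms(1) by simp
          from triangle_less_tadpole[OF x this True] le[OF x] show "(?m x)\<^sup>2 < (tadpole_poly x
            n)\<^sup>2" by simp
        qed
      next
        case oddn: False
        hence n17: "17 \<le> n" using assms(1) by (cases "n = 16") auto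
        obtain R S T where cert3: "size R = size S" "size R = size T" "\<And>a. a \<in># R + S + T
            \<Longrightarrow> 0 \<le> a"
          "(\<Sum>s\<in>#S. s) < (\<Sum>r\<in>#R. r)" "(\<Sum>s\<in>#T. s) < (\<Sum>r\<in>#R. r)"
          "\<And>x::real. 0 < x \<Longrightarrow> (\<Prod>r\<in>#R. x\<^sup>2 + r\<^sup>2) \<le>
            (tadpole_poly x 17)\<^sup>2"
          "\<And>x::real. 0 < x \<Longrightarrow> (x\<^sup>2 + 4) * (path_poly x 16)\<^sup>2 \<le>
            (\<Prod>s\<in>#S. x\<^sup>2 + s\<^sup>2)"
          "\<And>x::real. 0 < x \<Longrightarrow> triangle_poly x 17 \<le> (\<Prod>s\<in>#T. x\<^sup>2 +
            s\<^sup>2)"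
          by (rule odd_certificate, rule that) blast+
        show ?thesis
        proof (rule cert[OF cert3(2) _ cert3(5,6,8)])
          show "0 \<le> a" if "a \<in># R + T" for a using that cert3(3) by auto
          show "0 \<le> triangle_poly x 17" for x by (simp add: triangle_poly_def)
          fix x :: real assume x: "0 < x"
          show "(?m x)\<^sup>2 \<le> triangle_poly x n" by (rule le[OF x])
          show "(tadpole_poly x 17)\<^sup>2 * triangle_poly x n \<le> (tadpole_poly x n)\<^sup>2 *
            triangle_poly x 17"
            by (rule tadpole_triangle_iterate[OF x oddn n17])
        qed
      qed
    qed
  next
    case True
    show ?thesis
    proof (cases "even n")
      case even: True
      obtain R S where cert2: "size R = size S" "\<And>a. a \<in># R + S \<Longrightarrow> 0 \<le> a"
          "(\<Sum>s\<in>#S. s) < (\<Sum>r\<in>#R. r)"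
        "\<And>x::real. 0 < x \<Longrightarrow> (\<Prod>r\<in>#R. x\<^sup>2 + r\<^sup>2) \<le>
            (tadpole_poly x 14)\<^sup>2"
        "\<And>x::real. 0 < x \<Longrightarrow> (path_poly x 14 + path_poly x 12 + 2)\<^sup>2 \<le>
            (\<Prod>s\<in>#S. x\<^sup>2 + s\<^sup>2)"
        by (rule even_cycle_certificate, rule that) blast+
      show ?thesis
      proof (rule cert[OF cert2])
        fix x :: real assume x: "0 < x"
        show "(?m x)\<^sup>2 \<le> (path_poly x n + path_poly x (n - 2) + 2)\<^sup>2"
          using full_cycle_bound(1)[OF c True x] assms(3) by (intro power_mono) auto
        have "(tadpole_poly x 14 * (path_poly x n + path_poly x (n - 2) + 2))\<^sup>2
            \<le> (tadpole_poly x n * (path_poly x 14 + path_poly x 12 + 2))\<^sup>2"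
          using tadpole_cycle_iterate[OF x even] assms(1) path_poly_pos[OF x] tadpole_poly_pos[OF x]
          by (intro power_mono mult_nonneg_nonneg add_nonneg_nonneg) (auto intro: less_imp_le)
        thus "(tadpole_poly x 14)\<^sup>2 * (path_poly x n + path_poly x (n - 2) + 2)\<^sup>2
            \<le> (tadpole_poly x n)\<^sup>2 * (path_poly x 14 + path_poly x 12 + 2)\<^sup>2"
          by (simp only: power_mult_distrib)
      qed auto
    next
      case oddn: False
      hence n17: "17 \<le> n" using assms(1) by (cases "n = 16") auto
      obtain R S T where cert3: "size R = size S" "size R = size T" "\<And>a. a \<in># R + S + T
          \<Longrightarrow> 0 \<le> a"
          "(\<Sum>s\<in>#S. s) < (\<Sum>r\<in>#R. r)" "(\<Sum>s\<in>#T. s) < (\<Sum>r\<in>#R. r)"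
          "\<And>x::real. 0 < x \<Longrightarrow> (\<Prod>r\<in>#R. x\<^sup>2 + r\<^sup>2) \<le>
            (tadpole_poly x 17)\<^sup>2"
          "\<And>x::real. 0 < x \<Longrightarrow> (x\<^sup>2 + 4) * (path_poly x 16)\<^sup>2 \<le>
            (\<Prod>s\<in>#S. x\<^sup>2 + s\<^sup>2)"
          "\<And>x::real. 0 < x \<Longrightarrow> triangle_poly x 17 \<le> (\<Prod>s\<in>#T. x\<^sup>2 +
            s\<^sup>2)"
          by (rule odd_certificate, rule that) blast+
      show ?thesis
      proof (rule cert[OF cert3(1) _ cert3(4,6,7)])
        show "0 \<le> a" if "a \<in># R + S" for a using that cert3(3) by auto
        fix x :: real assume x: "0 < x"
        show "(?m x)\<^sup>2 \<le> (x\<^sup>2 + 4) * (path_poly x (n - 1))\<^sup>2"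
          using full_cycle_bound(2)[OF c True x] oddn assms(1,3) cycle_odd_eq[of n x] by simp
        have "(tadpole_poly x 17 * path_poly x (n - 1))\<^sup>2 \<le> (tadpole_poly x n * path_poly x
            16)\<^sup>2"
          using tadpole_path_iterate[OF x oddn n17] path_poly_pos[OF x] tadpole_poly_pos[OF x]
          by (intro power_mono mult_nonneg_nonneg) (auto intro: less_imp_le)
        hence "(x\<^sup>2 + 4) * (tadpole_poly x 17 * path_poly x (n - 1))\<^sup>2 \<le> (x\<^sup>2 + 4) *
            (tadpole_poly x n * path_poly x 16)\<^sup>2"
          by (intro mult_left_mono) auto
        thus "(tadpole_poly x 17)\<^sup>2 * ((x\<^sup>2 + 4) * (path_poly x (n - 1))\<^sup>2)
            \<le> (tadpole_poly x n)\<^sup>2 * ((x\<^sup>2 + 4) * (path_poly x 16)\<^sup>2)"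
          by (simp only: power_mult_distrib mult_ac)
      qed auto
    qed
  qed
qed

end
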